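(* Let $F$ be a field of characteristic different from $2$ and let $(A,\sigma)$ be an $F$-algebra with involution. The following statements are equivalent: (1) $(A,\sigma)$ is formally real; (2) there are $a\in \mathrm{Sym}(A,\sigma)^\times$ and $P\in X_F$ such that $\mathcal{C}_P(a)\cap -\mathcal{C}_P(a)=\{0\}$; (3) there is $b\in \mathrm{Sym}(A,\sigma)^\times$ such that the hermitian form $\langle b\rangle_\sigma$ is strongly anisotropic.
   Context: $X_F$ is the (possibly empty) set of orderings of $F$, an ordering being a subset $P\subseteq F$ with $P+P\subseteq P$, $P\cdot P\subseteq P$, $P\cup -P=F$ and $P\cap -P=\{0\}$ (so $0\in P$). An $F$-algebra with involution is a pair $(A,\sigma)$ where $A$ is a finite-dimensional simple $F$-algebra whose centre $K=Z(A)$ is a field and $\sigma:A\to A$ is an involution (additive, $\sigma(xy)=\sigma(y)\sigma(x)$, $\sigma^2=\mathrm{id}$) such that $F=K\cap \mathrm{Sym}(A,\sigma)$, where $\mathrm{Sym}(A,\sigma)=\{a\in A\mid \sigma(a)=a\}$. $\mathrm{Sym}(A,\sigma)^\times$ is the set of invertible elements of $A$ lying in $\mathrm{Sym}(A,\sigma)$. A prepositive cone on $(A,\sigma)$ is a subset $\mathcal{P}\subseteq \mathrm{Sym}(A,\sigma)$ such that (P1) $\mathcal{P}\neq\varnothing$; (P2) $\mathcal{P}+\mathcal{P}\subseteq\mathcal{P}$; (P3) $\sigma(a)\cdot\mathcal{P}\cdot a\subseteq\mathcal{P}$ for every $a\in A$; (P4) $\mathcal{P}_F:=\{u\in F\mid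 u\mathcal{P}\subseteq\mathcal{P}\}$ is an ordering on $F$; (P5) $\mathcal{P}\cap-\mathcal{P}=\{0\}$. $(A,\sigma)$ is formally real if it has at least one prepositive cone. For $P\in X_F$ and $a\in\mathrm{Sym}(A,\sigma)$, $\mathcal{C}_P(a):=\{\sum_{i=1}^k u_i\sigma(x_i)ax_i\mid k\in\mathbb{N},\ u_i\in P,\ x_i\in A\}$. $\langle b\rangle_\sigma$ is the hermitian form $A\times A\to A$, $(x,y)\mapsto\sigma(x)by$. For $\ell\in\mathbb{N}=\{1,2,\dots\}$, $\ell\times h$ is the orthogonal sum of $\ell$ copies of $h$. A form $h$ is isotropic if $h(x,x)=0$ for some $x\neq 0$; it is strongly anisotropic if $\ell\times h$ is not isotropic for every $\ell\in\mathbb{N}$. *)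

theory Defs
  imports Complex_Main "HOL-Library.Function_Algebras"
begin

definition field_ordering :: "'f::field set \<Rightarrow> bool" where
  "field_ordering P \<longleftrightarrow>
     (\<forall>x\<in>P. \<forall>y\<in>P. x + y \<in> P) \<and>
     (\<forall>x\<in>P. \<forall>y\<in>P. x * y \<in> P) \<and>
     P \<union> uminus ` P = UNIV \<and>
     P \<inter> uminus ` P = {0}"

definition two_sided_ideal :: "'a::ring_1 set \<Rightarrow> bool" where
  "two_sided_ideal I \<longleftrightarrow>
     0 \<in> I \<and> (\<forall>x\<in>I. \<forall>y\<in>I. x + y \<in> I) \<and> (\<forall>a. \<forall>x\<in>I. a * x \<in> I \<and> x * a \<in> I)"

definition center :: "'a::ring_1 set" where
  "center = {z. \<forall>x. z * x = x * z}"

definition Sym :: "('a \<Rightarrow> 'a) \<Rightarrow> 'a set" where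
  "Sym \<sigma> = {a. \<sigma> a = a}"

definition Sym_units :: "('a::ring_1 \<Rightarrow> 'a) \<Rightarrow> 'a set" where
  "Sym_units \<sigma> = {a \<in> Sym \<sigma>. \<exists>b. a * b = 1 \<and> b * a = 1}"

text \<open>The base field is identified with its image \<open>{scale c 1 | c}\<close> in the algebra; this
  is the reading of \<open>F = K \<inter> Sym(A,\<sigma>)\<close> in the last assumption. That \<open>A \<noteq> 0\<close> is part of
  the class \<open>ring_1\<close>. Linearity of \<open>\<sigma>\<close> over the base field is not assumed: it follows from
  that last assumption.\<close>

locale algebra_with_involution = vector_space scale
  for scale :: "'f::field \<Rightarrow> 'a::ring_1 \<Rightarrow> 'a" +
  fixes \<sigma> :: "'a \<Rightarrow> 'a"
  assumes scale_mult_left: "scale c x * y = scale c (x * y)"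
    and scale_mult_right: "x * scale c y = scale c (x * y)"
    and finite_dimensional: "\<exists>B. finite B \<and> span B = UNIV"
    and simple: "two_sided_ideal (I :: 'a set) \<Longrightarrow> I = {0} \<or> I = UNIV"
    and center_field: "(z :: 'a) \<in> center \<Longrightarrow> z \<noteq> 0 \<Longrightarrow> \<exists>w\<in>center. z * w = 1"
    and involution_add: "\<sigma> (x + y) = \<sigma> x + \<sigma> y"
    and involution_mult: "\<sigma> (x * y) = \<sigma> y * \<sigma> x"
    and involution_self_inverse: "\<sigma> (\<sigma> x) = x"
    and base_field: "range (\<lambda>c. scale c 1) = center \<inter> Sym \<sigma>"

definition cone_field :: "('f \<Rightarrow> 'a \<Rightarrow> 'a) \<Rightarrow> 'a set \<Rightarrow> 'f set" where
  "cone_field scale \<P> = {u. \<forall>x\<in>\<P>. scale u x \<in> \<P>}"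

definition prepositive_cone ::
    "('f::field \<Rightarrow> 'a::ring_1 \<Rightarrow> 'a) \<Rightarrow> ('a \<Rightarrow> 'a) \<Rightarrow> 'a set \<Rightarrow> bool" where
  "prepositive_cone scale \<sigma> \<P> \<longleftrightarrow>
     \<P> \<subseteq> Sym \<sigma> \<and>
     \<P> \<noteq> {} \<and>
     (\<forall>x\<in>\<P>. \<forall>y\<in>\<P>. x + y \<in> \<P>) \<and>
     (\<forall>a. \<forall>x\<in>\<P>. \<sigma> a * x * a \<in> \<P>) \<and>
     field_ordering (cone_field scale \<P>) \<and>
     \<P> \<inter> uminus ` \<P> = {0}"

definition formally_real :: "('f::field \<Rightarrow> 'a::ring_1 \<Rightarrow> 'a) \<Rightarrow> ('a \<Rightarrow> 'a) \<Rightarrow> bool" where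
  "formally_real scale \<sigma> \<longleftrightarrow> (\<exists>\<P>. prepositive_cone scale \<sigma> \<P>)"

definition cone_gen ::
    "('f \<Rightarrow> 'a::ring_1 \<Rightarrow> 'a) \<Rightarrow> ('a \<Rightarrow> 'a) \<Rightarrow> 'f set \<Rightarrow> 'a \<Rightarrow> 'a set" where
  "cone_gen scale \<sigma> P a =
     {(\<Sum>i\<in>{1..k}. scale (u i) (\<sigma> (x i) * a * x i)) |k u x.
        k \<ge> (1::nat) \<and> (\<forall>i\<in>{1..k}. u i \<in> P)}"

definition rank_one_form :: "('a \<Rightarrow> 'a) \<Rightarrow> 'a::ring_1 \<Rightarrow> 'a \<Rightarrow> 'a \<Rightarrow> 'a" where
  "rank_one_form \<sigma> b = (\<lambda>x y. \<sigma> x * b * y)"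

text \<open>A form is given by its underlying module \<open>M\<close>, a subset of a type, and a map \<open>h\<close>. The
  module \<open>M\<^sup>l\<close> is encoded by the functions on \<open>nat\<close> that vanish outside \<open>{1..l}\<close>, so that
  the zero vector is the zero function of \<open>HOL-Library.Function_Algebras\<close>.\<close>

definition isotropic :: "'m::zero set \<Rightarrow> ('m \<Rightarrow> 'm \<Rightarrow> 'a::zero) \<Rightarrow> bool" where
  "isotropic M h \<longleftrightarrow> (\<exists>x\<in>M. x \<noteq> 0 \<and> h x x = 0)"

definition multiple_module :: "nat \<Rightarrow> 'm::zero set \<Rightarrow> (nat \<Rightarrow> 'm) set" where
  "multiple_module l M = {v. (\<forall>i\<in>{1..l}. v i \<in> M) \<and> (\<forall>i. i \<notin> {1..l} \<longrightarrow> v i = 0)}"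

definition multiple_form ::
    "nat \<Rightarrow> ('m \<Rightarrow> 'm \<Rightarrow> 'a::comm_monoid_add) \<Rightarrow> (nat \<Rightarrow> 'm) \<Rightarrow> (nat \<Rightarrow> 'm) \<Rightarrow> 'a" where
  "multiple_form l h = (\<lambda>v w. \<Sum>i\<in>{1..l}. h (v i) (w i))"

definition strongly_anisotropic ::
    "'m::zero set \<Rightarrow> ('m \<Rightarrow> 'm \<Rightarrow> 'a::comm_monoid_add) \<Rightarrow> bool" where
  "strongly_anisotropic M h \<longleftrightarrow>
     (\<forall>l\<ge>1. \<not> isotropic (multiple_module l M) (multiple_form l h))"

end

theory Submission
  imports Defs "HOL-Analysis.Product_Vector" "HOL-Computational_Algebra.Polynomial"
begin

text \<open>
  If \<open>c\<close> lies in a prepositive cone, then \<open>\<sigma>(x) c x = 0\<close> implies \<open>c x = 0\<close>. Hence annihilators intersect when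
  elements of the cone are added, and an element with the smallest annihilator is a unit \<open>c\<close>;
  it satisfies (2) and (3). Conversely, the set \<open>C\<^sub>P(a)\<close> of (2) is a cone.

  For (3) \<open>\<Longrightarrow>\<close> (1) we may replace \<open>\<sigma>\<close> by the adjoint involution of \<open>\<langle>b\<rangle>\<^sub>\<sigma>\<close>, so that \<open>b = 1\<close>, and pass to a
  corner \<open>D = e A e\<close> that is a division algebra. Let \<open>L\<close> be a maximal commutative set of symmetric
  elements of \<open>D\<close> and \<open>C\<close> its centralizer in \<open>D\<close>. As \<open>\<langle>1\<rangle>\<close> is strongly anisotropic, the field \<open>L\<close> has an
  ordering that makes all \<open>\<sigma>(x) x\<close> with \<open>x \<in> C\<close> positive. For an \<open>L\<close>-bimodule projection \<open>\<phi> : D \<rightarrow> L\<close> and a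
  symmetric \<open>d \<in> D\<close>, let \<open>\<mu>(d)\<close> be the signature of the quadratic form \<open>x \<mapsto> \<phi>(\<sigma>(x) d x)\<close> on the right
  \<open>L\<close>-space \<open>D\<close>. Because \<open>\<langle>c, d\<rangle> \<cong> \<langle>c + d, c\<inverse> + d\<inverse>\<rangle>\<close>, the elements of maximal signature are closed under
  addition, and they form a cone unless \<open>\<mu> = 0\<close>.

  Suppose \<open>\<mu> = 0\<close>. Let \<open>f\<close> be the minimal polynomial of some \<open>a \<in> L\<close>, and let \<open>X\<close> and \<open>Y\<close> be the left and right
  multiplication by \<open>a\<close>. By Thom's lemma, elements \<open>X \<noteq> Y\<close> with \<open>f(X) = f(Y) = 0\<close> cannot give the same signs
  to all derivatives of \<open>f\<close>. Twisting the form by the Pfister form of the \<open>\<plusminus>f\<^sup>(\<^sup>k\<^sup>)(X)\<close>, \<open>\<plusminus>f\<^sup>(\<^sup>k\<^sup>)(Y)\<close> therefore kills the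
  signature outside the centralizer of \<open>a\<close>, so that the signature on this centralizer is zero as
  well. Repeating this for generators of \<open>L\<close> leads to \<open>C\<close>, where the form is positive definite.
\<close>

section \<open>Signatures over an ordered subfield\<close>

context finite_dimensional_vector_space
begin

lemma dim_le_dimension: "dim S \<le> card Basis"
  using dim_subset_UNIV dimension_def by simp

lemma dim_disjoint_le:
  assumes "subspace S" "subspace T" "S \<inter> T \<subseteq> {0}" "S \<subseteq> U" "T \<subseteq> U" "subspace U"
  shows "dim S + dim T \<le> dim U"
proof -
  have "dim (S \<inter> T) = 0"
    using assms(3) by simp
  then have "dim {x + y |x y. x \<in> S \<and> y \<in> T} = dim S + dim T"
    using dim_sums_Int[OF assms(1,2)] by linarith
  moreover have "{x + y |x y. x \<in> S \<and> y \<in> T} \<subseteq> U"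
    using assms by (auto intro: subspace_add)
  ultimately show ?thesis
    using dim_subset[of "{x + y |x y. x \<in> S \<and> y \<in> T}" U] by linarith
qed

lemma dim_direct_sum:
  assumes "subspace S" "subspace T" "S \<inter> T \<subseteq> {0}" "\<And>u. u \<in> U \<longleftrightarrow> (\<exists>s\<in>S. \<exists>t\<in>T. u = s + t)"
  shows "dim U = dim S + dim T"
proof -
  have U: "U = {x + y |x y. x \<in> S \<and> y \<in> T}"
    using assms(4) by blast
  moreover have "dim (S \<inter> T) = 0"
    using assms(3) by simp
  ultimately show ?thesis
    unfolding U using dim_sums_Int[OF assms(1,2)] by linarith
qed

text \<open>By \<open>sq\<close>, the map is injective on T(U), so T(T(U)) = T(U) by dimension.
  Hence T u = T(T y) for some y in U, and u - T y lies in the kernel. Later \<open>sq\<close> comes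
  from Fitting's lemma, from definiteness or from separability.\<close>

lemma kernel_image_decomposition:
  assumes U: "subspace U" and T: "Vector_Spaces.linear scale scale T" "\<And>x. x \<in> U \<Longrightarrow> T x \<in> U"
    and sq: "\<And>x. x \<in> U \<Longrightarrow> T (T x) = 0 \<Longrightarrow> T x = 0" and u: "u \<in> U"
  shows "\<exists>k\<in>U. \<exists>y\<in>U. T k = 0 \<and> u = k + T y"
proof -
  interpret pp: finite_dimensional_vector_space_pair scale Basis scale Basis
    by unfold_locales
  interpret T: Vector_Spaces.linear scale scale T by (rule T(1))
  have im: "subspace (T ` U)" using T.subspace_image U .
  have IU: "T ` U \<subseteq> U" using T(2) by auto
  have sp: "span (T ` U) = T ` U" using im span_eq_iff by blast
  have inj: "inj_on T (span (T ` U))"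
  proof (rule inj_onI)
    fix x y assume "x \<in> span (T ` U)" "y \<in> span (T ` U)" and eq: "T x = T y"
    then have "x - y \<in> T ` U" using sp im subspace_diff by auto
    then obtain z where z: "z \<in> U" "x - y = T z" by auto
    have "T (T z) = 0" using eq by (simp add: T.diff flip: z(2))
    then have "T z = 0" by (rule sq[OF z(1)])
    then show "x = y" using z(2) by simp
  qed
  have "T ` T ` U = T ` U"
  proof (rule subspace_dim_equal)
    show "dim (T ` U) \<le> dim (T ` T ` U)"
      using pp.dim_image_eq[OF T(1) inj] by simp
  qed (use im T.subspace_image IU in auto)
  then obtain y where y: "y \<in> U" "T u = T (T y)" using u by blast
  then have "u - T y \<in> U" "T (u - T y) = 0" using U u T(2) subspace_diff by (auto simp: T.diff)
  then show ?thesis using y(1) by (metis diff_add_cancel)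
qed

end

locale fd_algebra = finite_dimensional_vector_space scale Basis
  for scale :: "'f::field \<Rightarrow> 'a::ring_1 \<Rightarrow> 'a" and Basis :: "'a set" +
  assumes scale_mult_left: "scale c x * y = scale c (x * y)"
    and scale_mult_right: "x * scale c y = scale c (x * y)"

text \<open>The unit \<open>e\<close> of the field \<open>L\<close> is an idempotent, in general
  different from 1, because \<open>L\<close> will lie in a corner of the algebra. \<open>P\<close>
  is the set of nonnegative elements; vector spaces over \<open>L\<close> arise by right
  multiplication.\<close>

locale ordered_subfield = fd_algebra scale Basis
  for scale :: "'f::field \<Rightarrow> 'a::ring_1 \<Rightarrow> 'a" and Basis :: "'a set" +
  fixes L P :: "'a set" and e :: 'a
  assumes L_unit: "e \<in> L" and e_nonzero: "e \<noteq> 0"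
    and L_add: "s \<in> L \<Longrightarrow> t \<in> L \<Longrightarrow> s + t \<in> L"
    and L_mult: "s \<in> L \<Longrightarrow> t \<in> L \<Longrightarrow> s * t \<in> L"
    and L_scale: "t \<in> L \<Longrightarrow> scale c t \<in> L"
    and L_comm: "s \<in> L \<Longrightarrow> t \<in> L \<Longrightarrow> s * t = t * s"
    and L_one: "t \<in> L \<Longrightarrow> t * e = t"
    and L_inverse: "t \<in> L \<Longrightarrow> t \<noteq> 0 \<Longrightarrow> \<exists>s\<in>L. t * s = e"
    and P_add: "s \<in> P \<Longrightarrow> t \<in> P \<Longrightarrow> s + t \<in> P"
    and P_mult: "s \<in> P \<Longrightarrow> t \<in> P \<Longrightarrow> s * t \<in> P"
    and P_total: "t \<in> L \<Longrightarrow> t \<in> P \<or> - t \<in> P"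
    and P_sub: "P \<subseteq> L"
    and P_anti: "t \<in> P \<Longrightarrow> - t \<in> P \<Longrightarrow> t = 0"
begin

lemma L_zero: "0 \<in> L"
  using L_scale[OF L_unit, of 0] by simp

lemma L_minus: "t \<in> L \<Longrightarrow> - t \<in> L"
  using L_scale[of t "-1"] by simp

lemma P_zero: "0 \<in> P"
  using P_total[OF L_zero] by simp

lemma P_square: "t \<in> L \<Longrightarrow> t * t \<in> P"
  using P_total[of t] P_mult[of t t] P_mult[of "-t" "-t"] by auto

lemma L_no_zero_divisors:
  assumes "s \<in> L" "t \<in> L" "s * t = 0" "s \<noteq> 0"
  shows "t = 0"
proof -
  obtain r where "r \<in> L" "s * r = e"
    using L_inverse assms by blast
  then have "r * (s * t) = t"
    using assms L_comm L_one by (metis mult.assoc)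
  then show ?thesis
    using assms by simp
qed

lemma P_inverse:
  assumes "t \<in> P" "t \<noteq> 0"
  obtains s where "s \<in> P" "t * s = e"
proof -
  obtain s where s: "s \<in> L" "t * s = e"
    using L_inverse assms P_sub by blast
  then have "s = t * (s * s)"
    using L_one[OF s(1)] L_comm[OF L_unit s(1)] by (simp flip: mult.assoc)
  then have "s \<in> P"
    using P_mult[OF assms(1) P_square[OF s(1)]] by simp
  then show ?thesis
    using that s by blast
qed

lemma P_add_nonzero: "s \<in> P \<Longrightarrow> t \<in> P \<Longrightarrow> s \<noteq> 0 \<Longrightarrow> s + t \<noteq> 0"
  by (metis P_anti add_eq_0_iff)

lemma P_mult_nonzero: "s \<in> P \<Longrightarrow> t \<in> P \<Longrightarrow> s \<noteq> 0 \<Longrightarrow> t \<noteq> 0 \<Longrightarrow> s * t \<noteq> 0"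
  using L_no_zero_divisors P_sub by blast

section \<open>Quadratic forms over the ordered field \<open>L\<close> and Sylvester's law of
  inertia\<close>

definition lsub :: "'a set \<Rightarrow> bool" where
  "lsub W \<longleftrightarrow> subspace W \<and> (\<forall>x\<in>W. \<forall>t\<in>L. x * t \<in> W) \<and> (\<forall>x\<in>W. x * e = x)"

definition sform :: "'a set \<Rightarrow> ('a \<Rightarrow> 'a \<Rightarrow> 'a) \<Rightarrow> bool" where
  "sform U q \<longleftrightarrow> (\<forall>x\<in>U. \<forall>y\<in>U. q x y \<in> L \<and> q y x = q x y \<and>
     (\<forall>z\<in>U. q (x + z) y = q x y + q z y) \<and> (\<forall>t\<in>L. q (x * t) y = t * q x y))"

definition posd :: "('a \<Rightarrow> 'a \<Rightarrow> 'a) \<Rightarrow> 'a set \<Rightarrow> bool" where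
  "posd q W \<longleftrightarrow> (\<forall>x\<in>W. x \<noteq> 0 \<longrightarrow> q x x \<in> P \<and> q x x \<noteq> 0)"

text \<open>Dimensions are taken over the base field, so this is the usual index of positivity times
  the degree of \<open>L\<close>. The factor is harmless: only sums, comparisons and the vanishing
  of signatures matter.\<close>

definition pidx :: "'a set \<Rightarrow> ('a \<Rightarrow> 'a \<Rightarrow> 'a) \<Rightarrow> nat" where
  "pidx U q = Max (dim ` {W. lsub W \<and> W \<subseteq> U \<and> posd q W})"

definition sgn_form :: "'a set \<Rightarrow> ('a \<Rightarrow> 'a \<Rightarrow> 'a) \<Rightarrow> int" where
  "sgn_form U q = int (pidx U q) - int (pidx U (\<lambda>x y. - q x y))"

lemma lsub_subspace: "lsub W \<Longrightarrow> subspace W"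
  by (simp add: lsub_def)

lemma lsub_zero: "lsub {0}"
  by (simp add: lsub_def)

lemma lsub_sum:
  assumes "lsub V" "lsub W"
  shows "lsub {x + y |x y. x \<in> V \<and> y \<in> W}"
proof -
  have "subspace {x + y |x y. x \<in> V \<and> y \<in> W}"
    using assms subspace_sums lsub_def by blast
  then show ?thesis
    using assms unfolding lsub_def by (auto simp: distrib_right) blast
qed

lemma sform_subset: "sform U q \<Longrightarrow> V \<subseteq> U \<Longrightarrow> sform V q"
  unfolding sform_def by blast

lemma sform_uminus: "sform U q \<Longrightarrow> sform U (\<lambda>x y. - q x y)"
  unfolding sform_def using L_minus by auto

lemma pidx_ge:
  assumes "lsub W" "W \<subseteq> U" "posd q W"
  shows "dim W \<le> pidx U q"
  unfolding pidx_def
proof (rule Max_ge)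
  show "finite (dim ` {W. lsub W \<and> W \<subseteq> U \<and> posd q W})"
    by (rule finite_subset[of _ "{..card Basis}"]) (auto simp: dim_le_dimension)
qed (use assms in blast)

lemma pidx_attained:
  assumes "0 \<in> U"
  obtains W where "lsub W" "W \<subseteq> U" "posd q W" "dim W = pidx U q"
proof -
  let ?S = "dim ` {W. lsub W \<and> W \<subseteq> U \<and> posd q W}"
  have "finite ?S"
    by (rule finite_subset[of _ "{..card Basis}"]) (auto simp: dim_le_dimension)
  moreover have "{0} \<in> {W. lsub W \<and> W \<subseteq> U \<and> posd q W}"
    using assms lsub_zero by (simp add: posd_def)
  then have "?S \<noteq> {}" by blast
  ultimately have "Max ?S \<in> ?S" by (rule Max_in)
  then show ?thesis
    using that unfolding pidx_def by auto
qed

lemma pidx_le: "lsub U \<Longrightarrow> pidx U q \<le> dim U"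
  by (metis dim_subset lsub_subspace pidx_attained subspace_0)

lemma pidx_cong:
  assumes "\<And>x. x \<in> U \<Longrightarrow> q x x = q' x x"
  shows "pidx U q = pidx U q'"
proof -
  have "{W. lsub W \<and> W \<subseteq> U \<and> posd q W} = {W. lsub W \<and> W \<subseteq> U \<and> posd q' W}"
    using assms unfolding posd_def by (auto simp: subset_iff)
  then show ?thesis by (simp add: pidx_def)
qed

lemma sform_simps:
  assumes "sform U q" "x \<in> U" "y \<in> U"
  shows "q x y \<in> L" "q y x = q x y" "z \<in> U \<Longrightarrow> q (x + z) y = q x y + q z y"
    "t \<in> L \<Longrightarrow> q (x * t) y = t * q x y"
proof -
  have *: "q x y \<in> L \<and> q y x = q x y \<and>
     (\<forall>z\<in>U. q (x + z) y = q x y + q z y) \<and> (\<forall>t\<in>L. q (x * t) y = t * q x y)"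
    using assms unfolding sform_def by simp
  show "q x y \<in> L" "q y x = q x y" "z \<in> U \<Longrightarrow> q (x + z) y = q x y + q z y"
    "t \<in> L \<Longrightarrow> q (x * t) y = t * q x y"
    using * by auto
qed

lemma sform_right:
  assumes "sform U q" "lsub U" "x \<in> U" "y \<in> U"
  shows "z \<in> U \<Longrightarrow> q x (y + z) = q x y + q x z" "t \<in> L \<Longrightarrow> q x (y * t) = t * q x y"
    "q 0 y = 0" "q (- x) y = - q x y" "q x (- y) = - q x y"
proof -
  have m: "x \<in> U \<Longrightarrow> - x \<in> U" for x
    using assms(2) subspace_neg lsub_def by blast
  show "z \<in> U \<Longrightarrow> q x (y + z) = q x y + q x z"
    using assms sform_simps(2,3)[OF assms(1)] lsub_subspace subspace_add by metis
  show "t \<in> L \<Longrightarrow> q x (y * t) = t * q x y"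
    using assms sform_simps(2,4)[OF assms(1)] unfolding lsub_def by metis
  have 0: "q 0 y = 0" if "y \<in> U" for y
    using sform_simps(3)[OF assms(1) _ that, of 0 0] assms(2) by (simp add: lsub_def subspace_0)
  then show "q 0 y = 0" using assms by blast
  have *: "q (- x) y = - q x y" if "x \<in> U" "y \<in> U" for x y
    using sform_simps(3)[OF assms(1) that m[OF that(1)]] 0[OF that(2)] by (simp add: minus_unique)
  then show "q (- x) y = - q x y" using assms by blast
  show "q x (- y) = - q x y"
    using sform_simps(2)[OF assms(1)] * m assms by metis
qed

text \<open>Gram-Schmidt: a vector x with q(x, x) > 0 splits off and its orthogonal complement is
  treated by induction on the dimension; if there is no such x, the whole space is negative
  semidefinite. The radical of a degenerate form ends up in N.\<close>

lemma positive_decomposition: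
  assumes "lsub U" "sform U q"
  shows "\<exists>W N. lsub W \<and> lsub N \<and> W \<subseteq> U \<and> N \<subseteq> U \<and> posd q W \<and> (\<forall>x\<in>N. - q x x \<in> P) \<and>
    (\<forall>u\<in>U. \<exists>w\<in>W. \<exists>n\<in>N. u = w + n)"
  using assms
proof (induction "dim U" arbitrary: U rule: less_induct)
  case less
  note U = less.prems(1) and q = less.prems(2)
  have S: "subspace U" using U by (rule lsub_subspace)
  have q0: "q 0 0 = 0" using sform_right(3)[OF q U] subspace_0[OF S] by blast
  show ?case
  proof (cases "\<forall>x\<in>U. - q x x \<in> P")
    case True
    then show ?thesis
      using U lsub_zero subspace_0[OF S] by (intro exI[of _ "{0}"] exI[of _ U]) (auto simp: posd_def)
  next
    case False
    then obtain x where x: "x \<in> U" "- q x x \<notin> P" by blast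
    have p: "q x x \<in> P" "q x x \<noteq> 0"
      using P_total[OF sform_simps(1)[OF q x(1) x(1)]] x(2) P_zero by auto
    obtain r where r: "r \<in> P" "q x x * r = e" using P_inverse[OF p] .
    let ?X = "{x * t |t. t \<in> L}" and ?V = "{u\<in>U. q u x = 0}"
    have X: "lsub ?X"
      unfolding lsub_def
    proof (intro conjI)
      show "subspace ?X"
      proof (rule subspaceI)
        show "0 \<in> ?X" using L_zero by force
        show "a + b \<in> ?X" if "a \<in> ?X" "b \<in> ?X" for a b
          using that L_add by (auto simp flip: distrib_left)
        show "scale c a \<in> ?X" if "a \<in> ?X" for c a
          using that L_scale by (auto simp flip: scale_mult_right)
      qed
    qed (use L_mult L_one in \<open>auto simp: mult.assoc\<close>)
    have V: "lsub ?V"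
      unfolding lsub_def
    proof (intro conjI)
      have c: "scale c u = u * scale c e" if "u \<in> U" for c u
        using that U by (simp add: scale_mult_right lsub_def)
      show "subspace ?V"
      proof (rule subspaceI)
        show "0 \<in> ?V" using sform_right(3)[OF q U x(1) x(1)] subspace_0[OF S] by simp
        show "u + v \<in> ?V" if "u \<in> ?V" "v \<in> ?V" for u v
          using that sform_simps(3)[OF q _ x(1)] subspace_add[OF S] by auto
        show "scale c u \<in> ?V" if "u \<in> ?V" for c u
          using that sform_simps(4)[OF q _ x(1) L_scale[OF L_unit]] subspace_scale[OF S] by (auto simp: c)
      qed
    qed (use U sform_simps(4)[OF q _ x(1)] in \<open>auto simp: lsub_def\<close>)
    have XU: "x * t \<in> U" if "t \<in> L" for t
      using U x(1) that by (auto simp: lsub_def)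
    have "dim ?V < dim U"
    proof (rule ccontr)
      assume "\<not> dim ?V < dim U"
      then have "?V = U" by (intro subspace_dim_equal[OF lsub_subspace[OF V] S]) auto
      then show False using x(1) p(2) by blast
    qed
    then obtain W N where WN: "lsub W" "lsub N" "W \<subseteq> ?V" "N \<subseteq> ?V" "posd q W" "\<forall>x\<in>N. - q x x \<in> P"
      "\<forall>u\<in>?V. \<exists>w\<in>W. \<exists>n\<in>N. u = w + n"
      using less.hyps[OF _ V sform_subset[OF q]] by (elim meta_impE exE conjE) (auto intro: that)
    let ?W = "{y + w |y w. y \<in> ?X \<and> w \<in> W}"
    have "posd q ?W"
      unfolding posd_def
    proof (intro ballI impI)
      fix v assume "v \<in> ?W" "v \<noteq> 0"
      then obtain t w where v: "v = x * t + w" "t \<in> L" "w \<in> W" by blast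
      have w: "w \<in> U" "q w x = 0" using WN(3) v(3) by auto
      have "q v v = q (x * t) (x * t) + q (x * t) w + (q w (x * t) + q w w)"
        using sform_simps(3)[OF q XU[OF v(2)] _ w(1)] sform_right(1)[OF q U _ XU[OF v(2)] w(1)]
          subspace_add[OF S XU[OF v(2)] w(1)] XU[OF v(2)] w(1) by (simp add: v(1))
      also have "q w (x * t) = 0"
        using sform_right(2)[OF q U w(1) x(1) v(2)] w(2) by simp
      also have "q (x * t) w = 0"
        using sform_simps(4)[OF q x(1) w(1) v(2)] sform_simps(2)[OF q x(1) w(1)] w(2) by simp
      also have "q (x * t) (x * t) = t * t * q x x"
        using sform_simps(4)[OF q x(1) XU[OF v(2)] v(2)] sform_right(2)[OF q U x(1) x(1) v(2)] by (simp add: mult.assoc)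
      finally have val: "q v v = t * t * q x x + q w w" by simp
      have t: "t * t * q x x \<in> P" "t \<noteq> 0 \<Longrightarrow> t * t * q x x \<noteq> 0"
        using P_mult P_mult_nonzero P_square[OF v(2)] L_no_zero_divisors[OF v(2,2)] p by blast+
      have w: "q w w \<in> P" "w \<noteq> 0 \<Longrightarrow> q w w \<noteq> 0"
        using WN(5) v(3) P_zero q0 by (cases "w = 0"; simp add: posd_def)+
      have "t \<noteq> 0 \<or> w \<noteq> 0" using v(1) \<open>v \<noteq> 0\<close> by auto
      then have "q v v \<noteq> 0"
        using P_add_nonzero[OF t(1) w(1)] P_add_nonzero[OF w(1) t(1)] t(2) w(2) by (auto simp: val add.commute)
      then show "q v v \<in> P \<and> q v v \<noteq> 0" using P_add[OF t(1) w(1)] by (simp add: val)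
    qed
    moreover have "\<exists>w\<in>?W. \<exists>n\<in>N. u = w + n" if u: "u \<in> U" for u
    proof -
      \<comment> \<open>The coefficient of the orthogonal projection of u to x L, as r is the
        inverse of q(x, x).\<close>
      define s where "s = q u x * r"
      have s: "s \<in> L" using L_mult sform_simps(1)[OF q u x(1)] r(1) P_sub by (auto simp: s_def)
      have "r * q x x = e" using r p(1) P_sub L_comm by (metis subsetD)
      then have sx: "s * q x x = q u x"
        using L_one[OF sform_simps(1)[OF q u x(1)]] by (simp add: s_def mult.assoc)
      have m: "- (x * s) \<in> U" using subspace_neg[OF S XU[OF s]] .
      have "q (u + - (x * s)) x = 0"
        unfolding sform_simps(3)[OF q u x(1) m] sform_right(4)[OF q U XU[OF s] x(1)]
        using sx sform_simps(4)[OF q x(1) x(1) s] by simp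
      then have "u + - (x * s) \<in> ?V" using subspace_add[OF S u m] by simp
      then obtain w n where wn: "w \<in> W" "n \<in> N" "u + - (x * s) = w + n" using WN(7) by blast
      have "u = (x * s + w) + n" using wn(3) by (simp add: algebra_simps)
      moreover have "x * s + w \<in> ?W" using s wn(1) by blast
      ultimately show ?thesis using wn(2) by blast
    qed
    moreover have "?W \<subseteq> U" using XU WN(3) subspace_add[OF S] by blast
    moreover have "N \<subseteq> U" using WN(4) by blast
    ultimately show ?thesis
      using lsub_sum[OF X WN(1)] WN(2,6) by (intro exI[of _ ?W] exI[of _ N] conjI ballI) auto
  qed
qed

text \<open>Sylvester's law: a positive definite V meets the negative semidefinite N only in 0, so
  dim V is at most dim U - dim N = dim W.\<close>

lemma pidx_decomposition:
  assumes U: "lsub U" and q: "sform U q"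
  obtains W N where "lsub W" "lsub N" "W \<subseteq> U" "N \<subseteq> U" "posd q W" "\<And>x. x \<in> N \<Longrightarrow> - q x x \<in> P"
    "dim W = pidx U q" "dim W + dim N = dim U"
proof -
  obtain W N where WN: "lsub W" "lsub N" "W \<subseteq> U" "N \<subseteq> U" "posd q W" "\<And>x. x \<in> N \<Longrightarrow> - q x x \<in> P"
    "\<And>u. u \<in> U \<Longrightarrow> \<exists>w\<in>W. \<exists>n\<in>N. u = w + n"
    using positive_decomposition[OF assms] by blast
  have int: "V \<inter> N \<subseteq> {0}" if "posd q V" for V
    using that WN(6) P_anti unfolding posd_def by blast
  have eq: "dim U = dim W + dim N"
    using WN U int[OF WN(5)] lsub_subspace by (intro dim_direct_sum) (auto intro: subspace_add)
  obtain V where V: "lsub V" "V \<subseteq> U" "posd q V" "dim V = pidx U q"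
    using pidx_attained U by (metis lsub_subspace subspace_0)
  have "dim V + dim N \<le> dim U"
    using dim_disjoint_le int V WN U lsub_subspace by metis
  then have "dim W = pidx U q"
    using eq V(4) pidx_ge[OF WN(1,3,5)] by simp
  then show ?thesis using that WN eq by metis
qed

lemma pidx_zero: "pidx {0} q = 0"
  using pidx_le[OF lsub_zero, of q] by simp

lemma sform_zero: "sform {0} (\<lambda>x y. 0)"
  unfolding sform_def using L_zero by simp

text \<open>The map (x, y) -> (f x y, g x y) is an isometry from the orthogonal sum of
  \<open>q1\<close> and \<open>q2\<close> to that of \<open>q3\<close> and \<open>q4\<close>. Pairs
  of spaces replace forms on a product, since forms live on subsets of the algebra. The proof
  compares dimensions over the base field, so linearity of f and g over this field is the right
  condition.\<close>

lemma sgn_form_isometry: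
  assumes U: "lsub U1" "lsub U2" "lsub U3" "lsub U4"
    and q: "sform U1 q1" "sform U2 q2" "sform U3 q3" "sform U4 q4"
    and add: "\<And>x y x' y'. f (x + x') (y + y') = f x y + f x' y'" "\<And>x y x' y'. g (x + x') (y + y') = g x y + g x' y'"
    and scl: "\<And>c x y. f (scale c x) (scale c y) = scale c (f x y)" "\<And>c x y. g (scale c x) (scale c y) = scale c (g x y)"
    and inj: "\<And>x y. x \<in> U1 \<Longrightarrow> y \<in> U2 \<Longrightarrow> f x y = 0 \<Longrightarrow> g x y = 0 \<Longrightarrow> x = 0 \<and> y = 0"
    and into: "\<And>x y. x \<in> U1 \<Longrightarrow> y \<in> U2 \<Longrightarrow> f x y \<in> U3 \<and> g x y \<in> U4"
    and dim: "dim U1 + dim U2 = dim U3 + dim U4"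
    and iso: "\<And>x y. x \<in> U1 \<Longrightarrow> y \<in> U2 \<Longrightarrow>
      q3 (f x y) (f x y) + q4 (g x y) (g x y) = q1 x x + q2 y y"
  shows "sgn_form U1 q1 + sgn_form U2 q2 = sgn_form U3 q3 + sgn_form U4 q4"
proof -
  interpret pr: finite_dimensional_vector_space_prod scale scale Basis Basis
    by unfold_locales
  let ?M = "\<lambda>(x, y). (f x y, g x y)"
  have lin: "Vector_Spaces.linear pr.scale pr.scale ?M"
    by unfold_locales (auto simp: add scl pr.scale_def)
  interpret pp: finite_dimensional_vector_space_pair pr.scale pr.Basis_pair pr.scale pr.Basis_pair
    by unfold_locales
  have S: "subspace U1" "subspace U2" "subspace U3" "subspace U4" using U lsub_subspace by auto
  have injM: "inj_on ?M (U1 \<times> U2)"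
  proof (rule inj_onI, clarsimp)
    fix x y x' y'
    assume h: "x \<in> U1" "y \<in> U2" "x' \<in> U1" "y' \<in> U2" "f x y = f x' y'" "g x y = g x' y'"
    have "f (x - x') (y - y') = 0" "g (x - x') (y - y') = 0"
      using add(1)[of "x - x'" x' "y - y'" y'] add(2)[of "x - x'" x' "y - y'" y'] h by auto
    then show "x = x' \<and> y = y'"
      using inj[of "x - x'" "y - y'"] h S subspace_diff by auto
  qed
  have dimM: "pr.p.dim (?M ` (A \<times> B)) = dim A + dim B"
    and subM: "pr.p.subspace (?M ` (A \<times> B))"
    if "subspace A" "subspace B" "A \<subseteq> U1" "B \<subseteq> U2" for A B
  proof -
    have s: "pr.p.subspace (A \<times> B)" using pr.subspace_Times that by blast
    then have sp: "pr.p.span (A \<times> B) = A \<times> B" by (simp add: pr.p.span_eq_iff)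
    have "inj_on ?M (pr.p.span (A \<times> B))"
      unfolding sp by (rule inj_on_subset[OF injM Sigma_mono[OF that(3,4)]])
    then show "pr.p.dim (?M ` (A \<times> B)) = dim A + dim B"
      using pp.dim_image_eq[OF lin] pr.dim_Times[OF that(1,2)] by simp
    show "pr.p.subspace (?M ` (A \<times> B))"
      using s lin pp.linear_subspace_image by blast
  qed
  have im: "?M ` (A \<times> B) \<subseteq> U3 \<times> U4" if AB: "A \<subseteq> U1" "B \<subseteq> U2" for A B
  proof clarsimp
    fix x y assume "x \<in> A" "y \<in> B"
    then have "x \<in> U1" "y \<in> U2" using AB by auto
    then show "f x y \<in> U3 \<and> g x y \<in> U4" by (rule into)
  qed
  have M: "?M ` (U1 \<times> U2) = U3 \<times> U4"
  proof (rule pr.p.subspace_dim_equal)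
    show "pr.p.dim (?M ` (U1 \<times> U2)) \<ge> pr.p.dim (U3 \<times> U4)"
      using dimM S dim pr.dim_Times by simp
  qed (use subM[OF S(1,2)] S(3,4) im[of U1 U2] pr.subspace_Times in auto)
  have pidx: "pidx U1 q1 + pidx U2 q2 = pidx U3 q3 + pidx U4 q4"
    if q: "sform U1 q1" "sform U2 q2" "sform U3 q3" "sform U4 q4"
      and iso: "\<And>x y. x \<in> U1 \<Longrightarrow> y \<in> U2 \<Longrightarrow>
        q3 (f x y) (f x y) + q4 (g x y) (g x y) = q1 x x + q2 y y" for q1 q2 q3 q4
  proof -
    obtain W1 N1 where 1: "lsub W1" "lsub N1" "W1 \<subseteq> U1" "N1 \<subseteq> U1" "posd q1 W1" "\<And>x. x \<in> N1 \<Longrightarrow> - q1 x x \<in> P"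
      "dim W1 = pidx U1 q1" "dim W1 + dim N1 = dim U1"
      by (rule pidx_decomposition[OF U(1) q(1)]) (rule that; blast)
    obtain W2 N2 where 2: "lsub W2" "lsub N2" "W2 \<subseteq> U2" "N2 \<subseteq> U2" "posd q2 W2" "\<And>x. x \<in> N2 \<Longrightarrow> - q2 x x \<in> P"
      "dim W2 = pidx U2 q2" "dim W2 + dim N2 = dim U2"
      by (rule pidx_decomposition[OF U(2) q(2)]) (rule that; blast)
    obtain W3 N3 where 3: "lsub W3" "lsub N3" "W3 \<subseteq> U3" "N3 \<subseteq> U3" "posd q3 W3" "\<And>x. x \<in> N3 \<Longrightarrow> - q3 x x \<in> P"
      "dim W3 = pidx U3 q3" "dim W3 + dim N3 = dim U3"
      by (rule pidx_decomposition[OF U(3) q(3)]) (rule that; blast)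
    obtain W4 N4 where 4: "lsub W4" "lsub N4" "W4 \<subseteq> U4" "N4 \<subseteq> U4" "posd q4 W4" "\<And>x. x \<in> N4 \<Longrightarrow> - q4 x x \<in> P"
      "dim W4 = pidx U4 q4" "dim W4 + dim N4 = dim U4"
      by (rule pidx_decomposition[OF U(4) q(4)]) (rule that; blast)
    have le: "dim A + dim B + (dim C + dim D) \<le> dim U3 + dim U4"
      if h: "lsub A" "lsub B" "lsub C" "lsub D" "A \<subseteq> U1" "B \<subseteq> U2" "C \<subseteq> U3" "D \<subseteq> U4"
        and i: "\<And>x y. x \<in> A \<Longrightarrow> y \<in> B \<Longrightarrow> f x y \<in> C \<Longrightarrow> g x y \<in> D \<Longrightarrow> f x y = 0 \<and> g x y = 0" for A B C D
    proof -
      have s: "subspace A" "subspace B" "subspace C" "subspace D" using h lsub_subspace by auto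
      have "pr.p.dim (?M ` (A \<times> B)) + pr.p.dim (C \<times> D) \<le> pr.p.dim (U3 \<times> U4)"
      proof (rule pr.p.dim_disjoint_le)
        show "?M ` (A \<times> B) \<inter> C \<times> D \<subseteq> {0}" using i by (auto simp: zero_prod_def)
      qed (use subM[OF s(1,2) h(5,6)] s(3,4) S(3,4) h(7,8) im[OF h(5,6)] pr.subspace_Times in auto)
      then show ?thesis
        using dimM[OF s(1,2) h(5,6)] pr.dim_Times[OF s(3,4)] pr.dim_Times[OF S(3,4)] by simp
    qed
    have nonneg: "0 \<in> P \<and> (a \<in> P \<longrightarrow> b \<in> P \<longrightarrow> - (a + b) \<in> P \<longrightarrow> a = 0 \<and> b = 0)" for a b
      using P_zero P_add_nonzero P_add P_anti by (metis add_0)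
    have pd: "q x x \<in> P" "q x x = 0 \<Longrightarrow> x = 0" if "posd q W" "x \<in> W" "sform U q" "lsub U" for q W U x
      using that(1,2) P_zero sform_right(3)[OF that(3,4)] subspace_0[OF lsub_subspace[OF that(4)]]
      by (cases "x = 0"; simp add: posd_def)+
    note p1 = pd[OF 1(5) _ q(1) U(1)] and p2 = pd[OF 2(5) _ q(2) U(2)]
      and p3 = pd[OF 3(5) _ q(3) U(3)] and p4 = pd[OF 4(5) _ q(4) U(4)]
    have f0: "f 0 0 = 0" "g 0 0 = 0"
      using add(1)[of 0 0 0 0] add(2)[of 0 0 0 0] by auto
    \<comment> \<open>The image of the positive definite W1 x W2 meets the negative semidefinite N3
      x N4 only in 0, which bounds the index of the first sum by that of the second. Exchanging the
      signs gives the reverse inequality.\<close>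
    have "dim W1 + dim W2 + (dim N3 + dim N4) \<le> dim U3 + dim U4"
    proof (rule le)
      fix x y assume h: "x \<in> W1" "y \<in> W2" "f x y \<in> N3" "g x y \<in> N4"
      have "- (q3 (f x y) (f x y)) + - (q4 (g x y) (g x y)) \<in> P"
        using h 3(6) 4(6) P_add by blast
      then have "- (q1 x x + q2 y y) \<in> P"
        using iso[of x y] h 1(3) 2(3) by (metis add.commute minus_add_distrib subsetD)
      then show "f x y = 0 \<and> g x y = 0"
        using nonneg p1 p2 h f0 by metis
    qed (use 1 2 3 4 in auto)
    moreover have "dim N1 + dim N2 + (dim W3 + dim W4) \<le> dim U3 + dim U4"
    proof (rule le)
      fix x y assume h: "x \<in> N1" "y \<in> N2" "f x y \<in> W3" "g x y \<in> W4"
      have "- (q1 x x) + - (q2 y y) \<in> P"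
        using h 1(6) 2(6) P_add by blast
      then have "- (q3 (f x y) (f x y) + q4 (g x y) (g x y)) \<in> P"
        using iso[of x y] h 1(4) 2(4) by (metis add.commute minus_add_distrib subsetD)
      then show "f x y = 0 \<and> g x y = 0"
        using nonneg p3 p4 h by metis
    qed (use 1 2 3 4 in auto)
    ultimately show ?thesis
      using 1(7,8) 2(7,8) 3(7,8) 4(7,8) dim by linarith
  qed
  have "pidx U1 (\<lambda>x y. - q1 x y) + pidx U2 (\<lambda>x y. - q2 x y) = pidx U3 (\<lambda>x y. - q3 x y) + pidx U4 (\<lambda>x y. - q4 x y)"
  proof (rule pidx[OF q[THEN sform_uminus]])
    fix x y assume "x \<in> U1" "y \<in> U2"
    then show "- q3 (f x y) (f x y) + - q4 (g x y) (g x y) = - q1 x x + - q2 y y"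
      using iso[of x y] by (metis add.commute minus_add_distrib)
  qed
  then show ?thesis using pidx[OF q iso] by (simp add: sgn_form_def)
qed

lemma sgn_form_isometry1:
  assumes U: "lsub U" "lsub V" and q: "sform U q" "sform V p"
    and "\<And>x x'. f (x + x') = f x + f x'" "\<And>c x. f (scale c x) = scale c (f x)"
    and "\<And>x. x \<in> U \<Longrightarrow> f x = 0 \<Longrightarrow> x = 0" "\<And>x. x \<in> U \<Longrightarrow> f x \<in> V" "dim U = dim V"
    and "\<And>x. x \<in> U \<Longrightarrow> p (f x) (f x) = q x x"
  shows "sgn_form U q = sgn_form V p"
proof -
  have "sgn_form U q + sgn_form {0} (\<lambda>x y. 0) = sgn_form V p + sgn_form {0} (\<lambda>x y. 0)"
    by (rule sgn_form_isometry[OF U(1) lsub_zero U(2) lsub_zero q(1) sform_zero q(2) sform_zero,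
          where f = "\<lambda>x y. f x" and g = "\<lambda>x y. y"]) (use assms in auto)
  then show ?thesis by simp
qed

lemma sgn_form_split:
  assumes U: "lsub U" "lsub K" "lsub I" and q: "sform U q" and sub: "K \<subseteq> U" "I \<subseteq> U" and dis: "K \<inter> I \<subseteq> {0}"
    and span: "\<And>u. u \<in> U \<Longrightarrow> \<exists>x\<in>K. \<exists>y\<in>I. u = x + y" and orth: "\<And>x y. x \<in> K \<Longrightarrow> y \<in> I \<Longrightarrow> q x y = 0"
  shows "sgn_form U q = sgn_form K q + sgn_form I q"
proof -
  have S: "subspace U" "subspace K" "subspace I" using U lsub_subspace by auto
  have d: "dim U = dim K + dim I"
  proof (rule dim_direct_sum[OF S(2,3) dis])
    show "u \<in> U \<longleftrightarrow> (\<exists>s\<in>K. \<exists>t\<in>I. u = s + t)" for u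
      using span subspace_add[OF S(1) subsetD[OF sub(1)] subsetD[OF sub(2)]] by blast
  qed
  have "sgn_form K q + sgn_form I q = sgn_form U q + sgn_form {0} (\<lambda>x y. 0)"
  proof (rule sgn_form_isometry[OF U(2,3,1) lsub_zero sform_subset[OF q sub(1)] sform_subset[OF q sub(2)] q sform_zero,
          where f = "\<lambda>x y. x + y" and g = "\<lambda>x y. 0"])
    show "dim K + dim I = dim U + dim {0}" using d by simp
    fix x y assume h: "x \<in> K" "y \<in> I"
    then have hU: "x \<in> U" "y \<in> U" using sub by auto
    show "x = 0 \<and> y = 0" if "x + y = 0" "0 = (0::'a)"
    proof -
      have "x = - y" using that by (simp add: add_eq_0_iff)
      then have "x \<in> K \<inter> I" using h subspace_neg[OF S(3)] by auto
      then show ?thesis using dis \<open>x = - y\<close> by auto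
    qed
    show "x + y \<in> U \<and> 0 \<in> {0::'a}" using subspace_add[OF S(1) hU] by simp
    have "q (x + y) (x + y) = q x x + q x y + (q y x + q y y)"
      using sform_simps(3)[OF q hU(1) subspace_add[OF S(1) hU] hU(2)] sform_right(1)[OF q U(1)] hU by simp
    then show "q (x + y) (x + y) + 0 = q x x + q y y"
      using orth[OF h] sform_simps(2)[OF q hU] by simp
  qed (auto simp: algebra_simps scale_right_distrib)
  then show ?thesis
    using pidx_zero by (simp add: sgn_form_def)
qed

lemma sgn_form_bound: "lsub U \<Longrightarrow> \<bar>sgn_form U q\<bar> \<le> int (dim U)"
  using pidx_le[of U q] pidx_le[of U "\<lambda>x y. - q x y"] by (simp add: sgn_form_def)

lemma sgn_form_uminus: "sgn_form U (\<lambda>x y. - q x y) = - sgn_form U q"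
  by (simp add: sgn_form_def)

lemma sgn_form_cong:
  assumes "\<And>x. x \<in> U \<Longrightarrow> q x x = q' x x"
  shows "sgn_form U q = sgn_form U q'"
proof -
  have "pidx U q = pidx U q'" by (rule pidx_cong[OF assms])
  moreover have "pidx U (\<lambda>x y. - q x y) = pidx U (\<lambda>x y. - q' x y)"
    by (rule pidx_cong) (simp add: assms)
  ultimately show ?thesis by (simp add: sgn_form_def)
qed

lemma sgn_form_posd:
  assumes "lsub U" "posd q U"
  shows "sgn_form U q = int (dim U)"
proof -
  have "pidx U q = dim U"
    using pidx_le[OF assms(1), of q] pidx_ge[OF assms(1) subset_refl assms(2)] by linarith
  moreover obtain W where W: "lsub W" "W \<subseteq> U" "posd (\<lambda>x y. - q x y) W" "dim W = pidx U (\<lambda>x y. - q x y)"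
    using pidx_attained subspace_0[OF lsub_subspace[OF assms(1)]] by metis
  have "W \<subseteq> {0}"
    using W(2,3) assms(2) P_anti unfolding posd_def by (metis insertCI subsetD subsetI)
  then have "dim W = 0" by simp
  ultimately show ?thesis using W(4) by (simp add: sgn_form_def)
qed

end

section \<open>Rings of self-adjoint operators\<close>

text \<open>The example to come is the ring of polynomials in two variables, which act as left and
  right multiplication by one element of \<open>L\<close>.\<close>

locale ring_action = ordered_subfield scale Basis L P e
  for scale :: "'f::field \<Rightarrow> 'a::ring_1 \<Rightarrow> 'a" and Basis :: "'a set" and L P :: "'a set" and e :: 'a +
  fixes act :: "'r::comm_ring_1 \<Rightarrow> 'a \<Rightarrow> 'a"
  assumes act_add: "act (r + s) x = act r x + act s x"
    and act_mult: "act (r * s) x = act r (act s x)"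
    and act_one: "act 1 x = x"
    and act_vec_add: "act r (x + y) = act r x + act r y"
    and act_scale: "act r (scale c x) = scale c (act r x)"
    and act_L: "t \<in> L \<Longrightarrow> act r (x * t) = act r x * t"
begin

lemma act_vec_zero: "act r 0 = 0"
  using act_vec_add[of r 0 0] by simp

lemma act_zero: "act 0 x = 0"
  using act_add[of 0 0 x] by simp

lemma act_minus: "act (- r) x = - act r x"
  using act_add[of r "- r" x] act_zero[of x] by (simp add: add_eq_0_iff)

lemma act_diff: "act (r - s) x = act r x - act s x"
  using act_add[of r "- s" x] act_minus by simp

section \<open>Signatures of forms twisted by self-adjoint operators\<close>

definition rform :: "'a set \<Rightarrow> ('a \<Rightarrow> 'a \<Rightarrow> 'a) \<Rightarrow> bool" where
  "rform U q \<longleftrightarrow> lsub U \<and> sform U q \<and> (\<forall>r. \<forall>x\<in>U. act r x \<in> U) \<and>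
     (\<forall>r. \<forall>x\<in>U. \<forall>y\<in>U. q (act r x) y = q x (act r y))"

definition regular :: "'a set \<Rightarrow> 'r \<Rightarrow> bool" where
  "regular U r \<longleftrightarrow> (\<forall>x\<in>U. act r x = 0 \<longrightarrow> x = 0)"

definition sg :: "'a set \<Rightarrow> ('a \<Rightarrow> 'a \<Rightarrow> 'a) \<Rightarrow> 'r \<Rightarrow> int" where
  "sg U q r = sgn_form U (\<lambda>x y. q (act r x) y)"

text \<open>The signature of \<open>q\<close> twisted by r times the Pfister form of
  \<open>G\<close>: multiplying out the factors <1, g> gives the sum of the values of
  \<open>sg U q\<close> at r times the product of each sublist of \<open>G\<close>.\<close>

fun sgs :: "'a set \<Rightarrow> ('a \<Rightarrow> 'a \<Rightarrow> 'a) \<Rightarrow> 'r list \<Rightarrow> 'r \<Rightarrow> int" where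
  "sgs U q [] r = sg U q r"
| "sgs U q (g # G) r = sgs U q G r + sgs U q G (g * r)"

lemma rformD:
  assumes "rform U q"
  shows "lsub U" "sform U q" "x \<in> U \<Longrightarrow> act r x \<in> U"
    "x \<in> U \<Longrightarrow> y \<in> U \<Longrightarrow> q (act r x) y = q x (act r y)"
  using assms by (auto simp: rform_def)

lemma regular_mult: "rform U q \<Longrightarrow> regular U r \<Longrightarrow> regular U s \<Longrightarrow> regular U (r * s)"
  unfolding regular_def act_mult rform_def by blast

lemma regular_one: "regular U 1"
  by (simp add: regular_def act_one)

lemma regular_uminus: "regular U r \<Longrightarrow> regular U (- r)"
  by (simp add: regular_def act_minus)

lemma regular_multD: "regular U (r * s) \<Longrightarrow> regular U s"
  by (auto simp: regular_def act_mult act_vec_zero)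

lemma rform_subset:
  assumes "rform U q" "K \<subseteq> U" "lsub K" "\<And>r x. x \<in> K \<Longrightarrow> act r x \<in> K"
  shows "rform K q"
  using assms sform_subset[of U q K] by (auto simp: rform_def subset_iff)

lemma sform_act:
  assumes "rform U q"
  shows "sform U (\<lambda>x y. q (act r x) y)"
proof -
  note q = rformD[OF assms]
  show ?thesis
    unfolding sform_def
  proof (intro ballI conjI)
    fix x y assume h: "x \<in> U" "y \<in> U"
    show "q (act r x) y \<in> L" using sform_simps(1)[OF q(2)] q(3) h by blast
    show "q (act r y) x = q (act r x) y"
      using sform_simps(2)[OF q(2)] q(3,4) h by metis
    show "q (act r (x + z)) y = q (act r x) y + q (act r z) y" if "z \<in> U" for z
      using sform_simps(3)[OF q(2)] q(3) h that by (simp add: act_vec_add)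
    show "q (act r (x * t)) y = t * q (act r x) y" if "t \<in> L" for t
      using sform_simps(4)[OF q(2)] q(3) h that by (simp add: act_L)
  qed
qed

lemma sg_cong: "(\<And>x. x \<in> U \<Longrightarrow> act r x = act s x) \<Longrightarrow> sg U q r = sg U q s"
  unfolding sg_def by (rule sgn_form_cong) simp

lemma sg_bound: "rform U q \<Longrightarrow> \<bar>sg U q r\<bar> \<le> int (dim U)"
  using sgn_form_bound rformD by (simp add: sg_def)

lemma sg_uminus:
  assumes "rform U q" shows "sg U q (- r) = - sg U q r"
proof -
  have "sg U q (- r) = sgn_form U (\<lambda>x y. - q (act r x) y)"
    unfolding sg_def using sform_right(4)[OF rformD(2,1)[OF assms]] rformD(3)[OF assms]
    by (intro sgn_form_cong) (simp add: act_minus)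
  then show ?thesis by (simp add: sg_def sgn_form_uminus)
qed

text \<open>As u acts by a self-adjoint injective operator, x -> u x is an isometry between the two
  twisted forms.\<close>

lemma sg_square:
  assumes q: "rform U q" and u: "regular U u"
  shows "sg U q (u * u * r) = sg U q r"
  unfolding sg_def
proof (rule sgn_form_isometry1[where f = "act u"])
  show "q (act r (act u x)) (act u x) = q (act (u * u * r) x) x" if "x \<in> U" for x
  proof -
    have "q (act r (act u x)) (act u x) = q (act u (act r (act u x))) x"
      using rformD(3,4)[OF q] that by simp
    also have "act u (act r (act u x)) = act (u * u * r) x"
      by (metis act_mult mult.assoc mult.commute)
    finally show ?thesis .
  qed
qed (use rformD[OF q] sform_act[OF q] u in \<open>auto simp: act_vec_add act_scale regular_def\<close>)

text \<open>This is the isometry of the diagonal forms <r, s> and <r + s, r s (r + s)>, realised by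
  (x, y) -> (x + s y, x - r y). The difference of the two components is (r + s) y, so regularity of
  r + s makes the map injective.\<close>

lemma sg_relation:
  assumes q: "rform U q" and c: "regular U (r + s)"
  shows "sg U q r + sg U q s = sg U q (r + s) + sg U q (r * s * (r + s))"
proof -
  note d = rformD[OF q]
  have S: "subspace U" using d(1) by (rule lsub_subspace)
  have "sg U q (r + s) + sg U q (r * s * (r + s)) = sg U q r + sg U q s"
    unfolding sg_def
  proof (rule sgn_form_isometry[where f = "\<lambda>x y. x + act s y" and g = "\<lambda>x y. x + act (- r) y"])
    fix x y assume h: "x \<in> U" "y \<in> U"
    show "x + act s y \<in> U \<and> x + act (- r) y \<in> U"
      using h d(3) S subspace_add by blast
    show "x = 0 \<and> y = 0" if "x + act s y = 0" "x + act (- r) y = 0"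
    proof -
      have "act (r + s) y = (x + act s y) - (x + act (- r) y)"
        by (simp add: act_add act_minus)
      then have "y = 0" using that c h by (auto simp: regular_def)
      then show ?thesis using that by (simp add: act_vec_zero)
    qed
    have exp: "q (act a (x + act b y)) (x + act b y) =
      q (act a x) x + q (act (a * b) x) y + q (act (a * b) x) y + q (act (a * b * b) y) y" for a b
    proof -
      have "q (act a (x + act b y)) (x + act b y) = q (act a x + act (a * b) y) (x + act b y)"
        by (simp add: act_vec_add act_mult)
      also have "\<dots> = q (act a x) (x + act b y) + q (act (a * b) y) (x + act b y)"
        using sform_simps(3)[OF d(2)] h d(3) subspace_add[OF S] by simp
      also have "\<dots> = q (act a x) x + q (act a x) (act b y) + (q (act (a * b) y) x + q (act (a * b) y) (act b y))"
        using sform_right(1)[OF d(2,1)] h d(3) by simp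
      also have "q (act a x) (act b y) = q (act (a * b) x) y"
        using d(4)[of "act a x" y b] d(3) h by (simp add: act_mult mult.commute[of a b])
      also have "q (act (a * b) y) x = q (act (a * b) x) y"
        using d(4) sform_simps(2)[OF d(2)] h d(3) by metis
      also have "q (act (a * b) y) (act b y) = q (act (a * b * b) y) y"
        using d(4)[of "act (a * b) y" y b] d(3) h by (simp add: act_mult mult.commute[of "a * b" b])
      finally show ?thesis by (simp add: add.assoc)
    qed
    have neg: "q (act (- a) z) w = - q (act a z) w" if "z \<in> U" "w \<in> U" for a z w
      using sform_right(4)[OF d(2,1) d(3)[OF that(1)] that(2)] by (simp add: act_minus)
    have ad: "q (act (a + b) z) w = q (act a z) w + q (act b z) w" if "z \<in> U" "w \<in> U" for a b z w
      using sform_simps(3)[OF d(2)] d(3) that by (simp add: act_add)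
    have e: "r * s * (r + s) = r * s * s + s * r * r" by (simp add: algebra_simps)
    show "q (act r (x + act s y)) (x + act s y) + q (act s (x + act (- r) y)) (x + act (- r) y) =
        q (act (r + s) x) x + q (act (r * s * (r + s)) y) y"
      unfolding exp e ad[OF h(1) h(1)] ad[OF h(2) h(2)]
      using neg[OF h(1,2), of "s * r"] by (simp add: mult.commute[of s r])
  qed (use d sform_act[OF q] in \<open>auto simp: act_vec_add act_scale scale_right_distrib\<close>)
  then show ?thesis by simp
qed

lemma sgs_uminus: "rform U q \<Longrightarrow> sgs U q G (- r) = - sgs U q G r"
  by (induction G arbitrary: r) (simp_all add: sg_uminus)

lemma sgs_proportional:
  assumes "\<And>x. sg U q (a * x) = c * sg U q (b * x)"
  shows "sgs U q G (a * x) = c * sgs U q G (b * x)"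
proof (induction G arbitrary: x)
  case (Cons g G)
  then show ?case using Cons[of x] Cons[of "g * x"] by (simp add: distrib_left mult.left_commute[of g])
qed (simp add: assms)

lemma sgs_square:
  assumes "rform U q" "regular U u"
  shows "sgs U q G (u * u * r) = sgs U q G r"
  using sgs_proportional[of U q "u * u" 1 1 G r] sg_square[OF assms] by simp

lemma sgs_cong:
  assumes q: "rform U q" and eq: "\<And>x. x \<in> U \<Longrightarrow> act r x = act s x"
  shows "sgs U q G (r * x) = sgs U q G (s * x)"
proof -
  have "sg U q (r * x) = 1 * sg U q (s * x)" for x
    using sg_cong[of U "r * x" "s * x" q] eq rformD(3)[OF q] by (simp add: act_mult)
  then show ?thesis
    using sgs_proportional[of U q r 1 s G x] by simp
qed

lemma sgs_relation:
  assumes q: "rform U q" and c: "regular U (r + s)" and G: "\<And>g. g \<in> set G \<Longrightarrow> regular U g"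
  shows "sgs U q G r + sgs U q G s = sgs U q G (r + s) + sgs U q G (r * s * (r + s))"
proof -
  \<comment> \<open>The extra factor x makes the claim inductive, since each g in \<open>G\<close>
    multiplies the argument. In the base case it leaves a square x x, which does not change the
    signature.\<close>
  have "regular U x \<Longrightarrow> sgs U q G (x * r) + sgs U q G (x * s) = sgs U q G (x * (r + s)) + sgs U q G (x * (r * s * (r + s)))" for x
    using G
  proof (induction G arbitrary: x)
    case Nil
    have "regular U (x * r + x * s)"
      using regular_mult[OF q Nil(1) c] by (simp add: distrib_left)
    then have "sg U q (x * r) + sg U q (x * s) = sg U q (x * (r + s)) + sg U q (x * x * (x * (r * s * (r + s))))"
      using sg_relation[OF q, of "x * r" "x * s"] by (simp add: algebra_simps)
    then show ?case using sg_square[OF q Nil(1)] by simp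
  next
    case (Cons g G)
    have "regular U (g * x)" using regular_mult[OF q] Cons.prems by simp
    then show ?case using Cons.IH[of x] Cons.IH[of "g * x"] Cons.prems by (simp add: mult.assoc)
  qed
  from this[OF regular_one] show ?thesis by simp
qed

text \<open>A Pfister factor absorbs its own entry: g <1, g> = <g, g g>, and <g g> is isometric to
  <1> because g is regular.\<close>

lemma sgs_absorb:
  assumes q: "rform U q" and g: "g \<in> set G" "regular U g"
  shows "sgs U q G (g * r) = sgs U q G r"
  using g(1)
proof (induction G arbitrary: r)
  case (Cons h G)
  show ?case
  proof (cases "g = h")
    case True
    have "sgs U q G (h * (h * r)) = sgs U q G r"
      using sgs_square[OF q] g(2) True by (simp add: mult.assoc)
    then show ?thesis using True by simp
  next
    case False
    then have "g \<in> set G" using Cons.prems by simp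
    then show ?thesis using Cons.IH[of r] Cons.IH[of "h * r"] by (simp add: mult.left_commute)
  qed
qed simp

lemma sgs_bound:
  assumes "rform U q"
  shows "\<bar>sgs U q G r\<bar> \<le> int (2 ^ length G * dim U)"
proof (induction G arbitrary: r)
  case Nil
  then show ?case using sg_bound[OF assms] by simp
next
  case (Cons g G)
  have "\<bar>sgs U q (g # G) r\<bar> \<le> int (2 ^ length G * dim U) + int (2 ^ length G * dim U)"
    using Cons[of r] Cons[of "g * r"] abs_triangle_ineq[of "sgs U q G r" "sgs U q G (g * r)"]
    unfolding sgs.simps by linarith
  then show ?case by (simp add: ac_simps)
qed

text \<open>A truncated power series for \<open>\<surd>(r * (r - c))\<close>, with denominators cleared.\<close>
lemma square_modulo_power:
  fixes r c :: 'r
  shows "\<exists>M u v s i j. M = 2 ^ i * r ^ j \<and> u = M * r + c * s \<and> u * u = M * M * (r * (r - c)) + c ^ Suc k * v"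
proof (induction k)
  case 0
  show ?case by (rule exI[of _ 1], rule exI[of _ r], rule exI[of _ r], rule exI[of _ 0], rule exI[of _ 0], rule exI[of _ 0])
      (simp add: algebra_simps)
next
  case (Suc k)
  then obtain M u v s i j where h: "M = 2 ^ i * r ^ j" "u = M * r + c * s" "u * u = M * M * (r * (r - c)) + c ^ Suc k * v"
    by blast
  \<comment> \<open>A Newton step for the square root u / M, with the derivative 2 u / M replaced by
    2 r, which agrees with it modulo c. The new denominator is \<open>M * M'\<close>.\<close>
  define M' where "M' = 2 * M * r"
  define u' where "u' = M' * u - v * c ^ Suc k"
  have 1: "M * M' = 2 ^ (i + i + 1) * r ^ (j + j + 1)"
    unfolding M'_def h(1) by (simp add: algebra_simps power_add)
  have 2: "u' = (M * M') * r + c * (M' * s - v * c ^ k)"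
    unfolding u'_def h(2) by (simp add: algebra_simps)
  have "u' * u' = M' * M' * (u * u) - 2 * M' * u * v * c ^ Suc k + v * v * c ^ Suc k * c ^ Suc k"
    unfolding u'_def by (simp add: algebra_simps)
  also have "\<dots> = (M * M') * (M * M') * (r * (r - c)) + c ^ Suc k * (v * M' * (M' - 2 * u)) + v * v * c ^ Suc k * c ^ Suc k"
    unfolding h(3) by (simp add: algebra_simps)
  also have "M' - 2 * u = - 2 * c * s"
    unfolding h(2) M'_def by (simp add: algebra_simps)
  finally have "u' * u' = (M * M') * (M * M') * (r * (r - c)) + c ^ Suc (Suc k) * (v * M' * (- 2 * s) + v * v * c ^ k)"
    by (simp add: algebra_simps)
  then show ?case using 1 2 by blast
qed

text \<open>Fitting's lemma: once the kernels of the powers of c are stable, U is the direct sum of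
  the kernel K and the image I of \<open>c ^ n\<close>. The summands are orthogonal because
  \<open>c ^ n\<close> is self-adjoint.\<close>

lemma fitting_decomposition:
  assumes q: "rform U q"
  obtains K I n where "rform K q" "rform I q" "K \<subseteq> U" "I \<subseteq> U" "K \<inter> I \<subseteq> {0}"
    "\<forall>u\<in>U. \<exists>x\<in>K. \<exists>y\<in>I. u = x + y" "\<forall>x\<in>K. \<forall>y\<in>I. q x y = 0"
    "\<forall>x\<in>K. act (c ^ n) x = 0" "regular I c"
proof -
  note d = rformD[OF q]
  have S: "subspace U" using d(1) by (rule lsub_subspace)
  have lin: "Vector_Spaces.linear scale scale (act r)" for r
    by unfold_locales (auto simp: act_vec_add act_scale)
  have comm: "act r (act s x) = act s (act r x)" for r s x
    by (metis act_mult mult.commute)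
  define ker where "ker r = {x\<in>U. act r x = 0}" for r
  have ker: "lsub (ker r)" for r
    unfolding lsub_def
  proof (intro conjI ballI)
    show "subspace (ker r)"
      unfolding ker_def using S by (intro subspaceI)
        (auto simp: act_vec_zero act_vec_add act_scale subspace_0 subspace_add subspace_scale)
  qed (use d(1) in \<open>auto simp: ker_def lsub_def act_L\<close>)
  have im: "lsub (act r ` U)" for r
    unfolding lsub_def
  proof (intro conjI ballI)
    show "subspace (act r ` U)"
    proof -
      interpret T: Vector_Spaces.linear scale scale "act r" by (rule lin)
      show ?thesis using T.subspace_image[OF S] .
    qed
  qed (use d(1) L_unit in \<open>auto simp: lsub_def simp flip: act_L\<close>)
  \<comment> \<open>The exponent is at least 1 so that c x = 0 implies that \<open>c ^ n\<close>
    kills x; this makes c regular on I.\<close>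
  have "\<exists>n. n \<ge> 1 \<and> (\<forall>m\<ge>1. dim (ker (c ^ m)) \<le> dim (ker (c ^ n)))"
    using ex_has_greatest_nat[of "\<lambda>n. n \<ge> 1" 1 "\<lambda>n. dim (ker (c ^ n))" "Suc (card Basis)"]
      dim_le_dimension le_imp_less_Suc by blast
  then obtain n where n: "n \<ge> 1" "\<And>m. m \<ge> 1 \<Longrightarrow> dim (ker (c ^ m)) \<le> dim (ker (c ^ n))" by blast
  let ?K = "ker (c ^ n)" and ?I = "act (c ^ n) ` U"
  have stab: "?K = ker (c ^ (n + m))" for m
  proof (rule subspace_dim_equal)
    show "?K \<subseteq> ker (c ^ (n + m))"
      by (auto simp: ker_def power_add act_mult comm[of "c ^ n"] act_vec_zero)
    show "dim (ker (c ^ (n + m))) \<le> dim ?K" using n by simp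
  qed (use ker lsub_subspace in auto)
  have dis: "?K \<inter> ?I \<subseteq> {0}"
  proof
    fix x assume "x \<in> ?K \<inter> ?I"
    then obtain y where y: "y \<in> U" "x = act (c ^ n) y" "act (c ^ n) x = 0" by (auto simp: ker_def)
    then have "y \<in> ker (c ^ (n + n))" by (simp add: ker_def power_add act_mult)
    then have "y \<in> ?K" using stab by blast
    then show "x \<in> {0}" using y by (simp add: ker_def)
  qed
  have IU: "?I \<subseteq> U" using d(3) by auto
  have KU: "?K \<subseteq> U" by (auto simp: ker_def)
  have sq: "act (c ^ n) x = 0" if "x \<in> U" "act (c ^ n) (act (c ^ n) x) = 0" for x
  proof -
    have "x \<in> ker (c ^ (n + n))" using that by (simp add: ker_def power_add act_mult)
    then show ?thesis using stab by (auto simp: ker_def)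
  qed
  have "\<exists>x\<in>?K. \<exists>y\<in>?I. u = x + y" if u: "u \<in> U" for u
  proof -
    have "\<exists>k\<in>U. \<exists>y\<in>U. act (c ^ n) k = 0 \<and> u = k + act (c ^ n) y"
      by (rule kernel_image_decomposition[OF S lin d(3) sq u])
    then obtain k y where "k \<in> ?K" "y \<in> U" "u = k + act (c ^ n) y" unfolding ker_def by blast
    then show ?thesis by blast
  qed
  moreover have "q x y = 0" if xy: "x \<in> ?K" "y \<in> ?I" for x y
  proof -
    obtain z where "z \<in> U" "y = act (c ^ n) z" using xy by blast
    then show ?thesis
      using xy(1) d(4)[of x z "c ^ n"] sform_right(3)[OF d(2,1)] S subspace_0 by (auto simp: ker_def)
  qed
  moreover have "regular ?I c"
    unfolding regular_def
  proof (intro ballI impI)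
    fix x assume x: "x \<in> ?I" "act c x = 0"
    have "act (c ^ n) x = act (c ^ (n - 1)) (act c x)"
      using n(1) by (metis act_mult power_minus_mult less_eq_Suc_le One_nat_def)
    then have "x \<in> ?K \<inter> ?I" using x IU by (auto simp: ker_def act_vec_zero)
    then show "x = 0" using dis by auto
  qed
  moreover have "rform ?K q"
    by (rule rform_subset[OF q KU ker]) (use d(3) comm in \<open>auto simp: ker_def act_vec_zero\<close>)
  moreover have "rform ?I q"
  proof (rule rform_subset[OF q IU im])
    fix r x assume "x \<in> ?I"
    then obtain y where "y \<in> U" "x = act (c ^ n) y" by blast
    then show "act r x \<in> ?I" using comm[of r "c ^ n" y] d(3)[of y r] by auto
  qed
  moreover have "act (c ^ n) x = 0" if "x \<in> ?K" for x using that by (simp add: ker_def)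
  ultimately show ?thesis
    using that[OF _ _ KU IU dis] by metis
qed

lemma sgs_split:
  assumes "rform U q" "rform K q" "rform I q" "K \<subseteq> U" "I \<subseteq> U" "K \<inter> I \<subseteq> {0}"
    "\<forall>u\<in>U. \<exists>x\<in>K. \<exists>y\<in>I. u = x + y" "\<forall>x\<in>K. \<forall>y\<in>I. q x y = 0"
  shows "sgs U q G r = sgs K q G r + sgs I q G r"
proof (induction G arbitrary: r)
  case Nil
  have span: "\<exists>x\<in>K. \<exists>y\<in>I. u = x + y" if "u \<in> U" for u using assms(7) that by blast
  have orth: "q (act r x) y = 0" if "x \<in> K" "y \<in> I" for x y
    using assms(8) that rformD(3)[OF assms(2)] by blast
  have "sg U q r = sg K q r + sg I q r"
    unfolding sg_def
    by (rule sgn_form_split[OF rformD(1)[OF assms(1)] rformD(1)[OF assms(2)] rformD(1)[OF assms(3)]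
        sform_act[OF assms(1)] assms(4-6) span orth])
  then show ?case by simp
qed simp

text \<open>With c = r + s, the product r (r - c) is - r s. Since c is nilpotent on U, the
  approximate square root becomes exact: u u acts as - M M r s with M and u regular. Hence r, u u r
  = - M M r r s and - s have the same signature.\<close>

lemma sgs_nilpotent:
  assumes q: "rform U q" and r: "regular U r" and s: "regular U s" and two: "regular U 2"
    and nil: "\<And>x. x \<in> U \<Longrightarrow> act ((r + s) ^ n) x = 0"
  shows "sgs U q G r = - sgs U q G s"
proof -
  define c where "c = r + s"
  obtain M u v t i j where h: "M = 2 ^ i * r ^ j" "u * u = M * M * (r * (r - c)) + c ^ Suc n * v"
    using square_modulo_power[of r c n] by blast
  have pow: "regular U a \<Longrightarrow> regular U (a ^ m)" for a m
    by (induction m) (auto simp: regular_one intro: regular_mult[OF q])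
  have M: "regular U M" unfolding h(1) using pow two r regular_mult[OF q] by blast
  have act: "act (u * u) x = act (M * M * - (r * s)) x" if "x \<in> U" for x
  proof -
    have "act (c ^ Suc n * v) x = act (c * v) (act (c ^ n) x)"
      by (simp add: ac_simps flip: act_mult)
    also have "\<dots> = 0" using nil[OF that] by (simp add: c_def act_vec_zero)
    finally have "act (u * u) x = act (M * M * (r * (r - c))) x"
      unfolding h(2) act_add by simp
    also have "r * (r - c) = - (r * s)" by (simp add: c_def algebra_simps)
    finally show ?thesis .
  qed
  have "regular U (M * M * - (r * s))"
    using regular_mult[OF q] regular_uminus M r s by blast
  then have "regular U (u * u)" using act by (auto simp: regular_def)
  then have u: "regular U u" by (rule regular_multD)
  have "sgs U q G r = sgs U q G (u * u * r)" using sgs_square[OF q u] by simp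
  also have "\<dots> = sgs U q G (M * M * - (r * s) * r)" by (rule sgs_cong[OF q act])
  also have "M * M * - (r * s) * r = (M * r) * (M * r) * - s" by (simp add: algebra_simps)
  also have "sgs U q G \<dots> = - sgs U q G s"
    using sgs_square[OF q regular_mult[OF q M r]] sgs_uminus[OF q] by simp
  finally show ?thesis .
qed

definition semiring_nonzero_on :: "'a set \<Rightarrow> 'r set \<Rightarrow> bool" where
  "semiring_nonzero_on U N \<longleftrightarrow> (\<forall>r\<in>N. \<forall>s\<in>N. r + s \<in> N \<and> r * s \<in> N) \<and> (\<forall>r\<in>N. \<exists>x\<in>U. act r x \<noteq> 0)"

text \<open>A nonzero signature of the Pfister form \<open>\<langle>1, g\<^sub>1\<rangle> \<otimes> \<dots> \<otimes> \<langle>1, g\<^sub>n\<rangle>\<close> makes the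
  \<open>g\<^sub>i\<close> simultaneously positive: elements that attain the maximal signature are closed under addition.\<close>
theorem positive_semiring:
  assumes "rform U q" "regular U 2" "\<And>g. g \<in> set G \<Longrightarrow> regular U g" "regular U w" "sgs U q G w \<noteq> 0"
  shows "\<exists>N. set G \<subseteq> N \<and> semiring_nonzero_on U N"
  using assms
proof (induction "dim U" arbitrary: U rule: less_induct)
  case less
  note q = less.prems(1) and two = less.prems(2) and G = less.prems(3) and w = less.prems(4,5)
  show ?case
  proof (cases "\<exists>c. \<not> regular U c \<and> (\<forall>n. \<exists>x\<in>U. act (c ^ n) x \<noteq> 0)")
    \<comment> \<open>Some c is neither regular nor nilpotent: Fitting's lemma splits U into two
      smaller summands, one of which still has a nonzero signature.\<close>
    case True
    then obtain c where c: "\<not> regular U c" "\<And>n. \<exists>x\<in>U. act (c ^ n) x \<noteq> 0" by blast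
    obtain K I n where KI: "rform K q" "rform I q" "K \<subseteq> U" "I \<subseteq> U" "K \<inter> I \<subseteq> {0}"
      "\<forall>u\<in>U. \<exists>x\<in>K. \<exists>y\<in>I. u = x + y" "\<forall>x\<in>K. \<forall>y\<in>I. q x y = 0"
      "\<forall>x\<in>K. act (c ^ n) x = 0" "regular I c"
      by (rule fitting_decomposition[OF q, of c], rule that, assumption+)
    have "K \<noteq> U" using c(2)[of n] KI(8) by blast
    moreover have "I \<noteq> U" using c(1) KI(9) by blast
    ultimately have lt: "dim K < dim U" "dim I < dim U"
      using subspace_dim_equal[OF _ _ KI(3)] subspace_dim_equal[OF _ _ KI(4)] lsub_subspace rformD(1) KI(1,2) q
      by (meson not_le_imp_less)+
    have sub: ?thesis if V: "rform V q" "V \<subseteq> U" "dim V < dim U" "sgs V q G w \<noteq> 0" for V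
    proof -
      have reg: "regular V r" if "regular U r" for r
        using that V(2) by (auto simp: regular_def)
      have "\<exists>N. set G \<subseteq> N \<and> semiring_nonzero_on V N"
        by (rule less.hyps[OF V(3,1) reg[OF two] reg[OF G] reg[OF w(1)] V(4)])
      then obtain N where N: "set G \<subseteq> N" "semiring_nonzero_on V N" by (elim exE conjE) (rule that)
      moreover have "\<forall>r\<in>N. \<exists>x\<in>U. act r x \<noteq> 0"
        using N(2) V(2) unfolding semiring_nonzero_on_def by fast
      ultimately have "semiring_nonzero_on U N"
        unfolding semiring_nonzero_on_def by (elim conjE) (intro conjI; assumption)
      then show ?thesis using N(1) by (intro exI[of _ N] conjI)
    qed
    have "sgs K q G w \<noteq> 0 \<or> sgs I q G w \<noteq> 0"
      using sgs_split[OF q KI(1-7), of G w] w(2) by auto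
    then show ?thesis
      using sub[OF KI(1,3) lt(1)] sub[OF KI(2,4) lt(2)] by (elim disjE)
  next
    case False
    \<comment> \<open>Every element is now regular or nilpotent on U, as in an Artinian local
      ring.\<close>
    then have dich: "regular U c \<or> (\<exists>n. \<forall>x\<in>U. act (c ^ n) x = 0)" for c by blast
    define S where "S r = sgs U q G r" for r
    have "\<exists>r. regular U r \<and> (\<forall>s. regular U s \<longrightarrow> nat (S s) \<le> nat (S r))"
    proof -
      have "nat (S s) < Suc (2 ^ length G * dim U)" for s
        using sgs_bound[OF q, of G s] unfolding S_def by linarith
      then show ?thesis
        using ex_has_greatest_nat[of "regular U" w "\<lambda>s. nat (S s)" "Suc (2 ^ length G * dim U)"] w(1) by blast
    qed
    then obtain m where m: "regular U m" "\<And>s. regular U s \<Longrightarrow> nat (S s) \<le> nat (S m)" by blast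
    have neg: "S (- r) = - S r" for r unfolding S_def by (rule sgs_uminus[OF q])
    have pos: "S m > 0"
      using m(2)[OF w(1)] m(2)[OF regular_uminus[OF w(1)]] neg[of w] w(2) unfolding S_def by linarith
    have max: "S s \<le> S m" if "regular U s" for s
      using m(2)[OF that] pos by linarith
    define H where "H = {z. regular U z \<and> S z = S m}"
    have add: "r + s \<in> H" if "r \<in> H" "s \<in> H" for r s
    proof -
      have rs: "regular U r" "regular U s" "S r = S m" "S s = S m" using that by (auto simp: H_def)
      have "regular U (r + s)"
      proof (rule ccontr)
        assume "\<not> regular U (r + s)"
        then obtain n where n: "\<And>x. x \<in> U \<Longrightarrow> act ((r + s) ^ n) x = 0" using dich by blast
        have "S r = - S s"
          unfolding S_def by (rule sgs_nilpotent[OF q rs(1,2) two n])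
        then show False using rs pos by simp
      qed
      moreover have "S r + S s = S (r + s) + S (r * s * (r + s))"
        unfolding S_def by (rule sgs_relation[OF q calculation G])
      moreover have "regular U (r * s * (r + s))"
        using calculation rs regular_mult[OF q] by blast
      \<comment> \<open>Twice the maximal value is the sum of two values that do not exceed it, so
        both are maximal.\<close>
      ultimately show ?thesis
        using max[of "r + s"] max[of "r * s * (r + s)"] rs by (auto simp: H_def)
    qed
    \<comment> \<open>\<open>H\<close> is closed under addition, and its multipliers are closed
      under multiplication as well. A multiplier r cannot act as 0, because r m still has a positive
      signature.\<close>
    define N where "N = {z. \<forall>h\<in>H. z * h \<in> H}"
    have mH: "m \<in> H" using m by (simp add: H_def)
    have NG: "set G \<subseteq> N"
      using sgs_absorb[OF q _ G] regular_mult[OF q] G by (auto simp: N_def H_def S_def)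
    have Nc: "r + s \<in> N" "r * s \<in> N" if "r \<in> N" "s \<in> N" for r s
      using that add by (auto simp: N_def distrib_right mult.assoc)
    have Nn: "\<exists>x\<in>U. act r x \<noteq> 0" if "r \<in> N" for r
    proof (rule ccontr)
      assume *: "\<not> (\<exists>x\<in>U. act r x \<noteq> 0)"
      have "r * m \<in> H" using that mH by (simp add: N_def)
      then have "sgs U q G (r * m) = S m" by (simp add: H_def S_def)
      moreover have "sgs U q G (r * m) = sgs U q G (0 * m)"
        by (rule sgs_cong[OF q]) (use * in \<open>simp add: act_zero\<close>)
      moreover have "sgs U q G 0 = 0" using neg[of 0] by (simp add: S_def)
      ultimately show False using pos by simp
    qed
    show ?thesis unfolding semiring_nonzero_on_def by (intro exI[of _ N] conjI ballI NG Nc Nn)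
  qed
qed

end

section \<open>Thom's lemma\<close>

text \<open>Leibniz rule for the product of the variable and q. For k = 0 the truncated difference k
  - 1 does no harm, as its term has the factor 0.\<close>

lemma higher_pderiv_pCons:
  fixes q :: "'r::idom poly"
  shows "(pderiv ^^ k) (pCons a q) = (if k = 0 then [:a:] else 0) + pCons 0 ((pderiv ^^ k) q) + smult (of_nat k) ((pderiv ^^ (k - 1)) q)"
proof (induction k)
  case (Suc k)
  have "pderiv [:a:] = 0" by simp
  then have "(pderiv ^^ Suc k) (pCons a q) = pderiv (pCons 0 ((pderiv ^^ k) q)) + pderiv (smult (of_nat k) ((pderiv ^^ (k - 1)) q))"
    using Suc by (simp add: pderiv_add)
  also have "pderiv (smult (of_nat k) ((pderiv ^^ (k - 1)) q)) = smult (of_nat k) ((pderiv ^^ k) q)"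
    by (cases k) (simp_all add: pderiv_smult)
  finally show ?case by (simp add: pderiv_pCons smult_add_left)
qed simp

text \<open>Taylor's formula multiplied by the factorial of m to avoid division: the coefficient m!
  / k! is written \<open>(m choose k) * fact (m - k)\<close>. One m serves all q of degree at most
  m, which suits the induction.\<close>

lemma taylor_poly:
  fixes q :: "'r::idom poly"
  assumes "degree q \<le> m"
  shows "(\<Sum>k\<le>m. of_nat ((m choose k) * fact (m - k)) * h ^ k * poly ((pderiv ^^ k) q) u) = of_nat (fact m) * poly q (u + h)"
  using assms
proof (induction q)
  case (pCons a q)
  show ?case
  proof (cases "q = 0")
    case True
    have "(\<Sum>k\<le>m. of_nat ((m choose k) * fact (m - k)) * h ^ k * poly ((pderiv ^^ k) [:a:]) u)
        = (\<Sum>k\<le>m. if k = 0 then of_nat (fact m) * a else 0)"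
      by (rule sum.cong) (auto simp: higher_pderiv_pCons)
    then show ?thesis using True by simp
  next
    case False
    then have deg: "degree q < m" using pCons.prems by simp
    then obtain l where m: "m = Suc l" by (cases m) auto
    let ?c = "\<lambda>k. of_nat ((m choose k) * fact (m - k)) :: 'r"
    let ?d = "\<lambda>k. poly ((pderiv ^^ k) q) u"
    have van: "?d m = 0"
    proof -
      have "(pderiv ^^ m) q = 0"
        using deg by (intro poly_eqI) (simp add: coeff_higher_pderiv coeff_eq_0)
      then show ?thesis by simp
    qed
    have IH: "(\<Sum>k\<le>m. ?c k * h ^ k * ?d k) = of_nat (fact m) * poly q (u + h)"
      using pCons.IH deg by simp
    have coef: "?c (Suc k) * of_nat (Suc k) = ?c k" if "k \<le> l" for k
    proof -
      have "(m choose Suc k) * fact (m - Suc k) * Suc k = (m choose k) * fact (m - k)"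
      proof -
        have "Suc k * (m choose Suc k) = (m - k) * (m choose k)"
          using binomial_absorption[of k m] binomial_absorb_comp[of m k] by simp
        moreover have "fact (m - k) = (m - k) * fact (m - Suc k)"
          using that m by (simp add: Suc_diff_le)
        ultimately show ?thesis by (metis mult.assoc mult.commute)
      qed
      then show ?thesis by (metis of_nat_mult)
    qed
    have "(\<Sum>k\<le>m. ?c k * h ^ k * poly ((pderiv ^^ k) (pCons a q)) u)
        = (\<Sum>k\<le>m. (if k = 0 then ?c 0 * a else 0) + u * (?c k * h ^ k * ?d k) + ?c k * of_nat k * h ^ k * ?d (k - 1))"
      by (rule sum.cong) (auto simp: higher_pderiv_pCons algebra_simps)
    also have "\<dots> = ?c 0 * a + u * (\<Sum>k\<le>m. ?c k * h ^ k * ?d k) + (\<Sum>k\<le>m. ?c k * of_nat k * h ^ k * ?d (k - 1))"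
      by (simp add: sum.distrib sum_distrib_left)
    also have "(\<Sum>k\<le>m. ?c k * of_nat k * h ^ k * ?d (k - 1)) = (\<Sum>k\<le>l. ?c (Suc k) * of_nat (Suc k) * h ^ Suc k * ?d k)"
      unfolding m sum.atMost_Suc_shift by simp
    also have "\<dots> = (\<Sum>k\<le>l. h * (?c k * h ^ k * ?d k))"
    proof (rule sum.cong)
      fix k assume "k \<in> {..l}"
      then have "?c (Suc k) * of_nat (Suc k) * h ^ Suc k * ?d k = ?c k * h ^ Suc k * ?d k"
        by (simp only: coef atMost_iff)
      then show "?c (Suc k) * of_nat (Suc k) * h ^ Suc k * ?d k = h * (?c k * h ^ k * ?d k)"
        by (simp only: power_Suc ac_simps)
    qed simp
    also have "\<dots> = h * (\<Sum>k\<le>m. ?c k * h ^ k * ?d k)"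
      unfolding m sum.atMost_Suc using van m by (simp add: sum_distrib_left)
    finally show ?thesis
      using IH by (simp add: algebra_simps)
  qed
qed simp

text \<open>An algebraic form of Thom's lemma. The \<open>\<beta> i j\<close> are, up to a factorial, the Bernstein coefficients
  of the \<open>i\<close>-th derivative on \<open>[u, v]\<close>; going down in \<open>i\<close>, they form a monotone sequence
  between two end points of the same sign.\<close>
lemma thom_semiring:
  fixes p :: "'r::idom poly" and u v :: 'r and s :: "nat \<Rightarrow> 'r"
  assumes Nadd: "\<And>x y. x \<in> N \<Longrightarrow> y \<in> N \<Longrightarrow> x + y \<in> N" and Nmult: "\<And>x y. x \<in> N \<Longrightarrow> y \<in> N \<Longrightarrow> x * y \<in> N"
    and n: "degree p = n" "n \<ge> 1" and vu: "v - u \<in> N"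
    and s: "\<And>i. s i = 1 \<or> s i = -1"
    and du: "\<And>i. 1 \<le> i \<Longrightarrow> i \<le> n \<Longrightarrow> s i * poly ((pderiv ^^ i) p) u \<in> N"
    and dv: "\<And>i. 1 \<le> i \<Longrightarrow> i \<le> n \<Longrightarrow> s i * poly ((pderiv ^^ i) p) v \<in> N"
  shows "s 1 * (of_nat (fact n) * (poly p v - poly p u)) \<in> N"
proof -
  define h where "h = v - u"
  have hN: "h \<in> N" using vu by (simp add: h_def)
  \<comment> \<open>As \<open>b0\<close>, \<open>bn\<close> and \<open>step\<close> show, row i runs
    from the i-th derivative at u to that at v, both times \<open>fact (n - i)\<close>, and its
    differences are h times the entries of row i + 1.\<close>
  define \<beta> where "\<beta> i j = (\<Sum>k\<le>j. of_nat ((j choose k) * fact (n - i - k)) * h ^ k * poly ((pderiv ^^ (i + k)) p) u)" for i j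
  have nat: "of_nat (Suc m) * x \<in> N" if "x \<in> N" for m x
  proof (induction m)
    case (Suc m)
    have "of_nat (Suc (Suc m)) * x = x + of_nat (Suc m) * x" by (simp add: algebra_simps)
    then show ?case using Nadd[OF that Suc] by simp
  qed (simp add: that)
  have fact: "of_nat (fact m) * x \<in> N" if "x \<in> N" for m x
    using nat[OF that, of "fact m - 1"] fact_ge_1[of m, where 'a = nat] by (simp del: of_nat_Suc)
  have b0: "\<beta> i 0 = of_nat (fact (n - i)) * poly ((pderiv ^^ i) p) u" for i
    by (simp add: \<beta>_def)
  have bn: "\<beta> i (n - i) = of_nat (fact (n - i)) * poly ((pderiv ^^ i) p) v" for i
  proof -
    have "degree ((pderiv ^^ i) p) \<le> n - i"
      using n(1) by (intro degree_le) (simp add: coeff_higher_pderiv coeff_eq_0)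
    from taylor_poly[OF this, of h u] show ?thesis
      by (simp add: \<beta>_def h_def funpow_add[symmetric, THEN fun_cong, unfolded comp_def] add.commute)
  qed
  have step: "\<beta> i (Suc j) = \<beta> i j + h * \<beta> (Suc i) j" for i j
  proof -
    let ?t = "\<lambda>c k. of_nat (c * fact (n - i - k)) * h ^ k * poly ((pderiv ^^ (i + k)) p) u"
    have "\<beta> i (Suc j) = ?t 1 0 + (\<Sum>k\<le>j. ?t (Suc j choose Suc k) (Suc k))"
      unfolding \<beta>_def sum.atMost_Suc_shift by simp
    also have "\<dots> = ?t 1 0 + ((\<Sum>k\<le>j. ?t (j choose k) (Suc k)) + (\<Sum>k\<le>j. ?t (j choose Suc k) (Suc k)))"
      by (simp add: algebra_simps flip: sum.distrib)
    also have "?t 1 0 + (\<Sum>k\<le>j. ?t (j choose Suc k) (Suc k)) = (\<Sum>k\<le>Suc j. ?t (j choose k) k)"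
      unfolding sum.atMost_Suc_shift by simp
    moreover have "(\<Sum>k\<le>Suc j. ?t (j choose k) k) = \<beta> i j"
      by (simp add: \<beta>_def binomial_eq_0)
    moreover have "(\<Sum>k\<le>j. ?t (j choose k) (Suc k)) = h * \<beta> (Suc i) j"
      unfolding \<beta>_def sum_distrib_left by (rule sum.cong) (simp_all add: ac_simps)
    ultimately show ?thesis by (simp add: ac_simps)
  qed
  \<comment> \<open>Induction on n - i: the entries of row i + 1 have the sign
    \<open>s (Suc i)\<close>. If it equals \<open>s i\<close>, the sign of row i spreads from its
    left end, otherwise from its right end.\<close>
  have main: "i \<ge> 1 \<Longrightarrow> n - i = d \<Longrightarrow> i \<le> n \<Longrightarrow> j \<le> d \<Longrightarrow> s i * \<beta> i j \<in> N" for i j d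
  proof (induction d arbitrary: i j)
    case 0
    then show ?case using b0[of i] du[of i] by simp
  next
    case (Suc d)
    have IH: "s (Suc i) * \<beta> (Suc i) j \<in> N" if "j \<le> d" for j
      using Suc.IH[of "Suc i" j] Suc.prems that by simp
    have e0: "s i * \<beta> i 0 \<in> N"
      using fact[OF du[of i], of "n - i"] Suc.prems by (simp add: b0 mult.left_commute)
    have en: "s i * \<beta> i (Suc d) \<in> N"
      using fact[OF dv[of i], of "n - i"] Suc.prems bn[of i] by (simp add: mult.left_commute)
    show ?case
    proof (cases "s (Suc i) = s i")
      case True
      have "j \<le> Suc d \<Longrightarrow> s i * \<beta> i j \<in> N" for j
      proof (induction j)
        case (Suc j)
        then have "s i * \<beta> i j + h * (s (Suc i) * \<beta> (Suc i) j) \<in> N"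
          using Nadd Nmult hN IH by simp
        then show ?case using True by (simp add: step algebra_simps)
      qed (rule e0)
      then show ?thesis using Suc.prems by simp
    next
      case False
      then have opp: "s (Suc i) = - s i" using s[of i] s[of "Suc i"] by auto
      have "t \<le> Suc d \<Longrightarrow> s i * \<beta> i (Suc d - t) \<in> N" for t
      proof (induction t)
        case 0
        then show ?case using en by simp
      next
        case (Suc t)
        have e: "Suc d - t = Suc (d - t)" "Suc d - Suc t = d - t" using Suc.prems by auto
        have "s i * \<beta> i (Suc (d - t)) + h * (s (Suc i) * \<beta> (Suc i) (d - t)) \<in> N"
          using Suc e Nadd Nmult hN IH by simp
        then show ?case unfolding e using opp by (simp add: step algebra_simps)
      qed
      from this[of "Suc d - j"] show ?thesis using Suc.prems by simp
    qed
  qed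
  \<comment> \<open>Row 1 has the sign \<open>s 1\<close>, so row 0 moves away from its first entry
    in this direction.\<close>
  have "j < n \<Longrightarrow> s 1 * (\<beta> 0 (Suc j) - \<beta> 0 0) \<in> N" for j
  proof (induction j)
    case 0
    then show ?case using main[of 1 "n - 1" 0] n Nmult[OF hN] by (simp add: step mult.left_commute)
  next
    case (Suc j)
    have "s 1 * (\<beta> 0 (Suc j) - \<beta> 0 0) + h * (s 1 * \<beta> 1 (Suc j)) \<in> N"
      using Suc main[of 1 "n - 1" "Suc j"] Nmult[OF hN] Nadd by simp
    then show ?case by (simp add: step[of 0 "Suc j"] algebra_simps)
  qed
  from this[of "n - 1"] show ?thesis
    using n bn[of 0] b0[of 0] by (simp add: algebra_simps)
qed

text \<open>This serves \<open>commutator_square\<close>, where the square of u - v kills a vector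
  while the derivative at v acts invertibly.\<close>

lemma poly_double_root:
  fixes p :: "'r::idom poly"
  shows "\<exists>R. poly p u - poly p v = (u - v) * (poly (pderiv p) v + (u - v) * R)"
proof (induction p)
  case (pCons a p)
  then obtain R where "poly p u - poly p v = (u - v) * (poly (pderiv p) v + (u - v) * R)" by blast
  then have p: "poly p u = poly p v + (u - v) * (poly (pderiv p) v + (u - v) * R)"
    by (simp add: algebra_simps)
  have "poly (pCons a p) u - poly (pCons a p) v
    = (u - v) * (poly (pderiv (pCons a p)) v + (u - v) * (poly (pderiv p) v + u * R))"
    by (simp add: pderiv_pCons p algebra_simps)
  then show ?case by blast
qed simp

lemma map_poly_pderiv:
  fixes h :: "'a::{comm_semiring_1,semiring_no_zero_divisors} \<Rightarrow> 'b::{comm_semiring_1,semiring_no_zero_divisors}"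
  assumes "h 0 = 0" "\<And>n x. h (of_nat n * x) = of_nat n * h x"
  shows "map_poly h (pderiv p) = pderiv (map_poly h p)"
  by (rule poly_eqI) (simp add: coeff_map_poly coeff_pderiv assms del: of_nat_Suc)

lemma map_poly_higher_pderiv:
  fixes h :: "'a::{comm_semiring_1,semiring_no_zero_divisors} \<Rightarrow> 'b::{comm_semiring_1,semiring_no_zero_divisors}"
  assumes "h 0 = 0" "\<And>n x. h (of_nat n * x) = of_nat n * h x"
  shows "map_poly h ((pderiv ^^ i) p) = (pderiv ^^ i) (map_poly h p)"
  by (induction i) (simp_all add: map_poly_pderiv[OF assms])

section \<open>Restriction to the centralizer of an element\<close>

context fd_algebra
begin

definition evl :: "'a \<Rightarrow> 'f poly \<Rightarrow> 'a" where
  "evl a f = fold_coeffs (\<lambda>c r. scale c 1 + a * r) f 0"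

lemma evl_0 [simp]: "evl a 0 = 0"
  by (simp add: evl_def)

lemma evl_pCons [simp]: "evl a (pCons c f) = scale c 1 + a * evl a f"
  by (cases "f = 0 \<and> c = 0") (auto simp: evl_def)

lemma evl_add [simp]: "evl a (f + g) = evl a f + evl a g"
  by (induction f g rule: poly_induct2) (simp_all add: scale_left_distrib distrib_left add_ac)

lemma evl_smult [simp]: "evl a (smult c f) = scale c (evl a f)"
  by (induction f) (simp_all add: scale_right_distrib scale_mult_right)

lemma evl_mult [simp]: "evl a (f * g) = evl a f * evl a g"
  by (induction f) (simp_all add: distrib_right scale_mult_left mult.assoc)

lemma evl_uminus [simp]: "evl a (- f) = - evl a f"
  using evl_add[of a f "- f"] by (simp add: add_eq_0_iff)

lemma evl_1 [simp]: "evl a 1 = 1"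
  by (simp flip: pCons_one)

lemma evl_commute_elem:
  assumes "a * x = x * a"
  shows "evl a f * x = x * evl a f"
proof (induction f)
  case (pCons c f)
  have "a * (evl a f * x) = x * (a * evl a f)"
    unfolding pCons by (simp add: assms flip: mult.assoc)
  then show ?case by (simp add: distrib_left distrib_right scale_mult_left scale_mult_right mult.assoc)
qed simp

lemma evl_commute: "evl a f * a = a * evl a f"
  by (induction f) (simp_all add: distrib_left distrib_right scale_mult_left scale_mult_right mult.assoc)

text \<open>Polynomials in two variables act on the algebra: the inner variable X is left
  multiplication by \<open>a\<close>, the outer variable Y is right multiplication by
  \<open>a\<close>.\<close>

definition pact :: "'a \<Rightarrow> 'f poly poly \<Rightarrow> 'a \<Rightarrow> 'a" where
  "pact a r x = fold_coeffs (\<lambda>f y. evl a f * x + y * a) r 0"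

lemma pact_0 [simp]: "pact a 0 x = 0"
  by (simp add: pact_def)

lemma pact_pCons [simp]: "pact a (pCons f r) x = evl a f * x + pact a r x * a"
  by (cases "r = 0 \<and> f = 0") (auto simp: pact_def)

lemma pact_add: "pact a (r + s) x = pact a r x + pact a s x"
  by (induction r s rule: poly_induct2) (simp_all add: distrib_right add_ac)

lemma pact_smult: "pact a (smult f r) x = evl a f * pact a r x"
  by (induction r) (simp_all add: distrib_left mult.assoc)

lemma pact_mult: "pact a (r * s) x = pact a r (pact a s x)"
  by (induction r) (simp_all add: pact_add pact_smult)

lemma pact_vec_add: "pact a r (x + y) = pact a r x + pact a r y"
  by (induction r) (simp_all add: distrib_left distrib_right add_ac)

lemma pact_scale: "pact a r (scale c x) = scale c (pact a r x)"
  by (induction r) (simp_all add: scale_mult_left scale_mult_right scale_right_distrib)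

lemma pact_one: "pact a 1 x = x"
  by (simp flip: pCons_one)

text \<open>The coefficients become constants of the two-variable ring, so that f can be evaluated
  at both variables: f(X) acts as left and f(Y) as right multiplication by f(a).\<close>

abbreviation lift_poly :: "'f poly \<Rightarrow> 'f poly poly poly" where
  "lift_poly \<equiv> map_poly (\<lambda>c. [:[:c:]:])"

lemma poly_lift_left: "poly (lift_poly f) [:[:0, 1:]:] = [:f:]"
  by (induction f) (simp_all add: map_poly_pCons)

lemma pact_lift_right: "pact a (poly (lift_poly f) [:0, 1:]) x = x * evl a f"
proof (induction f)
  case (pCons c f)
  have "poly (lift_poly (pCons c f)) [:0, 1:] = [:[:c:]:] + pCons 0 (poly (lift_poly f) [:0, 1:])"
    by (simp add: map_poly_pCons)
  then have "pact a (poly (lift_poly (pCons c f)) [:0, 1:]) x = scale c x + x * evl a f * a"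
    by (simp only: pact_add pact_pCons pCons.IH) (simp add: scale_mult_left)
  then show ?case
    by (simp add: distrib_left scale_mult_right mult.assoc evl_commute)
qed simp

end

lemma lift_poly_uminus: "map_poly (\<lambda>c. [:[:c::'f::field:]:]) (- f) = - map_poly (\<lambda>c. [:[:c:]:]) f"
  by (rule poly_eqI) (simp add: coeff_map_poly)

context ordered_subfield
begin

text \<open>The factor \<open>e\<close> moves the value into the corner: a constant polynomial
  evaluates to a multiple of 1, which need not lie in \<open>L\<close>.\<close>

lemma evl_in_L: "a \<in> L \<Longrightarrow> e * evl a f \<in> L"
proof (induction f)
  case (pCons c f)
  have "e * a = a * e" using L_comm L_unit pCons.prems by blast
  then have "e * (a * evl a f) = a * (e * evl a f)" by (simp flip: mult.assoc)
  then show ?case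
    using pCons L_scale L_unit L_add L_mult by (simp add: distrib_left scale_mult_right)
qed (simp add: L_zero)

lemma two_nonzero: "(2::'f) \<noteq> 0"
proof
  assume "(2::'f) = 0"
  then have "scale 2 e = 0" by simp
  moreover have "scale 2 e = e + e" by (metis one_add_one scale_left_distrib scale_one)
  moreover have "e \<in> P" using P_square[OF L_unit] L_one[OF L_unit] by simp
  ultimately show False using P_add_nonzero e_nonzero by metis
qed

lemma ring_action_pact: "a \<in> L \<Longrightarrow> ring_action scale Basis L P e (pact a)"
proof unfold_locales
  fix t r x assume "a \<in> L" "t \<in> L"
  then show "pact a r (x * t) = pact a r x * t"
    by (induction r) (simp_all add: distrib_right mult.assoc L_comm[of a t])
qed (simp_all add: pact_add pact_mult pact_one pact_vec_add pact_scale)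

lemma pidx_scale:
  assumes "sform U q" "p \<in> P" "p \<noteq> 0"
  shows "pidx U (\<lambda>x y. p * q x y) = pidx U q"
proof -
  have *: "(p * q x x \<in> P \<and> p * q x x \<noteq> 0) \<longleftrightarrow> (q x x \<in> P \<and> q x x \<noteq> 0)" if "x \<in> U" for x
  proof
    have L: "q x x \<in> L" using sform_simps(1)[OF assms(1) that that] .
    obtain s where s: "s \<in> P" "p * s = e" using P_inverse assms by blast
    have "s * (p * q x x) = q x x"
      using s L assms(2) P_sub L_comm L_one L_unit by (metis mult.assoc subsetD)
    then show "p * q x x \<in> P \<and> p * q x x \<noteq> 0 \<Longrightarrow> q x x \<in> P \<and> q x x \<noteq> 0"
      using P_mult[OF s(1), of "p * q x x"] by auto
  qed (use P_mult P_mult_nonzero assms in blast)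
  have "{W. lsub W \<and> W \<subseteq> U \<and> posd (\<lambda>x y. p * q x y) W} = {W. lsub W \<and> W \<subseteq> U \<and> posd q W}"
    using * unfolding posd_def by (intro Collect_cong conj_cong refl ball_cong) (auto simp: subset_iff)
  then show ?thesis by (simp add: pidx_def)
qed

lemma sgn_form_scale:
  assumes "sform U q" "p \<in> P" "p \<noteq> 0"
  shows "sgn_form U (\<lambda>x y. p * q x y) = sgn_form U q"
  using pidx_scale[OF assms] pidx_scale[OF sform_uminus[OF assms(1)] assms(2,3)] by (simp add: sgn_form_def)

text \<open>If \<open>f\<close> is a polynomial with the simple root \<open>a\<close>, then \<open>0 = f(X) - f(Y) = (X - Y) (f'(Y) + (X - Y) R)\<close>
  for the left multiplication \<open>X\<close> and the right multiplication \<open>Y\<close> by \<open>a\<close>.\<close>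
lemma commutator_square:
  assumes a: "a \<in> L" and x: "e * x = x" "x * e = x" and f: "e * evl a f = 0" "e * evl a (pderiv f) \<noteq> 0"
    and sq: "a * (a * x - x * a) = (a * x - x * a) * a"
  shows "a * x = x * a"
proof -
  interpret ra: ring_action scale Basis L P e "pact a"
    using a by (rule ring_action_pact)
  let ?X = "[:[:0, 1:]:] :: 'f poly poly" and ?Y = "[:0, 1:] :: 'f poly poly"
  define p where "p = lift_poly f"
  have ea: "e * a = a" "a * e = a" using L_one[OF a] L_comm[OF L_unit a] by auto
  have eE: "e * evl a g = evl a g * e" for g
    using evl_commute_elem[of a e g] ea by simp
  have \<Delta>: "pact a (?X - ?Y) x = a * x - x * a" for x by simp
  define y where "y = a * x - x * a"
  have y: "y * e = y" using x ea by (simp add: y_def left_diff_distrib mult.assoc)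
  obtain R where R: "poly p ?X - poly p ?Y = (?X - ?Y) * (poly (pderiv p) ?Y + (?X - ?Y) * R)"
    using poly_double_root[of p ?X ?Y] by blast
  have "poly p ?X - poly p ?Y = poly (pderiv p) ?Y * (?X - ?Y) + R * ((?X - ?Y) * (?X - ?Y))"
    unfolding R by (simp only: distrib_left ac_simps)
  then have "pact a (poly p ?X - poly p ?Y) x = pact a (poly (pderiv p) ?Y) y + pact a R (a * y - y * a)"
    by (simp only: pact_add pact_mult \<Delta> y_def)
  also have "a * y - y * a = 0" using sq by (simp add: y_def)
  also have "poly (pderiv p) ?Y = poly (lift_poly (pderiv f)) ?Y"
    unfolding p_def by (subst map_poly_pderiv) (simp_all add: of_nat_poly)
  \<comment> \<open>The quadratic term has vanished, so y f'(a) = f(a) x - x f(a) = 0, and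
    \<open>e\<close> times f'(a) is invertible in \<open>L\<close>.\<close>
  finally have "pact a (poly p ?X) x - pact a (poly p ?Y) x = y * evl a (pderiv f)"
    by (simp only: ra.act_diff ra.act_vec_zero pact_lift_right add_0_right)
  moreover have "pact a (poly p ?X) x = 0"
    using x f(1) eE[of f] by (simp add: p_def poly_lift_left) (metis mult.assoc mult_zero_left)
  moreover have "pact a (poly p ?Y) x = 0"
    using x f(1) unfolding p_def pact_lift_right by (metis mult.assoc mult_zero_right)
  ultimately have "y * (e * evl a (pderiv f)) = 0" using y by (simp flip: mult.assoc)
  moreover obtain t where "t \<in> L" "e * evl a (pderiv f) * t = e"
    using L_inverse evl_in_L[OF a] f(2) by blast
  ultimately have "y * e = 0" by (metis mult.assoc mult_zero_left)
  then show ?thesis using y by (simp add: y_def)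
qed

text \<open>The signature of the Pfister form of the signed derivatives is computed twice. On U it
  is 0: left factors are covered by \<open>vanish\<close>, and right factors are positive elements
  of \<open>L\<close>. In the Fitting decomposition for X - Y, the kernel is the centralizer of a,
  where all factors are positive, and the image contributes 0 by Thom's lemma.\<close>

lemma sgn_form_kernel:
  assumes U: "lsub U" "\<And>x. x \<in> U \<Longrightarrow> a * x \<in> U" "\<And>x. x \<in> U \<Longrightarrow> e * x = x" and a: "a \<in> L"
    and q: "sform U q" "\<And>x y. x \<in> U \<Longrightarrow> y \<in> U \<Longrightarrow> q (a * x) y = q x (a * y)"
    and f: "degree f = n" "n \<ge> 1" "e * evl a f = 0" "\<And>i. 1 \<le> i \<Longrightarrow> i \<le> n \<Longrightarrow> e * evl a ((pderiv ^^ i) f) \<noteq> 0"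
    and vanish: "\<And>g. sgn_form U (\<lambda>x y. q (evl a g * x) y) = 0"
  shows "sgn_form {x\<in>U. a * x = x * a} q = 0"
proof -
  interpret ra: ring_action scale Basis L P e "pact a"
    using a by (rule ring_action_pact)
  have S: "subspace U" using U(1) by (rule lsub_subspace)
  have q0: "q 0 y = 0" "q y 0 = 0" if "y \<in> U" for y
    using sform_right(3)[OF q(1) U(1)] sform_simps(2)[OF q(1)] that S subspace_0 by metis+
  have left_stable: "evl a g * x \<in> U" if "x \<in> U" for g x
    using that by (induction g) (use U(2) S in \<open>auto simp: distrib_right scale_mult_left mult.assoc subspace_0 intro: subspace_add subspace_scale\<close>)
  have left_adj: "q (evl a g * x) y = q x (evl a g * y)" if "x \<in> U" "y \<in> U" for g x y
    using that
  proof (induction g arbitrary: x y)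
    case 0
    then show ?case using q0 by simp
  next
    case (pCons c g)
    have s: "scale c x = x * scale c e" if "x \<in> U" for x
      using that U(1) by (simp add: scale_mult_right lsub_def)
    have m: "scale c x \<in> U" "a * (evl a g * x) \<in> U" if "x \<in> U" for x
      using that U(2) left_stable S subspace_scale by auto
    have 1: "q (scale c x) y = q x (scale c y)"
      using s pCons.prems sform_simps(4)[OF q(1) _ _ L_scale[OF L_unit]] sform_right(2)[OF q(1) U(1) _ _ L_scale[OF L_unit]] by simp
    have 2: "q (a * (evl a g * x)) y = q x (a * (evl a g * y))"
    proof -
      have "q (a * (evl a g * x)) y = q (evl a g * x) (a * y)"
        using q(2)[OF left_stable[OF pCons.prems(1)] pCons.prems(2)] .
      also have "\<dots> = q x (evl a g * (a * y))"
        by (rule pCons.IH[OF pCons.prems(1) U(2)[OF pCons.prems(2)]])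
      also have "evl a g * (a * y) = a * (evl a g * y)"
        using evl_commute[of a g] by (simp flip: mult.assoc)
      finally show ?thesis .
    qed
    have "q (scale c x + a * (evl a g * x)) y = q (scale c x) y + q (a * (evl a g * x)) y"
      using sform_simps(3)[OF q(1) m(1) _ m(2)] pCons.prems by blast
    moreover have "q x (scale c y + a * (evl a g * y)) = q x (scale c y) + q x (a * (evl a g * y))"
      using sform_right(1)[OF q(1) U(1) _ m(1) m(2)] pCons.prems by blast
    ultimately show ?case
      using 1 2 by (simp add: distrib_right scale_mult_left mult.assoc)
  qed
  have right: "x * a \<in> U" "q (x * a) y = q x (y * a)" if "x \<in> U" "y \<in> U" for x y
    using that U(1) a sform_simps(4)[OF q(1)] sform_right(2)[OF q(1) U(1)] by (auto simp: lsub_def)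
  have stable: "pact a r x \<in> U" if "x \<in> U" for r x
    by (induction r) (use that left_stable right S in \<open>auto simp: subspace_0 intro: subspace_add\<close>)
  have adj: "q (pact a r x) y = q x (pact a r y)" if "x \<in> U" "y \<in> U" for r x y
    using that
  proof (induction r arbitrary: x y)
    case 0
    then show ?case using q0 by simp
  next
    case (pCons g r)
    note p = pCons.prems
    have "q (pact a r x * a) y = q x (pact a r y * a)"
      using right(2)[OF stable[OF p(1)] p(2)] pCons.IH[OF p(1) right(1)[OF p(2) p(2)]] ra.act_L[OF a, of r y]
      by simp
    moreover have "q (evl a g * x + pact a r x * a) y = q (evl a g * x) y + q (pact a r x * a) y"
      by (rule sform_simps(3)[OF q(1) left_stable[OF p(1)] p(2) right(1)[OF stable[OF p(1)] p(2)]])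
    moreover have "q x (evl a g * y + pact a r y * a) = q x (evl a g * y) + q x (pact a r y * a)"
      by (rule sform_right(1)[OF q(1) U(1) p(1) left_stable[OF p(2)] right(1)[OF stable[OF p(2)] p(2)]])
    ultimately show ?case using left_adj pCons.prems by simp
  qed
  have R: "ra.rform U q"
    unfolding ra.rform_def using U(1) q(1) stable adj by blast
  let ?X = "[:[:0, 1:]:] :: 'f poly poly" and ?Y = "[:0, 1:] :: 'f poly poly"
  define \<Delta> where "\<Delta> = ?X - ?Y"
  define p where "p = lift_poly f"
  have \<Delta>: "pact a \<Delta> x = a * x - x * a" for x
    by (simp add: \<Delta>_def)
  have lift: "map_poly (\<lambda>c. [:[:c:]:]) ((pderiv ^^ i) f) = (pderiv ^^ i) p" for i
    unfolding p_def by (rule map_poly_higher_pderiv) (simp_all add: of_nat_poly)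
  have deg: "degree p = n"
    unfolding p_def using f(1) by (simp add: degree_map_poly)
  have eE: "evl a g * x = (e * evl a g) * x" "x * evl a g = x * (e * evl a g)" if "x \<in> U" for g x
  proof -
    show "evl a g * x = (e * evl a g) * x"
      using U(3)[OF left_stable[OF that]] by (simp add: mult.assoc)
    have "x * e = x" using U(1) that by (simp add: lsub_def)
    then show "x * evl a g = x * (e * evl a g)" by (metis mult.assoc)
  qed
  have reg: "x = 0" if x: "x \<in> U" "e * evl a g \<noteq> 0" "evl a g * x = 0 \<or> x * evl a g = 0" for g x
  proof -
    obtain t where t: "t \<in> L" "e * evl a g * t = e"
      using L_inverse evl_in_L[OF a] x(2) by blast
    then have t': "t * (e * evl a g) = e" using L_comm evl_in_L[OF a] by metis
    from x(3) show ?thesis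
    proof
      assume "evl a g * x = 0"
      then have "t * ((e * evl a g) * x) = 0" using eE(1)[OF x(1)] by simp
      then have "e * x = 0" using t' by (simp flip: mult.assoc)
      then show ?thesis using U(3)[OF x(1)] by simp
    next
      assume "x * evl a g = 0"
      then have "(x * (e * evl a g)) * t = 0" using eE(2)[OF x(1)] by simp
      then have "x * e = 0" using t(2) by (simp add: mult.assoc)
      then show ?thesis using U(1) x(1) by (simp add: lsub_def)
    qed
  qed
  have kill: "pact a (poly p ?X - poly p ?Y) x = 0" if "x \<in> U" for x
    using eE[OF that, of f] f(3) by (simp add: p_def poly_lift_left pact_lift_right ra.act_diff)
  have dbl: "pact a \<Delta> x = 0" if x: "x \<in> U" "pact a \<Delta> (pact a \<Delta> x) = 0" for x
  proof -
    have "e * x = x" "x * e = x" using x(1) U(1,3) by (auto simp: lsub_def)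
    moreover have "a * (a * x - x * a) = (a * x - x * a) * a" using x(2) by (simp add: \<Delta>)
    ultimately have "a * x = x * a"
      using commutator_square[OF a, of x f] f(3) f(4)[of 1] f(2) by simp
    then show ?thesis by (simp add: \<Delta>)
  qed
  \<comment> \<open>By \<open>dbl\<close>, the powers of X - Y kill nothing beyond its kernel, so
    the Fitting kernel will be the centralizer of a.\<close>
  have nil: "pact a \<Delta> x = 0" if "x \<in> U" "pact a (\<Delta> ^ N) x = 0" for x N
    using that
  proof (induction N arbitrary: x)
    case 0
    then show ?case by (simp add: pact_one ra.act_vec_zero)
  next
    case (Suc N)
    have "pact a (\<Delta> ^ N) (pact a \<Delta> x) = 0"
      using Suc.prems(2) unfolding power_Suc2 pact_mult .
    then show ?case using Suc.IH[OF stable[OF Suc.prems(1)]] dbl Suc.prems(1) by blast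
  qed
  \<comment> \<open>The sign is chosen so that the i-th derivative becomes positive at a;
    \<open>s\<close> records it, and \<open>lft\<close>, \<open>rgt\<close> are the corresponding
    elements for left and right multiplication.\<close>
  define h where "h i = (if e * evl a ((pderiv ^^ i) f) \<in> P then (pderiv ^^ i) f else - (pderiv ^^ i) f)" for i
  define s :: "nat \<Rightarrow> 'f poly poly" where "s i = (if e * evl a ((pderiv ^^ i) f) \<in> P then 1 else - 1)" for i
  define lft :: "nat \<Rightarrow> 'f poly poly" where "lft i = [:h i:]" for i
  define rgt where "rgt i = poly (lift_poly (h i)) ?Y" for i
  have hP: "e * evl a (h i) \<in> P" "e * evl a (h i) \<noteq> 0" if "1 \<le> i" "i \<le> n" for i
    using f(4)[OF that] P_total[OF evl_in_L[OF a, of "(pderiv ^^ i) f"]] by (auto simp: h_def)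
  have sX: "s i * poly ((pderiv ^^ i) p) ?X = lft i" for i
    using poly_lift_left[of "(pderiv ^^ i) f"] by (simp add: lft_def h_def s_def lift)
  have sY: "s i * poly ((pderiv ^^ i) p) ?Y = rgt i" for i
    by (simp add: rgt_def h_def s_def lift_poly_uminus lift)
  have actl: "pact a (lft i) x = evl a (h i) * x" for i x by (simp add: lft_def)
  have actr: "pact a (rgt i) x = x * evl a (h i)" for i x
    unfolding rgt_def by (rule pact_lift_right)
  define xs where "xs = [1..<Suc n]"
  define G where "G = map rgt xs @ map lft xs"
  have xs: "i \<in> set xs \<longleftrightarrow> 1 \<le> i \<and> i \<le> n" for i by (auto simp: xs_def)
  have regG: "ra.regular U g" if gG: "g \<in> set G" for g
  proof -
    obtain i where i: "1 \<le> i" "i \<le> n" "g = lft i \<or> g = rgt i" using gG by (auto simp: G_def xs)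
    have "pact a g x = evl a (h i) * x \<or> pact a g x = x * evl a (h i)" for x
      using i(3) actl actr by metis
    then show ?thesis
      unfolding ra.regular_def using reg[OF _ hP(2)[OF i(1,2)]] by metis
  qed
  \<comment> \<open>Right multiplication by a positive element of \<open>L\<close> multiplies the
    form by this element, which leaves the signature unchanged.\<close>
  have pos: "ra.sg V q (g * r) = ra.sg V q r"
    if V: "ra.rform V q" "V \<subseteq> U" and g: "\<And>y. y \<in> V \<Longrightarrow> pact a g y = y * evl a (h i)" and i: "1 \<le> i" "i \<le> n" for V g r i
  proof -
    have "ra.sg V q (g * r) = sgn_form V (\<lambda>x y. (e * evl a (h i)) * q (pact a r x) y)"
      unfolding ra.sg_def
    proof (rule sgn_form_cong)
      fix x assume x: "x \<in> V"
      have "pact a (g * r) x = pact a r x * (e * evl a (h i))"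
        using g[OF ra.rformD(3)[OF V(1) x]] eE(2) ra.rformD(3)[OF V(1) x] V(2) by (simp add: pact_mult subset_iff)
      then show "q (pact a (g * r) x) x = (e * evl a (h i)) * q (pact a r x) x"
        using sform_simps(4)[OF ra.rformD(2)[OF V(1)] ra.rformD(3)[OF V(1) x] x evl_in_L[OF a]] by simp
    qed
    also have "\<dots> = ra.sg V q r"
      unfolding ra.sg_def using hP[OF i] ra.sform_act[OF V(1)] by (intro sgn_form_scale)
    finally show ?thesis .
  qed
  \<comment> \<open>Products of left factors are again polynomials in X, to which
    \<open>vanish\<close> applies.\<close>
  have zero: "ra.sgs U q (map lft ys) [:g:] = 0" for ys g
  proof (induction ys arbitrary: g)
    case Nil
    show ?case using vanish[of g] by (simp add: ra.sg_def)
  next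
    case (Cons i ys)
    have "lft i * [:g:] = [:h i * g:]" by (simp add: lft_def)
    then show ?case using Cons[of g] Cons[of "h i * g"] by simp
  qed
  have "set ys \<subseteq> set xs \<Longrightarrow> ra.sgs U q (map rgt ys @ map lft xs) [:g:] = 0" for ys g
  proof (induction ys arbitrary: g)
    case (Cons i ys)
    have "ra.sg U q (rgt i * r) = 1 * ra.sg U q (1 * r)" for r
      using pos[OF R subset_refl actr] Cons.prems by (simp add: xs)
    then have "ra.sgs U q (map rgt ys @ map lft xs) (rgt i * [:g:]) = 1 * ra.sgs U q (map rgt ys @ map lft xs) (1 * [:g:])"
      by (rule ra.sgs_proportional)
    then show ?case using Cons by simp
  qed (simp add: zero)
  from this[of xs 1] have U0: "ra.sgs U q G 1 = 0"
    unfolding G_def by (simp flip: pCons_one)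
  obtain K I N where KI: "ra.rform K q" "ra.rform I q" "K \<subseteq> U" "I \<subseteq> U" "K \<inter> I \<subseteq> {0}"
    "\<forall>u\<in>U. \<exists>x\<in>K. \<exists>y\<in>I. u = x + y" "\<forall>x\<in>K. \<forall>y\<in>I. q x y = 0"
    "\<forall>x\<in>K. pact a (\<Delta> ^ N) x = 0" "ra.regular I \<Delta>"
    by (rule ra.fitting_decomposition[OF R, of \<Delta>], rule that, assumption+)
  have K\<Delta>: "pact a \<Delta> x = 0" if "x \<in> K" for x
    using nil[of x N] that KI(3,8) by blast
  have K: "K = {x\<in>U. a * x = x * a}"
  proof (intro equalityI subsetI)
    fix x assume "x \<in> {x\<in>U. a * x = x * a}"
    then have x: "x \<in> U" "pact a \<Delta> x = 0" by (auto simp: \<Delta>)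
    obtain y z where yz: "y \<in> K" "z \<in> I" "x = y + z" using KI(6) x(1) by blast
    then have "pact a \<Delta> z = 0" using x(2) K\<Delta>[OF yz(1)] by (simp add: pact_vec_add)
    then have "z = 0" using KI(9) yz(2) by (simp add: ra.regular_def)
    then show "x \<in> K" using yz by simp
  qed (use K\<Delta> KI(3) \<Delta> in auto)
  have posK: "ra.sg K q (g * r) = ra.sg K q r" if gG: "g \<in> set G" for g r
  proof -
    obtain i where i: "1 \<le> i" "i \<le> n" "g = lft i \<or> g = rgt i" using gG by (auto simp: G_def xs)
    have "pact a g y = y * evl a (h i)" if "y \<in> K" for y
      using i(3) that evl_commute_elem[of a y "h i"] K by (auto simp: actl actr)
    from pos[OF KI(1,3) this i(1,2)] show ?thesis .
  qed
  have "set ys \<subseteq> set G \<Longrightarrow> ra.sgs K q ys r = 2 ^ length ys * ra.sg K q r" for ys r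
  proof (induction ys arbitrary: r)
    case (Cons g ys)
    then show ?case using Cons.IH[of r] Cons.IH[of "g * r"] posK[of g r] by simp
  qed simp
  then have K0: "ra.sgs K q G 1 = 2 ^ length G * sgn_form K q"
    by (simp add: ra.sg_def pact_one)
  have I0: "ra.sgs I q G 1 = 0"
  proof (rule ccontr)
    assume nz: "ra.sgs I q G 1 \<noteq> 0"
    have regI: "ra.regular I g" if "ra.regular U g" for g
      using that KI(4) by (auto simp: ra.regular_def)
    \<comment> \<open>Adjoining \<Delta> or -\<Delta> to the Pfister form leaves one signature
      nonzero, as the two add up to twice the old one. This decides which of X and Y counts as the
      larger.\<close>
    have "ra.sgs I q (- \<Delta> # G) 1 + ra.sgs I q (\<Delta> # G) 1 = 2 * ra.sgs I q G 1"
      using ra.sgs_uminus[OF KI(2)] by simp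
    then have "ra.sgs I q (- \<Delta> # G) 1 \<noteq> 0 \<or> ra.sgs I q (\<Delta> # G) 1 \<noteq> 0" using nz by linarith
    then have "\<exists>u v. (v - u = \<Delta> \<or> v - u = - \<Delta>) \<and> ra.sgs I q ((v - u) # G) 1 \<noteq> 0 \<and> {u, v} = {?X, ?Y}"
    proof
      assume "ra.sgs I q (- \<Delta> # G) 1 \<noteq> 0"
      moreover have "?Y - ?X = - \<Delta>" unfolding \<Delta>_def by (simp only: minus_diff_eq)
      ultimately show ?thesis by (intro exI[of _ ?X] exI[of _ ?Y]) (simp only: simp_thms)
    next
      assume "ra.sgs I q (\<Delta> # G) 1 \<noteq> 0"
      then show ?thesis unfolding \<Delta>_def
        by (intro exI[of _ ?Y] exI[of _ ?X]) (simp only: simp_thms insert_commute)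
    qed
    then obtain u v where uv: "v - u = \<Delta> \<or> v - u = - \<Delta>" "ra.sgs I q ((v - u) # G) 1 \<noteq> 0"
      "{u, v} = {?X, ?Y}" by blast
    have reg2: "ra.regular I 2"
      unfolding ra.regular_def
    proof (intro ballI impI)
      fix x assume "pact a 2 x = 0"
      moreover have "pact a 2 x = scale 2 x"
        unfolding one_add_one[symmetric] pact_add pact_one scale_left_distrib scale_one ..
      ultimately show "x = 0" using two_nonzero by simp
    qed
    have "\<exists>N. set ((v - u) # G) \<subseteq> N \<and> ra.semiring_nonzero_on I N"
    proof (rule ra.positive_semiring[OF KI(2) reg2 _ ra.regular_one uv(2)])
      fix g assume "g \<in> set ((v - u) # G)"
      then show "ra.regular I g"
        using uv(1) KI(9) ra.regular_uminus regI regG by auto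
    qed
    then obtain N where N: "set ((v - u) # G) \<subseteq> N" "\<forall>r\<in>N. \<forall>s\<in>N. r + s \<in> N \<and> r * s \<in> N"
      "\<forall>r\<in>N. \<exists>x\<in>I. pact a r x \<noteq> 0"
      unfolding ra.semiring_nonzero_on_def by (elim exE conjE) (rule that)
    have lr: "s i * poly ((pderiv ^^ i) p) w \<in> N" if "1 \<le> i" "i \<le> n" "w \<in> {?X, ?Y}" for i w
    proof -
      have "lft i \<in> set G" "rgt i \<in> set G" using that(1,2) xs by (auto simp: G_def)
      then show ?thesis using that(3) sX[of i] sY[of i] N(1) by auto
    qed
    \<comment> \<open>Thom's lemma puts a multiple of p(v) - p(u) into N. It acts as 0 because f(X)
      and f(Y) do, contrary to the choice of N.\<close>
    have "s 1 * (of_nat (fact n) * (poly p v - poly p u)) \<in> N"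
    proof (rule thom_semiring[OF _ _ deg f(2)])
      show "v - u \<in> N" using N(1) by simp
      show "s i = 1 \<or> s i = -1" for i by (simp add: s_def)
      show "s i * poly ((pderiv ^^ i) p) u \<in> N" "s i * poly ((pderiv ^^ i) p) v \<in> N" if "1 \<le> i" "i \<le> n" for i
        using lr[OF that] uv(3) by blast+
    qed (use N(2) in auto)
    then obtain x where x: "x \<in> I" "pact a (s 1 * (of_nat (fact n) * (poly p v - poly p u))) x \<noteq> 0"
      using N(3) by blast
    have "poly p v - poly p u = poly p ?X - poly p ?Y \<or> poly p v - poly p u = - (poly p ?X - poly p ?Y)"
      using uv(3) by (auto simp: doubleton_eq_iff)
    then have "pact a (poly p v - poly p u) x = 0"
      using kill[OF subsetD[OF KI(4) x(1)]] by (elim disjE) (simp_all only: ra.act_minus minus_zero)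
    then show False using x(2) by (simp add: pact_mult ra.act_vec_zero)
  qed
  have "ra.sgs U q G 1 = ra.sgs K q G 1 + ra.sgs I q G 1"
    by (rule ra.sgs_split[OF R KI(1-7)])
  then have "sgn_form K q = 0" using U0 K0 I0 by simp
  then show ?thesis using K by simp
qed

end

section \<open>Division corners of definite involutions\<close>

text \<open>\<open>prime_ring\<close> is the form in which simplicity of the algebra is used; it
  does not mention the involution and so carries over when the involution is changed.\<close>

locale star_algebra = fd_algebra scale Basis
  for scale :: "'f::field \<Rightarrow> 'a::ring_1 \<Rightarrow> 'a" and Basis :: "'a set" +
  fixes \<sigma> :: "'a \<Rightarrow> 'a"
  assumes star_add: "\<sigma> (x + y) = \<sigma> x + \<sigma> y"
    and star_mult: "\<sigma> (x * y) = \<sigma> y * \<sigma> x"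
    and star_star: "\<sigma> (\<sigma> x) = x"
    and star_scale: "\<sigma> (scale c x) = scale c (\<sigma> x)"
    and prime_ring: "x \<noteq> 0 \<Longrightarrow> y \<noteq> 0 \<Longrightarrow> \<exists>a. x * a * y \<noteq> 0"
begin

lemma star_zero: "\<sigma> 0 = 0"
  using star_add[of 0 0] by simp

lemma star_minus: "\<sigma> (- x) = - \<sigma> x"
  using star_add[of x "- x"] star_zero by (simp add: add_eq_0_iff)

lemma star_diff: "\<sigma> (x - y) = \<sigma> x - \<sigma> y"
  using star_add[of x "- y"] star_minus by simp

lemma star_one: "\<sigma> 1 = 1"
  by (metis mult.left_neutral star_mult star_star)

lemma star_eq_zero: "\<sigma> x = 0 \<longleftrightarrow> x = 0"
  by (metis star_star star_zero)

text \<open>(P4) reduces to totality: \<open>cone_field scale Q\<close> inherits closure under sums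
  and products, and if it contains u and -u, then \<open>scale u d\<close> and its negative lie in
  Q, whence u = 0.\<close>

lemma prepositive_coneI:
  assumes sym: "\<And>x. x \<in> Q \<Longrightarrow> \<sigma> x = x" and add: "\<And>x y. x \<in> Q \<Longrightarrow> y \<in> Q \<Longrightarrow> x + y \<in> Q"
    and congr: "\<And>a x. x \<in> Q \<Longrightarrow> \<sigma> a * x * a \<in> Q" and anti: "\<And>x. x \<in> Q \<Longrightarrow> - x \<in> Q \<Longrightarrow> x = 0"
    and d: "d \<in> Q" "d \<noteq> 0" and total: "\<And>u. u \<in> cone_field scale Q \<or> - u \<in> cone_field scale Q"
  shows "prepositive_cone scale \<sigma> Q"
proof -
  have zero: "0 \<in> Q" using congr[OF d(1), of 0] by simp
  have "field_ordering (cone_field scale Q)"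
    unfolding field_ordering_def
  proof (intro conjI ballI)
    fix u v assume uv: "u \<in> cone_field scale Q" "v \<in> cone_field scale Q"
    show "u + v \<in> cone_field scale Q"
      using uv add by (simp add: cone_field_def scale_left_distrib)
    show "u * v \<in> cone_field scale Q"
      using uv by (simp add: cone_field_def flip: scale_scale)
  next
    show "cone_field scale Q \<union> uminus ` cone_field scale Q = UNIV"
      using total by (metis UNIV_eq_I UnI1 UnI2 add.inverse_inverse imageI)
    have "u = 0" if u: "u \<in> cone_field scale Q" "- u \<in> cone_field scale Q" for u
    proof -
      have "scale u d \<in> Q" "- scale u d \<in> Q"
        using u d(1) by (auto simp: cone_field_def)
      then show ?thesis using anti d(2) by force
    qed
    moreover have "0 \<in> cone_field scale Q" using zero by (simp add: cone_field_def)
    ultimately show "cone_field scale Q \<inter> uminus ` cone_field scale Q = {0}" by auto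
  qed
  moreover have "Q \<inter> uminus ` Q = {0}" using anti zero by auto
  ultimately show ?thesis
    unfolding prepositive_cone_def using zero add congr sym by (auto simp: Sym_def)
qed

lemma linear_left: "Vector_Spaces.linear scale scale (\<lambda>x. a * x)"
  by unfold_locales (auto simp: distrib_left scale_mult_right)

end

text \<open>\<open>definite\<close> says that the form <1> is strongly anisotropic; lists play the
  part of vectors in its multiples.\<close>

locale definite_star_algebra = star_algebra scale Basis \<sigma>
  for scale :: "'f::field \<Rightarrow> 'a::ring_1 \<Rightarrow> 'a" and Basis :: "'a set" and \<sigma> :: "'a \<Rightarrow> 'a" +
  assumes definite: "(\<Sum>x\<leftarrow>xs. \<sigma> x * x) = 0 \<Longrightarrow> x \<in> set xs \<Longrightarrow> x = 0"
begin

lemma star_self_nonzero: "x \<noteq> 0 \<Longrightarrow> \<sigma> x * x \<noteq> 0"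
  using definite[of "[x]" x] by auto

definition corner :: "'a \<Rightarrow> 'a set" where
  "corner e = {x. e * x = x \<and> x * e = x}"

lemma subspace_corner: "subspace (corner e)"
  by (intro subspaceI) (auto simp: corner_def distrib_left distrib_right scale_mult_left scale_mult_right)

lemma corner_mult: "x \<in> corner e \<Longrightarrow> y \<in> corner e \<Longrightarrow> x * y \<in> corner e"
  by (auto simp: corner_def mult.assoc) (simp flip: mult.assoc)

lemma corner_star: "\<sigma> e = e \<Longrightarrow> x \<in> corner e \<Longrightarrow> \<sigma> x \<in> corner e"
  unfolding corner_def by (metis (mono_tags, lifting) mem_Collect_eq star_mult)

text \<open>A symmetric idempotent \<open>e\<close> with the smallest corner works. For a nonzero
  symmetric s in the corner, definiteness yields e = k + s y with s k = 0, and k turns out to be a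
  symmetric idempotent. By minimality the corner of e - k is that of e, so k = 0 and s is
  invertible. A general x is reduced to \<sigma>(x) x and x \<sigma>(x).\<close>

lemma division_corner_exists:
  obtains e where "\<sigma> e = e" "e * e = e" "e \<noteq> 0" "\<And>x. x \<in> corner e \<Longrightarrow> x \<noteq> 0 \<Longrightarrow> \<exists>y\<in>corner e. x * y = e \<and> y * x = e"
proof -
  define idem where "idem e \<longleftrightarrow> \<sigma> e = e \<and> e * e = e \<and> e \<noteq> 0" for e
  have "idem 1" by (simp add: idem_def star_one)
  then obtain e where e: "idem e" and min: "\<And>f. idem f \<Longrightarrow> dim (corner e) \<le> dim (corner f)"
    using ex_has_least_nat[of idem 1 "\<lambda>e. dim (corner e)"] by blast
  have ee: "\<sigma> e = e" "e * e = e" "e \<noteq> 0" "e \<in> corner e" using e by (auto simp: idem_def corner_def)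
  have sym: "\<exists>y\<in>corner e. s * y = e \<and> y * s = e" if s: "s \<in> corner e" "\<sigma> s = s" "s \<noteq> 0" for s
  proof -
    have sq: "s * x = 0" if "s * (s * x) = 0" for x
    proof (rule ccontr)
      assume "s * x \<noteq> 0"
      then have "\<sigma> (s * x) * (s * x) \<noteq> 0" by (rule star_self_nonzero)
      then show False using that s(2) by (simp add: star_mult mult.assoc)
    qed
    obtain k y where ky: "k \<in> corner e" "y \<in> corner e" "s * k = 0" "e = k + s * y"
      using kernel_image_decomposition[OF subspace_corner linear_left corner_mult[OF s(1)] sq ee(4)] by blast
    have ks: "\<sigma> k * s = 0" using ky(3) s(2) star_mult[of s k] star_zero by simp
    \<comment> \<open>Here e - k = s y and \<sigma>(k) s = 0. The result \<sigma>(k) = \<sigma>(k) k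
      shows that k is both symmetric and idempotent.\<close>
    have "\<sigma> k * (e - k) = 0" using ky(4) ks by (simp flip: mult.assoc)
    moreover have "\<sigma> k * e = \<sigma> k" using corner_star[OF ee(1) ky(1)] by (simp add: corner_def)
    ultimately have k1: "\<sigma> k = \<sigma> k * k" by (simp add: right_diff_distrib)
    then have k2: "\<sigma> k = k" by (metis star_mult star_star)
    then have k3: "k * k = k" using k1 by simp
    have ke: "e * k = k" "k * e = k" using ky(1) by (auto simp: corner_def)
    have ks': "k * s = 0" using ks k2 by simp
    have es: "e * s = s" using s(1) by (simp add: corner_def)
    define f where "f = e - k"
    have fs: "f * s = s" using es ks' by (simp add: f_def left_diff_distrib)
    have "idem f"
      using fs s(3) ee k2 k3 ke by (auto simp: idem_def f_def star_diff left_diff_distrib right_diff_distrib)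
    then have "dim (corner e) \<le> dim (corner f)" by (rule min)
    have fe: "f * e = f" "e * f = f" using ke ee by (auto simp: f_def left_diff_distrib right_diff_distrib)
    have "corner f \<subseteq> corner e"
    proof
      fix x assume "x \<in> corner f"
      then have "f * x = x" "x * f = x" by (auto simp: corner_def)
      then show "x \<in> corner e" using fe unfolding corner_def by (metis (mono_tags, lifting) mem_Collect_eq mult.assoc)
    qed
    then have "corner f = corner e"
      using subspace_dim_equal[OF subspace_corner subspace_corner] \<open>dim (corner e) \<le> dim (corner f)\<close> by blast
    then have "f * e = e" using ee(4) by (auto simp: corner_def)
    then have sy: "s * y = e" using fe ky(4) by (simp add: f_def)
    then have ys: "\<sigma> y * s = e" using star_mult[of s y] s(2) ee(1) by simp
    have "\<sigma> y = \<sigma> y * (s * y)" using sy corner_star[OF ee(1) ky(2)] by (simp add: corner_def)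
    also have "\<dots> = y" using ys ky(2) by (simp add: corner_def flip: mult.assoc)
    finally show ?thesis using sy ys ky(2) by auto
  qed
  have "\<exists>y\<in>corner e. x * y = e \<and> y * x = e" if x: "x \<in> corner e" "x \<noteq> 0" for x
  proof -
    have sx: "\<sigma> x \<in> corner e" "\<sigma> x \<noteq> 0" using corner_star[OF ee(1) x(1)] x(2) star_eq_zero by auto
    obtain y where y: "y \<in> corner e" "y * (\<sigma> x * x) = e"
      using sym[of "\<sigma> x * x"] star_self_nonzero[OF x(2)] corner_mult[OF sx(1) x(1)] by (auto simp: star_mult star_star)
    obtain z where z: "z \<in> corner e" "(x * \<sigma> x) * z = e"
      using sym[of "x * \<sigma> x"] star_self_nonzero[OF sx(2)] corner_mult[OF x(1) sx(1)] by (auto simp: star_mult star_star)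
    have l: "(y * \<sigma> x) * x = e" and r: "x * (\<sigma> x * z) = e" using y z by (auto simp: mult.assoc)
    have m: "y * \<sigma> x \<in> corner e" "\<sigma> x * z \<in> corner e" using y z sx corner_mult by auto
    have "y * \<sigma> x = (y * \<sigma> x) * (x * (\<sigma> x * z))" using m(1) r by (simp add: corner_def)
    also have "\<dots> = ((y * \<sigma> x) * x) * (\<sigma> x * z)" by (simp only: mult.assoc)
    also have "\<dots> = \<sigma> x * z" using l m(2) by (simp add: corner_def)
    finally show ?thesis using l r m by auto
  qed
  then show ?thesis using that ee by blast
qed

end

locale division_corner = definite_star_algebra scale Basis \<sigma>
  for scale :: "'f::field \<Rightarrow> 'a::ring_1 \<Rightarrow> 'a" and Basis :: "'a set" and \<sigma> :: "'a \<Rightarrow> 'a" +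
  fixes e :: 'a
  assumes e_star: "\<sigma> e = e" and e_idem: "e * e = e" and e_nz: "e \<noteq> 0"
    and corner_inverse: "x \<in> corner e \<Longrightarrow> x \<noteq> 0 \<Longrightarrow> \<exists>y\<in>corner e. x * y = e \<and> y * x = e"
begin

abbreviation D :: "'a set" where "D \<equiv> corner e"

lemma D_unit: "x \<in> D \<Longrightarrow> e * x = x" "x \<in> D \<Longrightarrow> x * e = x"
  by (auto simp: corner_def)

lemma e_in_D: "e \<in> D"
  using e_idem by (simp add: corner_def)

lemma D_add: "x \<in> D \<Longrightarrow> y \<in> D \<Longrightarrow> x + y \<in> D"
  using subspace_add[OF subspace_corner] .

lemma D_scale: "x \<in> D \<Longrightarrow> scale c x \<in> D"
  using subspace_scale[OF subspace_corner] .

lemma D_star: "x \<in> D \<Longrightarrow> \<sigma> x \<in> D"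
  using corner_star[OF e_star] .

lemma D_no_zero_divisors: "x \<in> D \<Longrightarrow> y \<in> D \<Longrightarrow> x * y = 0 \<Longrightarrow> x \<noteq> 0 \<Longrightarrow> y = 0"
  by (metis D_unit(1) corner_inverse mult.assoc mult_zero_right)

definition Sym_D :: "'a set" where
  "Sym_D = {x\<in>D. \<sigma> x = x}"

definition max_commuting :: "'a set \<Rightarrow> bool" where
  "max_commuting M \<longleftrightarrow> M \<subseteq> Sym_D \<and> (\<forall>s\<in>M. \<forall>t\<in>M. s * t = t * s) \<and>
     (\<forall>s\<in>Sym_D. (\<forall>t\<in>M. s * t = t * s) \<longrightarrow> s \<in> M)"

lemma max_commuting_exists: "\<exists>M. max_commuting M"
proof -
  let ?A = "{M. M \<subseteq> Sym_D \<and> (\<forall>s\<in>M. \<forall>t\<in>M. s * t = t * s)}"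
  have "\<exists>M\<in>?A. \<forall>X\<in>?A. M \<subseteq> X \<longrightarrow> X = M"
  proof (rule subset_Zorn')
    fix C assume C: "subset.chain ?A C"
    have "s * t = t * s" if st: "s \<in> \<Union>C" "t \<in> \<Union>C" for s t
    proof -
      obtain M N where MN: "M \<in> C" "N \<in> C" "s \<in> M" "t \<in> N" using st by blast
      have "M \<subseteq> N \<or> N \<subseteq> M" using subset.chain_total[OF C MN(1,2)] by auto
      then obtain K where "K \<in> C" "s \<in> K" "t \<in> K" using MN by blast
      then show ?thesis using C unfolding subset_chain_def by blast
    qed
    then show "\<Union>C \<in> ?A" using C unfolding subset_chain_def by blast
  qed
  then obtain M where M: "M \<in> ?A" "\<forall>X\<in>?A. M \<subseteq> X \<longrightarrow> X = M" by (elim bexE) (rule that)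
  have "s \<in> M" if s: "s \<in> Sym_D" "\<forall>t\<in>M. s * t = t * s" for s
  proof -
    have "insert s M \<in> ?A" using M(1) s by auto
    from bspec[OF M(2) this] have "insert s M = M" by blast
    then show ?thesis by blast
  qed
  then show ?thesis using M(1) unfolding max_commuting_def by blast
qed

end

section \<open>Ordering a maximal symmetric subfield\<close>

locale max_symmetric_subfield = division_corner scale Basis \<sigma> e
  for scale :: "'f::field \<Rightarrow> 'a::ring_1 \<Rightarrow> 'a" and Basis :: "'a set" and \<sigma> :: "'a \<Rightarrow> 'a" and e :: 'a +
  fixes L :: "'a set"
  assumes max_L: "max_commuting L"
begin

lemma L_D: "t \<in> L \<Longrightarrow> t \<in> D"
  using max_L unfolding max_commuting_def Sym_D_def by blast

lemma L_sym: "t \<in> L \<Longrightarrow> \<sigma> t = t"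
  using max_L unfolding max_commuting_def Sym_D_def by blast

lemma L_commute: "s \<in> L \<Longrightarrow> t \<in> L \<Longrightarrow> s * t = t * s"
  using max_L unfolding max_commuting_def by blast

lemma L_intro: "s \<in> D \<Longrightarrow> \<sigma> s = s \<Longrightarrow> (\<And>t. t \<in> L \<Longrightarrow> s * t = t * s) \<Longrightarrow> s \<in> L"
  using max_L unfolding max_commuting_def Sym_D_def by blast

lemma L_e: "e \<in> L"
  by (rule L_intro) (auto simp: e_in_D e_star D_unit L_D)

lemma L_plus: "s \<in> L \<Longrightarrow> t \<in> L \<Longrightarrow> s + t \<in> L"
  by (rule L_intro) (auto simp: D_add L_D star_add L_sym distrib_left distrib_right L_commute)

lemma L_times: "s \<in> L \<Longrightarrow> t \<in> L \<Longrightarrow> s * t \<in> L"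
proof (rule L_intro)
  assume st: "s \<in> L" "t \<in> L"
  show "s * t \<in> D" using st corner_mult L_D by blast
  show "\<sigma> (s * t) = s * t" using st by (simp add: star_mult L_sym L_commute)
  show "s * t * r = r * (s * t)" if "r \<in> L" for r
    using L_commute st that by (metis mult.assoc)
qed

lemma L_scaled: "t \<in> L \<Longrightarrow> scale c t \<in> L"
  by (rule L_intro) (auto simp: D_scale L_D star_scale L_sym scale_mult_left scale_mult_right L_commute)

lemma L_inv:
  assumes "t \<in> L" "t \<noteq> 0"
  shows "\<exists>s\<in>L. t * s = e"
proof -
  obtain y where y: "y \<in> D" "t * y = e" "y * t = e" using corner_inverse[OF L_D] assms by blast
  have "y \<in> L"
  proof (rule L_intro[OF y(1)])
    have "\<sigma> y * t = e" using star_mult[of t y] y(2) L_sym[OF assms(1)] e_star by simp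
    then have "\<sigma> y * (t * y) = y" using y(1) D_unit by (simp flip: mult.assoc)
    then show "\<sigma> y = y" using y(2) D_unit D_star[OF y(1)] by simp
    show "y * r = r * y" if r: "r \<in> L" for r
    proof -
      have "y * r = y * r * (t * y)" using y(2) D_unit(2)[OF corner_mult[OF y(1) L_D[OF r]]] by simp
      also have "\<dots> = y * (r * t) * y" by (simp only: mult.assoc)
      also have "r * t = t * r" using L_commute[OF r assms(1)] .
      also have "y * (t * r) * y = (y * t) * r * y" by (simp only: mult.assoc)
      also have "\<dots> = r * y" using y(3) D_unit(1)[OF L_D[OF r]] by (simp flip: mult.assoc)
      finally show ?thesis .
    qed
  qed
  then show ?thesis using y by blast
qed

definition cent :: "'a set \<Rightarrow> 'a set" where
  "cent S = {x\<in>D. \<forall>t\<in>S. t * x = x * t}"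

lemma cent_D: "x \<in> cent S \<Longrightarrow> x \<in> D"
  by (simp add: cent_def)

lemma subspace_cent: "subspace (cent S)"
proof -
  have "subspace D" by (rule subspace_corner)
  then show ?thesis unfolding subspace_def cent_def
    by (auto simp: distrib_left distrib_right scale_mult_left scale_mult_right)
qed

lemma cent_mult: "x \<in> cent S \<Longrightarrow> y \<in> cent S \<Longrightarrow> x * y \<in> cent S"
  unfolding cent_def using corner_mult by (auto simp: mult.assoc) (metis mult.assoc)

lemma L_cent: "S \<subseteq> L \<Longrightarrow> t \<in> L \<Longrightarrow> t \<in> cent S"
  unfolding cent_def using L_commute L_D by blast

lemma cent_star:
  assumes "S \<subseteq> L" "x \<in> cent S"
  shows "\<sigma> x \<in> cent S"
proof -
  have "t * \<sigma> x = \<sigma> x * t" if "t \<in> S" for t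
  proof -
    have "\<sigma> (t * x) = \<sigma> (x * t)" using assms that by (simp add: cent_def)
    then show ?thesis using assms(1) that L_sym by (auto simp: star_mult)
  qed
  then show ?thesis using assms D_star by (simp add: cent_def)
qed

abbreviation C :: "'a set" where "C \<equiv> cent L"

lemma C_sym: "x \<in> C \<Longrightarrow> \<sigma> x = x \<Longrightarrow> x \<in> L"
  by (rule L_intro) (auto simp: cent_def)

text \<open>\<sigma>(x) x is symmetric and commutes with \<open>L\<close>, so it belongs to
  \<open>L\<close> by maximality.\<close>

lemma C_norm: "x \<in> C \<Longrightarrow> \<sigma> x * x \<in> L"
  by (rule C_sym) (auto simp: cent_mult cent_star star_mult star_star)

section \<open>Artin-Schreier theory for \<open>L\<close>, with the norms from \<open>C\<close> as
  positive elements\<close>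

definition sums_of_norms :: "'a set" where
  "sums_of_norms = {\<Sum>x\<leftarrow>xs. \<sigma> x * x |xs. set xs \<subseteq> C}"

lemma sums_of_norms_L: "sums_of_norms \<subseteq> L"
proof -
  have "set xs \<subseteq> C \<Longrightarrow> (\<Sum>x\<leftarrow>xs. \<sigma> x * x) \<in> L" for xs
    by (induction xs) (use L_scaled[OF L_e, of 0] L_plus C_norm in auto)
  then show ?thesis by (auto simp: sums_of_norms_def)
qed

lemma norm_in_sums: "x \<in> C \<Longrightarrow> \<sigma> x * x \<in> sums_of_norms"
  unfolding sums_of_norms_def by (rule CollectI, rule exI[of _ "[x]"]) simp

lemma sums_of_norms_add:
  assumes "s \<in> sums_of_norms" "t \<in> sums_of_norms"
  shows "s + t \<in> sums_of_norms"
proof -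
  obtain xs ys where "set xs \<subseteq> C" "set ys \<subseteq> C" "s = (\<Sum>x\<leftarrow>xs. \<sigma> x * x)" "t = (\<Sum>x\<leftarrow>ys. \<sigma> x * x)"
    using assms by (auto simp: sums_of_norms_def)
  then show ?thesis unfolding sums_of_norms_def by (intro CollectI exI[of _ "xs @ ys"]) simp
qed

text \<open>The norm \<sigma>(x) x lies in \<open>L\<close> and hence commutes with y in
  \<open>C\<close>, so \<sigma>(x) x \<sigma>(y) y = \<sigma>(x y) x y.\<close>

lemma sums_of_norms_mult:
  assumes "s \<in> sums_of_norms" "t \<in> sums_of_norms"
  shows "s * t \<in> sums_of_norms"
proof -
  have 1: "(\<sigma> x * x) * r \<in> sums_of_norms" if "x \<in> C" "r \<in> sums_of_norms" for x r
  proof -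
    have "set ys \<subseteq> C \<Longrightarrow> (\<sigma> x * x) * (\<Sum>y\<leftarrow>ys. \<sigma> y * y) \<in> sums_of_norms" for ys
    proof (induction ys)
      case Nil
      show ?case unfolding sums_of_norms_def by (rule CollectI, rule exI[of _ "[]"]) simp
    next
      case (Cons y ys)
      have y: "y \<in> C" using Cons.prems by simp
      then have "\<sigma> y * ((\<sigma> x * x) * y) = \<sigma> y * (y * (\<sigma> x * x))"
        using C_norm[OF that(1)] by (simp add: cent_def)
      moreover have "(\<sigma> y * y) * (\<sigma> x * x) = (\<sigma> x * x) * (\<sigma> y * y)"
        using L_commute C_norm y that(1) by blast
      ultimately have "(\<sigma> x * x) * (\<sigma> y * y) = \<sigma> (x * y) * (x * y)"
        by (simp add: star_mult mult.assoc)
      then show ?case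
        using Cons sums_of_norms_add norm_in_sums[OF cent_mult[OF that(1) y]] by (simp add: distrib_left)
    qed
    then show ?thesis using that(2) by (auto simp: sums_of_norms_def)
  qed
  have "set xs \<subseteq> C \<Longrightarrow> (\<Sum>x\<leftarrow>xs. \<sigma> x * x) * t \<in> sums_of_norms" for xs
  proof (induction xs)
    case Nil
    show ?case unfolding sums_of_norms_def by (rule CollectI, rule exI[of _ "[]"]) simp
  next
    case (Cons x xs)
    then show ?case using 1[OF _ assms(2), of x] sums_of_norms_add by (simp add: distrib_right)
  qed
  then show ?thesis using assms(1) by (auto simp: sums_of_norms_def)
qed

text \<open>Otherwise \<open>e\<close>, which is its own norm, and the given elements would form an
  isotropic vector.\<close>

lemma sums_of_norms_proper: "- e \<notin> sums_of_norms"
proof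
  assume "- e \<in> sums_of_norms"
  then obtain xs where "- e = (\<Sum>x\<leftarrow>xs. \<sigma> x * x)" by (auto simp: sums_of_norms_def)
  then have "(\<Sum>x\<leftarrow>e # xs. \<sigma> x * x) = 0" by (simp add: e_star e_idem flip: \<open>- e = _\<close>)
  from definite[OF this, of e] show False using e_nz by simp
qed

text \<open>Squares from \<open>L\<close> are covered: an element of \<open>L\<close> is symmetric
  and lies in \<open>C\<close>, so its square is its norm.\<close>

definition preordering :: "'a set \<Rightarrow> bool" where
  "preordering P \<longleftrightarrow> sums_of_norms \<subseteq> P \<and> P \<subseteq> L \<and> (\<forall>s\<in>P. \<forall>t\<in>P. s + t \<in> P \<and> s * t \<in> P) \<and> - e \<notin> P"

lemma max_preordering_exists: "\<exists>P. preordering P \<and> (\<forall>Q. preordering Q \<longrightarrow> P \<subseteq> Q \<longrightarrow> Q = P)"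
proof -
  have "\<exists>P\<in>Collect preordering. \<forall>X\<in>Collect preordering. P \<subseteq> X \<longrightarrow> X = P"
  proof (rule subset_Zorn_nonempty)
    have "preordering sums_of_norms"
      using sums_of_norms_L sums_of_norms_add sums_of_norms_mult sums_of_norms_proper by (simp add: preordering_def)
    then show "Collect preordering \<noteq> {}" by blast
    fix \<C> assume ne: "\<C> \<noteq> {}" and ch: "subset.chain (Collect preordering) \<C>"
    have pre: "preordering P" if "P \<in> \<C>" for P using ch that by (auto simp: subset_chain_def)
    have "s + t \<in> \<Union>\<C> \<and> s * t \<in> \<Union>\<C>" if st: "s \<in> \<Union>\<C>" "t \<in> \<Union>\<C>" for s t
    proof -
      obtain M N where MN: "M \<in> \<C>" "N \<in> \<C>" "s \<in> M" "t \<in> N" using st by blast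
      have "M \<subseteq> N \<or> N \<subseteq> M" using subset.chain_total[OF ch MN(1,2)] by auto
      then obtain K where K: "K \<in> \<C>" "s \<in> K" "t \<in> K" using MN by blast
      then have "s + t \<in> K \<and> s * t \<in> K" using pre[OF K(1)] by (simp add: preordering_def)
      then show ?thesis using K(1) by blast
    qed
    moreover have "sums_of_norms \<subseteq> \<Union>\<C>" using ne pre unfolding preordering_def by blast
    moreover have "\<Union>\<C> \<subseteq> L" "- e \<notin> \<Union>\<C>" using pre unfolding preordering_def by blast+
    ultimately show "\<Union>\<C> \<in> Collect preordering" unfolding preordering_def by blast
  qed
  then show ?thesis by blast
qed

text \<open>The theorem of Artin and Schreier: a maximal preordering is an ordering.\<close>

lemma ordering_exists:
  obtains P where "ordered_subfield scale Basis L P e" "sums_of_norms \<subseteq> P"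
proof -
  obtain P where P: "preordering P" and max: "\<And>Q. preordering Q \<Longrightarrow> P \<subseteq> Q \<Longrightarrow> Q = P"
    using max_preordering_exists by metis
  have sub: "sums_of_norms \<subseteq> P" "P \<subseteq> L" and add: "\<And>s t. s \<in> P \<Longrightarrow> t \<in> P \<Longrightarrow> s + t \<in> P"
    and mult: "\<And>s t. s \<in> P \<Longrightarrow> t \<in> P \<Longrightarrow> s * t \<in> P" and proper: "- e \<notin> P"
    using P by (auto simp: preordering_def)
  have sq: "t * t \<in> P" if "t \<in> L" for t
    using norm_in_sums[of t] that L_cent[of L t] L_sym sub by auto
  have eP: "e \<in> P" using sq[OF L_e] e_idem by simp
  have zP: "0 \<in> P" using sq[OF L_scaled[OF L_e, of 0]] by simp
  \<comment> \<open>By maximality, P + x P is not a preordering if x is outside P, and the only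
    condition that can fail is that -e is not in it.\<close>
  have ext: "\<exists>s\<in>P. \<exists>t\<in>P. - e = s + x * t" if x: "x \<in> L" "x \<notin> P" for x
  proof (rule ccontr)
    assume not: "\<not> ?thesis"
    let ?Q = "{s + x * t |s t. s \<in> P \<and> t \<in> P}"
    have PQ: "P \<subseteq> ?Q" using zP by force
    have "preordering ?Q"
      unfolding preordering_def
    proof (intro conjI ballI)
      show "sums_of_norms \<subseteq> ?Q" using sub PQ by blast
      show "?Q \<subseteq> L" using sub x L_plus L_times by blast
      show "- e \<notin> ?Q" using not by blast
      fix a b assume "a \<in> ?Q" "b \<in> ?Q"
      then obtain s t u v where ab: "s \<in> P" "t \<in> P" "u \<in> P" "v \<in> P" "a = s + x * t" "b = u + x * v" by blast
      have "a + b = (s + u) + x * (t + v)" using ab by (simp add: algebra_simps)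
      then show "a + b \<in> ?Q" using add ab by blast
      have c: "s * x = x * s" "t * x = x * t" using L_commute x ab(1,2) sub by blast+
      have "a * b = (s * u + x * x * (t * v)) + x * (s * v + t * u)"
        using ab(5,6) c by (simp add: distrib_left distrib_right add_ac) (metis mult.assoc)
      moreover have "s * u + x * x * (t * v) \<in> P" "s * v + t * u \<in> P"
        using add mult ab sq[OF x(1)] by simp_all
      ultimately show "a * b \<in> ?Q" by blast
    qed
    then have "?Q = P" using max PQ by blast
    moreover have "x \<in> ?Q" using zP eP D_unit(2)[OF L_D[OF x(1)]] by force
    ultimately show False using x by simp
  qed
  have "ordered_subfield scale Basis L P e"
  proof unfold_locales
    show "t \<in> P \<or> - t \<in> P" if t: "t \<in> L" for t
    proof (rule ccontr)
      assume not: "\<not> ?thesis"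
      have mt: "- t \<in> L" using L_scaled[OF t, of "-1"] by simp
      obtain a b where ab: "a \<in> P" "b \<in> P" "- e = a + t * b" using ext[OF t] not by blast
      obtain c d where cd: "c \<in> P" "d \<in> P" "- e = c + (- t) * d" using ext[OF mt] not by blast
      have L: "a \<in> L" "b \<in> L" "c \<in> L" "d \<in> L" using ab cd sub by auto
      \<comment> \<open>The two relations read e + a = - t b and e + c = t d. In their product t
        occurs only as a square, which brings -e into P.\<close>
      have "(e + a) * (e + c) = - ((t * t) * (b * d))"
      proof -
        have 1: "e + a = - (t * b)" using ab(3) by (metis add.assoc add.commute add_eq_0_iff neg_eq_iff_add_eq_0)
        have 2: "e + c = t * d"
        proof -
          have "e + c = e + (c + (- t) * d) + t * d" by (simp add: algebra_simps)
          also have "c + (- t) * d = - e" using cd(3) by simp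
          finally show ?thesis by simp
        qed
        have "b * t = t * b" using L_commute L t by blast
        then show ?thesis unfolding 1 2 by (simp add: mult.assoc) (metis mult.assoc)
      qed
      moreover have "(e + a) * (e + c) = e + (a + c + a * c)"
        using D_unit L_D L e_idem by (simp add: distrib_left distrib_right add_ac)
      ultimately have "- e = (a + c + a * c) + (t * t) * (b * d)"
        by (simp add: add_ac eq_neg_iff_add_eq_0 minus_unique)
      then have "- e \<in> P" using add mult ab(1,2) cd(1,2) sq[OF t] by simp
      then show False using proper by simp
    qed
    show "t = 0" if t: "t \<in> P" "- t \<in> P" for t
    proof (rule ccontr)
      assume "t \<noteq> 0"
      then obtain s where s: "s \<in> L" "t * s = e" using L_inv sub t by blast
      \<comment> \<open>As s is the inverse of t, this element is -e.\<close>
      have "(- t) * t * (s * s) \<in> P" using mult t sq[OF s(1)] by blast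
      also have "(- t) * t * (s * s) = - (t * (t * s) * s)" by (simp add: mult.assoc)
      also have "t * (t * s) * s = e"
        using s D_unit(2)[OF L_D] t sub by (metis subsetD)
      finally show False using proper by simp
    qed
  qed (use L_e e_nz L_plus L_times L_scaled L_commute D_unit L_D L_inv add mult sub in auto)
  then show ?thesis using that sub(1) by blast
qed

end

section \<open>Separability, complements of centralizers and the projection to
  \<open>L\<close>\<close>

locale ordered_corner =
  max_symmetric_subfield scale Basis \<sigma> e L + ordered_subfield scale Basis L P e
  for scale :: "'f::field \<Rightarrow> 'a::ring_1 \<Rightarrow> 'a" and Basis :: "'a set" and \<sigma> :: "'a \<Rightarrow> 'a" and e :: 'a
    and L P :: "'a set" +
  assumes norms_positive: "sums_of_norms \<subseteq> P"
begin

text \<open>Positive multiples of \<open>e\<close> are positive. The resulting characteristic 0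
  makes degrees of derivatives drop by exactly one.\<close>

lemma of_nat_nonzero: "(of_nat (Suc m) :: 'f) \<noteq> 0"
proof -
  have eP: "e \<in> P" using P_square[OF L_e] e_idem by simp
  have "scale (of_nat (Suc m)) e \<in> P \<and> scale (of_nat (Suc m)) e \<noteq> 0"
  proof (induction m)
    case (Suc m)
    have "scale (of_nat (Suc (Suc m))) e = e + scale (of_nat (Suc m)) e"
      unfolding of_nat_Suc[of "Suc m"] scale_left_distrib by simp
    then show ?case using Suc eP P_add P_add_nonzero e_nz by (simp del: of_nat_Suc)
  qed (simp add: eP e_nz)
  then show ?thesis by auto
qed

lemma pderiv_degree_pred:
  assumes "degree (f :: 'f poly) = Suc m"
  shows "degree (pderiv f) = m" "pderiv f \<noteq> 0"
proof -
  have "coeff (pderiv f) m = of_nat (Suc m) * coeff f (Suc m)" by (rule coeff_pderiv)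
  moreover have "coeff f (Suc m) \<noteq> 0" using assms by (metis degree_0 leading_coeff_0_iff nat.simps(3))
  ultimately have nz: "coeff (pderiv f) m \<noteq> 0" using of_nat_nonzero[of m] by (simp del: of_nat_Suc)
  have "degree (pderiv f) \<le> m"
    by (rule degree_le) (simp add: coeff_pderiv coeff_eq_0 assms)
  then show "degree (pderiv f) = m" using nz le_degree by (metis le_antisym)
  show "pderiv f \<noteq> 0" using nz by auto
qed

lemma annihilating_poly_exists: "\<exists>f. f \<noteq> 0 \<and> e * evl a f = 0"
proof -
  define w where "w k = e * evl a (monom 1 k)" for k
  have evl_sum: "e * evl a (\<Sum>k\<in>A. monom (c k) k) = (\<Sum>k\<in>A. scale (c k) (w k))" if "finite A" for A c
    using that
  proof (induction A)
    case (insert k A)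
    have "monom (c k) k = smult (c k) (monom 1 k)" by (simp add: smult_monom)
    then show ?case using insert by (simp add: distrib_left w_def scale_mult_right)
  qed simp
  let ?A = "{..card Basis}"
  show ?thesis
  \<comment> \<open>Linear dependence concerns the set of the elements \<open>w k\<close>, so a
    coincidence of two of them is treated apart; it yields a difference of two monomials.\<close>
  proof (cases "inj_on w ?A")
    case True
    have "dependent (w ` ?A)"
    proof (rule dependent_biggerset_general)
      show "dim (w ` ?A) < card (w ` ?A)"
        using dim_le_dimension[of "w ` ?A"] by (simp add: card_image[OF True])
    qed
    then obtain c v where c: "v \<in> w ` ?A" "c v \<noteq> 0" "(\<Sum>v\<in>w ` ?A. scale (c v) v) = 0"
      using dependent_finite[of "w ` ?A"] by auto
    define f where "f = (\<Sum>k\<in>?A. monom (c (w k)) k)"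
    have "e * evl a f = 0"
      using c(3) unfolding f_def evl_sum[OF finite_atMost] by (simp add: sum.reindex[OF True])
    moreover obtain k where k: "k \<in> ?A" "v = w k" using c(1) by blast
    then have "coeff f k = c (w k)"
      by (simp add: f_def coeff_sum sum.delta)
    then have "f \<noteq> 0" using c(2) k by auto
    ultimately show ?thesis by blast
  next
    case False
    then obtain i j where ij: "i \<noteq> j" "w i = w j" by (auto simp: inj_on_def)
    let ?f = "monom 1 i - monom 1 j :: 'f poly"
    have "e * evl a ?f = w i - w j"
      using evl_add[of a "monom 1 i" "- monom 1 j"] by (simp add: w_def right_diff_distrib)
    moreover have "coeff ?f i = 1" using ij(1) by simp
    then have "?f \<noteq> 0" by (metis coeff_0 zero_neq_one)
    ultimately show ?thesis using ij(2) by (intro exI[of _ ?f]) simp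
  qed
qed

text \<open>Take f of minimal degree among the nonzero polynomials that vanish at a. In
  characteristic 0 its derivatives up to order n are nonzero and of smaller degree, so none of them
  vanishes at a.\<close>

lemma separable_annihilator:
  obtains f n where "degree f = n" "n \<ge> 1" "e * evl a f = 0"
    "\<forall>i\<in>{1..n}. e * evl a ((pderiv ^^ i) f) \<noteq> 0"
proof -
  obtain f where f: "f \<noteq> 0 \<and> e * evl a f = 0"
    and min: "\<And>g. g \<noteq> 0 \<and> e * evl a g = 0 \<Longrightarrow> degree f \<le> degree g"
    using ex_has_least_nat[of "\<lambda>f. f \<noteq> 0 \<and> e * evl a f = 0" _ degree] annihilating_poly_exists[of a] by metis
  have n: "degree f \<ge> 1"
  proof (rule ccontr)
    assume "\<not> degree f \<ge> 1"
    then obtain c where c: "f = [:c:]" by (metis degree_eq_zeroE less_one not_le)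
    then show False using f e_nz by (simp add: scale_mult_right)
  qed
  have "i \<le> degree f \<Longrightarrow> (pderiv ^^ i) f \<noteq> 0 \<and> degree ((pderiv ^^ i) f) = degree f - i" for i
  proof (induction i)
    case (Suc i)
    then have "degree ((pderiv ^^ i) f) = Suc (degree f - Suc i)" by simp
    then show ?case using pderiv_degree_pred by simp
  qed (use f in simp)
  then have "e * evl a ((pderiv ^^ i) f) \<noteq> 0" if "1 \<le> i" "i \<le> degree f" for i
    using min[of "(pderiv ^^ i) f"] that n by fastforce
  then show ?thesis using that[of f "degree f"] f n by simp
qed

lemma commutator_square_D:
  assumes a: "a \<in> L" and x: "x \<in> D" and sq: "a * (a * x - x * a) - (a * x - x * a) * a = 0"
  shows "a * x - x * a = 0"
proof -
  obtain f n where f: "degree f = n" "n \<ge> 1" "e * evl a f = 0"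
    "\<forall>i\<in>{1..n}. e * evl a ((pderiv ^^ i) f) \<noteq> 0"
    by (rule separable_annihilator[of a])
  have "e * evl a (pderiv f) \<noteq> 0" using bspec[OF f(4), of 1] f(2) by simp
  from commutator_square[OF a D_unit[OF x] f(3) this] sq show ?thesis by simp
qed

lemma cent_stable:
  assumes "S \<subseteq> L" "t \<in> L" "x \<in> cent S"
  shows "t * x \<in> cent S" "x * t \<in> cent S"
  using L_cent assms cent_mult by blast+

text \<open>Induction on S. On the centralizer of S, the commutator T with a new element a has the
  same kernel as its square. So this space is the direct sum of ker T, the centralizer of the
  enlarged set, and the image of T, which is added to I. The image is stable under \<open>L\<close>
  because \<open>L\<close> commutes with a, and under \<sigma> because \<sigma> T = - T
  \<sigma>.\<close>

lemma complement_exists: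
  assumes "finite S" "S \<subseteq> L"
  shows "\<exists>I. subspace I \<and> I \<subseteq> D \<and> (\<forall>x\<in>D. \<exists>c\<in>cent S. \<exists>i\<in>I. x = c + i) \<and> cent S \<inter> I \<subseteq> {0} \<and>
    (\<forall>x\<in>I. \<forall>t\<in>L. t * x \<in> I \<and> x * t \<in> I) \<and> (\<forall>x\<in>I. \<sigma> x \<in> I)"
  using assms
proof (induction S)
  case empty
  have "cent {} = D" by (simp add: cent_def)
  then show ?case
    by (intro exI[of _ "{0}"]) (auto simp: star_zero corner_def)
next
  case (insert a S)
  then have a: "a \<in> L" and S: "S \<subseteq> L" by auto
  obtain I where I: "subspace I" "I \<subseteq> D" "\<forall>x\<in>D. \<exists>c\<in>cent S. \<exists>i\<in>I. x = c + i" "cent S \<inter> I \<subseteq> {0}"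
    "\<forall>x\<in>I. \<forall>t\<in>L. t * x \<in> I \<and> x * t \<in> I" "\<forall>x\<in>I. \<sigma> x \<in> I"
    using insert by (elim meta_impE exE conjE) (auto intro: that)
  define T where "T x = a * x - x * a" for x
  have T: "Vector_Spaces.linear scale scale T"
    by unfold_locales (auto simp: T_def algebra_simps scale_mult_left scale_mult_right scale_right_diff_distrib)
  interpret T: Vector_Spaces.linear scale scale T by (rule T)
  have TU: "T x \<in> cent S" if "x \<in> cent S" for x
    unfolding T_def using cent_stable[OF S a that] subspace_diff[OF subspace_cent] by blast
  have sq: "T x = 0" if "x \<in> cent S" "T (T x) = 0" for x
    using commutator_square_D[OF a cent_D[OF that(1)]] that(2) by (simp add: T_def)
  have ker: "x \<in> cent (insert a S) \<longleftrightarrow> x \<in> cent S \<and> T x = 0" for x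
    by (auto simp: cent_def T_def)
  let ?J = "{i + y |i y. i \<in> I \<and> y \<in> T ` cent S}"
  have Tsub: "subspace (T ` cent S)" using T.subspace_image subspace_cent .
  have dec: "\<exists>c\<in>cent (insert a S). \<exists>i\<in>?J. x = c + i" if x: "x \<in> D" for x
  proof -
    obtain c i where c: "c \<in> cent S" "i \<in> I" "x = c + i" using I(3) x by blast
    obtain k y where k: "k \<in> cent S" "y \<in> cent S" "T k = 0" "c = k + T y"
      using kernel_image_decomposition[OF subspace_cent T TU sq c(1)] by blast
    have "x = k + (i + T y)" using c(3) k(4) by (simp add: add_ac)
    moreover have "k \<in> cent (insert a S)" using k ker by simp
    ultimately show ?thesis using c(2) k(2) by blast
  qed
  have int: "x = 0" if x: "x \<in> cent (insert a S)" "x \<in> ?J" for x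
  proof -
    obtain i y where iy: "i \<in> I" "y \<in> cent S" "x = i + T y" using x(2) by blast
    have "x \<in> cent S" using x(1) ker by blast
    then have "x - T y \<in> cent S" using subspace_diff[OF subspace_cent] TU iy(2) by blast
    then have "i \<in> cent S \<inter> I" using iy by simp
    then have "i = 0" using I(4) by blast
    then have "T (T y) = 0" using iy(3) x(1) ker by simp
    then show ?thesis using sq iy \<open>i = 0\<close> by simp
  qed
  have JD: "?J \<subseteq> D"
    using I(2) TU cent_D D_add by blast
  have stab: "t * x \<in> ?J \<and> x * t \<in> ?J" if h: "x \<in> ?J" "t \<in> L" for x t
  proof -
    obtain i y where iy: "i \<in> I" "y \<in> cent S" "x = i + T y" using h(1) by blast
    have "a * t = t * a" using L_commute a h(2) by blast
    then have "t * T y = T (t * y)" "T y * t = T (y * t)"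
    proof -
      have "t * (a * y) = a * (t * y)" "(y * a) * t = (y * t) * a"
        using \<open>a * t = t * a\<close> by (metis mult.assoc)+
      then show "t * T y = T (t * y)" "T y * t = T (y * t)"
        by (simp_all add: T_def right_diff_distrib left_diff_distrib mult.assoc)
    qed
    then have "t * x = t * i + T (t * y)" "x * t = i * t + T (y * t)"
      using iy(3) by (simp_all add: distrib_left distrib_right)
    then show ?thesis using I(5) iy h(2) cent_stable[OF S h(2) iy(2)] by blast
  qed
  have star: "\<sigma> x \<in> ?J" if h: "x \<in> ?J" for x
  proof -
    obtain i y where iy: "i \<in> I" "y \<in> cent S" "x = i + T y" using h by blast
    have "\<sigma> (T y) = T (- \<sigma> y)"
      using L_sym[OF a] by (simp add: T_def star_diff star_mult)
    then have "\<sigma> x = \<sigma> i + T (- \<sigma> y)" using iy(3) by (simp add: star_add)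
    moreover have "- \<sigma> y \<in> cent S" using cent_star[OF S iy(2)] subspace_neg[OF subspace_cent] by blast
    ultimately show ?thesis using I(6) iy(1) by blast
  qed
  show ?case
    by (intro exI[of _ ?J] conjI ballI subsetI)
      (use subspace_sums[OF I(1) Tsub] JD dec int stab star in auto)
qed

text \<open>S spans \<open>L\<close> over the base field; commuting with x is a linear condition, so
  it passes from S to \<open>L\<close>.\<close>

lemma finite_generators:
  obtains S where "finite S" "S \<subseteq> L" "cent S = C"
proof -
  have "subspace L"
    by (intro subspaceI) (auto simp: L_zero L_plus L_scaled)
  then obtain S where S: "finite S" "S \<subseteq> L" "span S = L"
    using basis_subspace_exists by metis
  have "x \<in> C" if x: "x \<in> cent S" for x
  proof -
    have "subspace {t. t * x = x * t}"
      by (intro subspaceI) (auto simp: distrib_left distrib_right scale_mult_left scale_mult_right)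
    moreover have "S \<subseteq> {t. t * x = x * t}" using x by (auto simp: cent_def)
    ultimately have "span S \<subseteq> {t. t * x = x * t}" by (intro span_minimal)
    then show ?thesis using x S(3) by (auto simp: cent_def)
  qed
  moreover have "C \<subseteq> cent S" using S(2) by (auto simp: cent_def)
  ultimately show ?thesis using that S by blast
qed

text \<open>Project D to \<open>C\<close> along the complement just found, then average the result
  with its image under \<sigma>; the average is symmetric and so lies in \<open>L\<close>.
  Uniqueness of the decomposition makes the projection compatible with sums, with \<open>L\<close>
  and with \<sigma>.\<close>

lemma bimodule_projection:
  obtains \<phi> where "\<And>x y. x \<in> D \<Longrightarrow> y \<in> D \<Longrightarrow> \<phi> (x + y) = \<phi> x + \<phi> y" "\<And>x. x \<in> D \<Longrightarrow> \<phi> x \<in> L"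
    "\<And>x t. x \<in> D \<Longrightarrow> t \<in> L \<Longrightarrow> \<phi> (t * x) = t * \<phi> x" "\<And>x. x \<in> D \<Longrightarrow> \<phi> (\<sigma> x) = \<phi> x"
    "\<And>t. t \<in> L \<Longrightarrow> \<phi> t = t"
proof -
  obtain S where S: "finite S" "S \<subseteq> L" "cent S = C" by (rule finite_generators)
  obtain I where I: "subspace I" "I \<subseteq> D" "\<forall>x\<in>D. \<exists>c\<in>C. \<exists>i\<in>I. x = c + i" "C \<inter> I \<subseteq> {0}"
    "\<forall>x\<in>I. \<forall>t\<in>L. t * x \<in> I \<and> x * t \<in> I" "\<forall>x\<in>I. \<sigma> x \<in> I"
    using complement_exists[OF S(1,2)] unfolding S(3) by (elim exE conjE) (rule that)
  have "\<exists>c. c \<in> C \<and> x - c \<in> I" if x: "x \<in> D" for x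
  proof -
    obtain c i where "c \<in> C" "i \<in> I" "x = c + i" using I(3) x by blast
    then show ?thesis by (intro exI[of _ c]) simp
  qed
  then obtain pr where pr: "\<And>x. x \<in> D \<Longrightarrow> pr x \<in> C \<and> x - pr x \<in> I" by metis
  have uniq: "pr x = c" if "x \<in> D" "c \<in> C" "x - c \<in> I" for x c
  proof -
    have "pr x - c = (x - c) - (x - pr x)" by simp
    then have "pr x - c \<in> C \<inter> I"
      using pr[OF that(1)] that subspace_diff[OF subspace_cent] subspace_diff[OF I(1)] by (metis IntI)
    then show ?thesis using I(4) by auto
  qed
  define \<phi> where "\<phi> x = scale (1 / 2) (pr x + \<sigma> (pr x))" for x
  have half: "scale (1 / 2) (t + t) = t" for t
  proof -
    have "scale (1 / 2) (t + t) = scale (1 / 2 * 2) t"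
      by (metis one_add_one scale_left_distrib scale_one scale_scale)
    then show ?thesis using two_nonzero by simp
  qed
  show ?thesis
  proof (rule that[of \<phi>])
    show "\<phi> (x + y) = \<phi> x + \<phi> y" if "x \<in> D" "y \<in> D" for x y
    proof -
      have "pr (x + y) = pr x + pr y"
      proof (rule uniq)
        have "x + y - (pr x + pr y) = (x - pr x) + (y - pr y)" by simp
        then show "x + y - (pr x + pr y) \<in> I" using pr that subspace_add[OF I(1)] by metis
      qed (use that pr D_add subspace_add[OF subspace_cent] in blast)+
      then show ?thesis by (simp add: \<phi>_def star_add scale_right_distrib add_ac)
    qed
    show "\<phi> x \<in> L" if "x \<in> D" for x
    proof (rule C_sym)
      show "\<phi> x \<in> C" unfolding \<phi>_def
        using pr[OF that] cent_star[OF subset_refl] subspace_add[OF subspace_cent] subspace_scale[OF subspace_cent] by blast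
      show "\<sigma> (\<phi> x) = \<phi> x" by (simp add: \<phi>_def star_scale star_add star_star add.commute)
    qed
    show "\<phi> (t * x) = t * \<phi> x" if "x \<in> D" "t \<in> L" for x t
    proof -
      have "pr (t * x) = t * pr x"
      proof (rule uniq)
        have "t * x - t * pr x = t * (x - pr x)" by (simp add: right_diff_distrib)
        then show "t * x - t * pr x \<in> I" using pr[OF that(1)] I(5) that(2) by simp
      qed (use that pr corner_mult L_D cent_stable[OF subset_refl] in blast)+
      moreover have "\<sigma> (t * pr x) = t * \<sigma> (pr x)"
        using L_sym[OF that(2)] cent_star[OF subset_refl] pr[OF that(1)] that(2) by (simp add: star_mult cent_def)
      ultimately show ?thesis by (simp add: \<phi>_def distrib_left scale_mult_right)
    qed
    show "\<phi> (\<sigma> x) = \<phi> x" if "x \<in> D" for x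
    proof -
      have "pr (\<sigma> x) = \<sigma> (pr x)"
      proof (rule uniq)
        show "\<sigma> x - \<sigma> (pr x) \<in> I" using pr[OF that] I(6) by (simp flip: star_diff)
      qed (use that pr D_star cent_star[OF subset_refl] in blast)+
      then show ?thesis by (simp add: \<phi>_def star_star add.commute)
    qed
    show "\<phi> t = t" if "t \<in> L" for t
    proof -
      have "pr t = t" using uniq[of t t] L_D[OF that] L_cent[OF subset_refl that] subspace_0[OF I(1)] by simp
      then show ?thesis by (simp add: \<phi>_def L_sym[OF that] half)
    qed
  qed
qed

end

section \<open>The cone of elements of maximal signature\<close>

locale trace_form = ordered_corner scale Basis \<sigma> e L P
  for scale :: "'f::field \<Rightarrow> 'a::ring_1 \<Rightarrow> 'a" and Basis :: "'a set" and \<sigma> :: "'a \<Rightarrow> 'a" and e :: 'a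
    and L P :: "'a set" +
  fixes \<phi> :: "'a \<Rightarrow> 'a"
  assumes proj_add: "x \<in> D \<Longrightarrow> y \<in> D \<Longrightarrow> \<phi> (x + y) = \<phi> x + \<phi> y"
    and proj_L: "x \<in> D \<Longrightarrow> \<phi> x \<in> L"
    and proj_left: "x \<in> D \<Longrightarrow> t \<in> L \<Longrightarrow> \<phi> (t * x) = t * \<phi> x"
    and proj_star: "x \<in> D \<Longrightarrow> \<phi> (\<sigma> x) = \<phi> x"
    and proj_id: "t \<in> L \<Longrightarrow> \<phi> t = t"
begin

section \<open>Hermitian forms transferred to \<open>L\<close> and their signatures\<close>

definition herm :: "'a \<Rightarrow> 'a \<Rightarrow> 'a \<Rightarrow> 'a" where
  "herm d x y = \<phi> (\<sigma> x * (d * y))"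

lemma proj_zero: "\<phi> 0 = 0"
  using proj_id[OF L_zero] .

lemma proj_minus: "x \<in> D \<Longrightarrow> \<phi> (- x) = - \<phi> x"
  using proj_add[of x "- x"] proj_zero subspace_neg[OF subspace_corner] by (simp add: add_eq_0_iff)

lemma Sym_DD: "d \<in> Sym_D \<Longrightarrow> d \<in> D" "d \<in> Sym_D \<Longrightarrow> \<sigma> d = d"
  by (auto simp: Sym_D_def)

lemma L_Sym_D: "t \<in> L \<Longrightarrow> t \<in> Sym_D"
  using L_D L_sym by (simp add: Sym_D_def)

lemma herm_arg: "x \<in> D \<Longrightarrow> y \<in> D \<Longrightarrow> d \<in> D \<Longrightarrow> \<sigma> x * (d * y) \<in> D"
  using corner_mult D_star by blast

lemma lsub_cent: "S \<subseteq> L \<Longrightarrow> lsub (cent S)"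
  unfolding lsub_def using subspace_cent cent_stable(2) D_unit(2) cent_D by blast

lemma cent_empty: "cent {} = D"
  by (simp add: cent_def)

lemma lsub_D: "lsub D"
  using lsub_cent[of "{}"] by (simp add: cent_empty)

lemma sform_herm:
  assumes "d \<in> Sym_D"
  shows "sform D (herm d)"
  unfolding sform_def
proof (intro ballI conjI)
  fix x y assume xy: "x \<in> D" "y \<in> D"
  note d = Sym_DD[OF assms]
  show "herm d x y \<in> L" unfolding herm_def using proj_L herm_arg xy d by blast
  have "\<sigma> (\<sigma> x * (d * y)) = \<sigma> y * (d * x)"
    by (simp add: star_mult star_star d(2) mult.assoc)
  then show "herm d y x = herm d x y"
    unfolding herm_def using proj_star[OF herm_arg[OF xy d(1)]] by simp
  show "herm d (x + z) y = herm d x y + herm d z y" if "z \<in> D" for z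
    unfolding herm_def using proj_add herm_arg xy d that by (simp add: star_add distrib_right)
  show "herm d (x * t) y = t * herm d x y" if "t \<in> L" for t
    unfolding herm_def using proj_left[OF herm_arg[OF xy d(1)] that] that
    by (simp add: star_mult L_sym mult.assoc)
qed

lemma star_evl: "\<sigma> a = a \<Longrightarrow> \<sigma> (evl a g) = evl a g"
  by (induction g) (simp_all add: star_zero star_add star_scale star_one star_mult evl_commute)

text \<open>The elements a of S are added one by one with \<open>sgn_form_kernel\<close>. Twisting
  by g(a) changes t into t g(a), again an element of \<open>L\<close>; as the claim covers all t in
  \<open>L\<close>, the induction hypothesis supplies the vanishing that is asked for.\<close>

lemma herm_vanish_cent:
  assumes "\<And>d. d \<in> Sym_D \<Longrightarrow> sgn_form D (herm d) = 0" "finite S" "S \<subseteq> L" "t \<in> L"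
  shows "sgn_form (cent S) (herm t) = 0"
  using assms(2-4)
proof (induction S arbitrary: t)
  case empty
  then show ?case using assms(1) L_Sym_D by (simp add: cent_empty)
next
  case (insert a S)
  then have a: "a \<in> L" and S: "S \<subseteq> L" and t: "t \<in> L" by auto
  obtain f n where f: "degree f = n" "n \<ge> 1" "e * evl a f = 0"
    "\<forall>i\<in>{1..n}. e * evl a ((pderiv ^^ i) f) \<noteq> 0"
    by (rule separable_annihilator[of a])
  have "sgn_form {x \<in> cent S. a * x = x * a} (herm t) = 0"
  proof (rule sgn_form_kernel[OF lsub_cent[OF S] cent_stable(1)[OF S a] D_unit(1)[OF cent_D] a _ _ f(1-3)])
    show "sform (cent S) (herm t)"
      using sform_subset[OF sform_herm[OF L_Sym_D[OF t]]] cent_D by blast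
    show "herm t (a * x) y = herm t x (a * y)" for x y
    proof -
      have "a * (t * y) = t * (a * y)"
        using L_commute[OF a t] by (simp flip: mult.assoc)
      then have "\<sigma> (a * x) * (t * y) = \<sigma> x * (t * (a * y))"
        by (simp only: star_mult L_sym[OF a] mult.assoc)
      then show ?thesis by (simp add: herm_def)
    qed
    show "e * evl a ((pderiv ^^ i) f) \<noteq> 0" if "1 \<le> i" "i \<le> n" for i
      using f(4) that by simp
    show "sgn_form (cent S) (\<lambda>x y. herm t (evl a g * x) y) = 0" for g
    proof -
      have "sgn_form (cent S) (\<lambda>x y. herm t (evl a g * x) y) = sgn_form (cent S) (herm (t * (e * evl a g)))"
      proof (rule sgn_form_cong)
        fix x
        have te: "t * (e * evl a g) = t * evl a g"
          using L_one[OF t] by (simp flip: mult.assoc)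
        have "evl a g * t = t * evl a g"
          by (rule evl_commute_elem[OF L_commute[OF a t]])
        then have "evl a g * (t * x) = (t * evl a g) * x"
          by (simp flip: mult.assoc)
        then have "\<sigma> (evl a g * x) * (t * x) = \<sigma> x * ((t * (e * evl a g)) * x)"
          unfolding te by (simp only: star_mult star_evl[OF L_sym[OF a]] mult.assoc)
        then show "herm t (evl a g * x) x = herm (t * (e * evl a g)) x x"
          by (simp add: herm_def)
      qed
      also have "\<dots> = 0"
        by (rule insert.IH[OF S L_times[OF t evl_in_L[OF a]]])
      finally show ?thesis .
    qed
  qed
  moreover have "{x \<in> cent S. a * x = x * a} = cent (insert a S)"
    by (auto simp: cent_def)
  ultimately show ?case by simp
qed

text \<open>If all signatures were 0, so would be that of \<open>herm e\<close> on \<open>C\<close>.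
  But there the form is x -> \<sigma>(x) x, which is positive definite, and \<open>C\<close>
  contains \<open>e\<close>.\<close>

lemma signature_nonzero: "\<exists>d\<in>Sym_D. sgn_form D (herm d) \<noteq> 0"
proof (rule ccontr)
  assume not: "\<not> ?thesis"
  obtain S where S: "finite S" "S \<subseteq> L" "cent S = C" by (rule finite_generators)
  have "sgn_form C (herm e) = 0"
    using herm_vanish_cent[OF _ S(1,2) L_e] not S(3) by auto
  moreover have "posd (herm e) C"
    unfolding posd_def
  proof (intro ballI impI)
    fix x assume x: "x \<in> C" "x \<noteq> 0"
    have "herm e x x = \<sigma> x * x"
      using D_unit(1)[OF cent_D[OF x(1)]] proj_id[OF C_norm[OF x(1)]] by (simp add: herm_def)
    then show "herm e x x \<in> P \<and> herm e x x \<noteq> 0"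
      using norm_in_sums[OF x(1)] norms_positive star_self_nonzero[OF x(2)] by auto
  qed
  ultimately have "dim C = 0"
    using sgn_form_posd[OF lsub_cent[OF subset_refl]] by simp
  moreover have "e \<in> C" using L_cent L_e by blast
  ultimately show False using e_nz by auto
qed

definition mu :: "'a \<Rightarrow> int" where
  "mu d = sgn_form D (herm d)"

lemma mu_minus:
  assumes "d \<in> Sym_D"
  shows "mu (- d) = - mu d"
proof -
  have "mu (- d) = sgn_form D (\<lambda>x y. - herm d x y)"
    unfolding mu_def
    by (rule sgn_form_cong) (simp add: herm_def proj_minus herm_arg Sym_DD[OF assms])
  then show ?thesis by (simp add: mu_def sgn_form_uminus)
qed

text \<open>Left multiplication by x is an isometry on D, injective because D has no zero
  divisors.\<close>

lemma mu_congruence: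
  assumes d: "d \<in> Sym_D" and x: "x \<in> D" "x \<noteq> 0"
  shows "\<sigma> x * d * x \<in> Sym_D" "mu (\<sigma> x * d * x) = mu d"
proof -
  show s: "\<sigma> x * d * x \<in> Sym_D"
    using Sym_DD[OF d] x(1) corner_mult D_star by (simp add: Sym_D_def star_mult star_star mult.assoc)
  show "mu (\<sigma> x * d * x) = mu d"
    unfolding mu_def
  proof (rule sgn_form_isometry1[OF lsub_D lsub_D sform_herm[OF s] sform_herm[OF d], where f = "\<lambda>y. x * y"])
    show "herm d (x * y) (x * y) = herm (\<sigma> x * d * x) y y" for y
      by (simp add: herm_def star_mult mult.assoc)
    show "y = 0" if "y \<in> D" "x * y = 0" for y
      using D_no_zero_divisors[OF x(1) that x(2)] .
    show "x * y \<in> D" if "y \<in> D" for y using corner_mult[OF x(1) that] .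
  qed (simp_all add: distrib_left scale_mult_right)
qed

lemma mu_scale:
  assumes d: "d \<in> Sym_D" and u: "scale u e \<in> P" "u \<noteq> 0"
  shows "mu (scale u d) = mu d"
proof -
  have "mu (scale u d) = sgn_form D (\<lambda>x y. scale u e * herm d x y)"
    unfolding mu_def
  proof (rule sgn_form_cong)
    fix x assume x: "x \<in> D"
    have arg: "\<sigma> x * (d * x) \<in> D" using herm_arg x Sym_DD(1)[OF d] by blast
    have "\<sigma> x * (scale u d * x) = scale u e * (\<sigma> x * (d * x))"
      using D_unit(1)[OF arg] by (simp add: scale_mult_left scale_mult_right)
    then show "herm (scale u d) x x = scale u e * herm d x x"
      unfolding herm_def using proj_left[OF arg L_scaled[OF L_e]] by simp
  qed
  also have "\<dots> = mu d"
    unfolding mu_def using sgn_form_scale[OF sform_herm[OF d] u(1)] u(2) e_nz by simp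
  finally show ?thesis .
qed

lemma Sym_D_inverse:
  assumes "c \<in> Sym_D" "c \<noteq> 0"
  obtains i where "i \<in> Sym_D" "c * i = e" "i * c = e"
proof -
  obtain i where i: "i \<in> D" "c * i = e" "i * c = e"
    using corner_inverse Sym_DD assms by blast
  have "\<sigma> i * c = e" using star_mult[of c i] i(2) Sym_DD(2)[OF assms(1)] e_star by simp
  then have "\<sigma> i = i"
    using i D_unit(1)[OF i(1)] D_unit(2)[OF D_star[OF i(1)]] by (metis mult.assoc)
  then show ?thesis using that i by (simp add: Sym_D_def)
qed

text \<open>The isometry \<open>\<langle>c, d\<rangle> \<cong> \<langle>c + d, c\<inverse> + d\<inverse>\<rangle>\<close>.\<close>
lemma mu_relation:
  assumes c: "c \<in> Sym_D" "c \<noteq> 0" and d: "d \<in> Sym_D" "d \<noteq> 0" and cd: "c + d \<noteq> 0"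
  obtains b where "b \<in> Sym_D" "b \<noteq> 0" "mu c + mu d = mu (c + d) + mu b"
proof -
  obtain i where i: "i \<in> Sym_D" "c * i = e" "i * c = e" using Sym_D_inverse[OF c] .
  obtain j where j: "j \<in> Sym_D" "d * j = e" "j * d = e" using Sym_D_inverse[OF d] .
  note D = Sym_DD(1)[OF c(1)] Sym_DD(1)[OF d(1)] Sym_DD(1)[OF i(1)] Sym_DD(1)[OF j(1)]
  have plus: "c + d \<in> Sym_D" "i + j \<in> Sym_D"
    using c d i j D_add by (auto simp: Sym_D_def star_add)
  have nz: "i + j \<noteq> 0"
  proof
    assume "i + j = 0"
    have "i * (c + d) * j = i * c * j + i * (d * j)" by (simp add: distrib_left distrib_right mult.assoc)
    also have "\<dots> = i + j" using i(3) j(2) D_unit[OF D(3)] D_unit[OF D(4)] by (simp add: add.commute)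
    finally have "i * ((c + d) * j) = 0" using \<open>i + j = 0\<close> by (simp add: mult.assoc)
    moreover have "i \<noteq> 0" "j \<noteq> 0" using i(2) j(2) e_nz by auto
    ultimately show False
      using D_no_zero_divisors cd D_add[OF D(1,2)] corner_mult D by metis
  qed
  have "mu (c + d) + mu (i + j) = mu c + mu d"
    unfolding mu_def
  \<comment> \<open>As i and j are the inverses of c and d, the mixed terms at x + i y and x - j y
    cancel each other.\<close>
  proof (rule sgn_form_isometry[OF lsub_D lsub_D lsub_D lsub_D sform_herm[OF plus(1)] sform_herm[OF plus(2)]
        sform_herm[OF c(1)] sform_herm[OF d(1)], where f = "\<lambda>x y. x + i * y" and g = "\<lambda>x y. x - j * y"])
    fix x y assume xy: "x \<in> D" "y \<in> D"
    have iy: "i * y \<in> D" "j * y \<in> D" using corner_mult D xy by auto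
    have p: "x + i * y \<in> D" "x - j * y \<in> D"
      using iy xy D_add subspace_diff[OF subspace_corner] by blast+
    then show "x + i * y \<in> D \<and> x - j * y \<in> D" by blast
    show "x = 0 \<and> y = 0" if "x + i * y = 0" "x - j * y = 0"
    proof -
      have "(i + j) * y = (x + i * y) - (x - j * y)" by (simp add: distrib_right)
      then have "(i + j) * y = 0" using that by simp
      then have "y = 0" using D_no_zero_divisors[OF D_add[OF D(3,4)] xy(2) _ nz] by blast
      then show ?thesis using that by simp
    qed
    have a: "c * (i * y) = y" "d * (j * y) = y" "i * (c * x) = x" "j * (d * x) = x"
      using i j D_unit(1) xy by (simp_all flip: mult.assoc)
    let ?z = "\<sigma> (x + i * y) * (c * (x + i * y))" and ?w = "\<sigma> (x - j * y) * (d * (x - j * y))"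
    have zw: "?z \<in> D" "?w \<in> D"
      using herm_arg[OF p(1) p(1) D(1)] herm_arg[OF p(2) p(2) D(2)] .
    have "?z = \<sigma> x * (c * x) + \<sigma> x * y + \<sigma> y * x + \<sigma> y * (i * y)"
      using a Sym_DD(2)[OF i(1)] by (simp add: star_add star_mult distrib_left distrib_right mult.assoc add_ac)
    moreover have "?w = \<sigma> x * (d * x) - \<sigma> x * y - \<sigma> y * x + \<sigma> y * (j * y)"
      using a Sym_DD(2)[OF j(1)]
      by (simp add: star_diff star_mult left_diff_distrib right_diff_distrib mult.assoc algebra_simps)
    ultimately have "?z + ?w = \<sigma> x * ((c + d) * x) + \<sigma> y * ((i + j) * y)"
      by (simp add: distrib_left distrib_right)
    then have "\<phi> ?z + \<phi> ?w = \<phi> (\<sigma> x * ((c + d) * x)) + \<phi> (\<sigma> y * ((i + j) * y))"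
      using proj_add zw herm_arg[OF xy(1,1)] herm_arg[OF xy(2,2)] D_add D by metis
    then show "herm c (x + i * y) (x + i * y) + herm d (x - j * y) (x - j * y) = herm (c + d) x x + herm (i + j) y y"
      by (simp add: herm_def)
  qed (auto simp: distrib_left scale_mult_right algebra_simps scale_right_distrib scale_right_diff_distrib)
  then show ?thesis using that[OF plus(2) nz] by simp
qed

text \<open>Z consists of 0 and the elements of maximal signature. If c and d are maximal,
  \<open>mu_relation\<close> forces c + d to be maximal or 0. Since the maximum is positive,
  negation leaves Z.\<close>

lemma positive_cone_corner:
  obtains Z where "Z \<subseteq> Sym_D" "0 \<in> Z" "\<And>c d. c \<in> Z \<Longrightarrow> d \<in> Z \<Longrightarrow> c + d \<in> Z"
    "\<And>x d. x \<in> D \<Longrightarrow> d \<in> Z \<Longrightarrow> \<sigma> x * d * x \<in> Z" "\<And>d. d \<in> Z \<Longrightarrow> - d \<in> Z \<Longrightarrow> d = 0"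
    "\<exists>d\<in>Z. d \<noteq> 0" "\<And>u d. scale u e \<in> P \<Longrightarrow> d \<in> Z \<Longrightarrow> scale u d \<in> Z"
proof -
  let ?ok = "\<lambda>d. d \<in> Sym_D \<and> d \<noteq> 0"
  have zero: "mu 0 = 0"
    using mu_minus[of 0] D_scale[OF e_in_D, of 0] by (simp add: Sym_D_def star_zero)
  obtain w where w: "w \<in> Sym_D" "mu w \<noteq> 0" using signature_nonzero by (auto simp: mu_def)
  then have wnz: "w \<noteq> 0" using zero by auto
  have neg: "- d \<in> Sym_D" if "d \<in> Sym_D" for d
    using that subspace_neg[OF subspace_corner] by (auto simp: Sym_D_def star_minus)
  have "nat (mu d) < Suc (dim D)" for d
    using sgn_form_bound[OF lsub_D, of "herm d"] by (simp add: mu_def)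
  then obtain m where m: "?ok m" "\<And>d. ?ok d \<Longrightarrow> nat (mu d) \<le> nat (mu m)"
    using ex_has_greatest_nat[of ?ok w "\<lambda>d. nat (mu d)" "Suc (dim D)"] w(1) wnz by blast
  have pos: "mu m > 0"
    using m(2)[of w] m(2)[of "- w"] mu_minus[OF w(1)] w neg[OF w(1)] wnz by auto
  have max: "mu d \<le> mu m" if "d \<in> Sym_D" "d \<noteq> 0" for d
    using m(2)[of d] that pos by auto
  define Z where "Z = {d\<in>Sym_D. d = 0 \<or> mu d = mu m}"
  have z0: "0 \<in> Sym_D" using D_scale[OF e_in_D, of 0] by (simp add: Sym_D_def star_zero)
  show ?thesis
  proof (rule that[of Z])
    show "Z \<subseteq> Sym_D" "0 \<in> Z" using z0 by (auto simp: Z_def)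
    show "\<exists>d\<in>Z. d \<noteq> 0" using m by (auto simp: Z_def)
    show "d = 0" if "d \<in> Z" "- d \<in> Z" for d
      using that mu_minus[of d] pos by (auto simp: Z_def)
    show "c + d \<in> Z" if cd: "c \<in> Z" "d \<in> Z" for c d
    proof (cases "c = 0 \<or> d = 0")
      case False
      then have c: "c \<in> Sym_D" "c \<noteq> 0" "mu c = mu m" and d: "d \<in> Sym_D" "d \<noteq> 0" "mu d = mu m"
        using cd by (auto simp: Z_def)
      have sum: "c + d \<in> Sym_D" using c d D_add by (auto simp: Sym_D_def star_add)
      show ?thesis
      proof (cases "c + d = 0")
        case True
        then show ?thesis using z0 by (simp add: Z_def)
      next
        case False
        obtain b where "b \<in> Sym_D" "b \<noteq> 0" "mu c + mu d = mu (c + d) + mu b"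
          using mu_relation[OF c(1,2) d(1,2) False] .
        then show ?thesis using max[of b] max[OF sum False] c(3) d(3) sum by (auto simp: Z_def)
      qed
    qed (use cd in auto)
    show "\<sigma> x * d * x \<in> Z" if "x \<in> D" "d \<in> Z" for x d
      using that mu_congruence[of d x] z0 by (cases "x = 0") (auto simp: Z_def)
    show "scale u d \<in> Z" if "scale u e \<in> P" "d \<in> Z" for u d
      using that mu_scale[of d u] z0 D_scale by (cases "u = 0") (auto simp: Z_def Sym_D_def star_scale)
  qed
qed

text \<open>The cone of the corner is pulled back along all compressions a -> e \<sigma>(x) a x e.
  If a and -a both belong to the result, every compression of a is 0, and polarization together with
  primeness gives a = 0.\<close>

lemma prepositive_cone_exists: "\<exists>\<P>. prepositive_cone scale \<sigma> \<P>"
proof -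
  obtain Z where Z: "Z \<subseteq> Sym_D" "0 \<in> Z" "\<And>c d. c \<in> Z \<Longrightarrow> d \<in> Z \<Longrightarrow> c + d \<in> Z"
    "\<And>x d. x \<in> D \<Longrightarrow> d \<in> Z \<Longrightarrow> \<sigma> x * d * x \<in> Z" "\<And>d. d \<in> Z \<Longrightarrow> - d \<in> Z \<Longrightarrow> d = 0"
    "\<exists>d\<in>Z. d \<noteq> 0" "\<And>u d. scale u e \<in> P \<Longrightarrow> d \<in> Z \<Longrightarrow> scale u d \<in> Z"
    by (rule positive_cone_corner) (rule that; assumption)
  define \<P> where "\<P> = {a. \<sigma> a = a \<and> (\<forall>x. e * (\<sigma> x * a * x) * e \<in> Z)}"
  have add: "a + b \<in> \<P>" if "a \<in> \<P>" "b \<in> \<P>" for a b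
  proof -
    have "e * (\<sigma> x * (a + b) * x) * e = e * (\<sigma> x * a * x) * e + e * (\<sigma> x * b * x) * e" for x
      by (simp add: distrib_left distrib_right)
    then show ?thesis using that Z(3) by (simp add: \<P>_def star_add)
  qed
  have congr: "\<sigma> b * a * b \<in> \<P>" if "a \<in> \<P>" for a b
  proof -
    have "e * (\<sigma> x * (\<sigma> b * a * b) * x) * e = e * (\<sigma> (b * x) * a * (b * x)) * e" for x
      by (simp add: star_mult mult.assoc)
    moreover have "e * (\<sigma> (b * x) * a * (b * x)) * e \<in> Z" for x
      using that unfolding \<P>_def by blast
    moreover have "\<sigma> (\<sigma> b * a * b) = \<sigma> b * a * b"
      using that by (simp add: \<P>_def star_mult star_star mult.assoc)
    ultimately show ?thesis unfolding \<P>_def mem_Collect_eq by metis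
  qed
  have scl: "scale u a \<in> \<P>" if "scale u e \<in> P" "a \<in> \<P>" for u a
    using that Z(7) by (simp add: \<P>_def star_scale scale_mult_left scale_mult_right)
  have anti: "a = 0" if a: "a \<in> \<P>" "- a \<in> \<P>" for a
  proof (rule ccontr)
    assume nz: "a \<noteq> 0"
    have sa: "\<sigma> a = a" using a by (simp add: \<P>_def)
    have diag: "e * (\<sigma> x * a * x) * e = 0" for x
      using a Z(5)[of "e * (\<sigma> x * a * x) * e"] by (simp add: \<P>_def)
    have off: "e * (\<sigma> x * a * y) * e + e * (\<sigma> y * a * x) * e = 0" for x y
      using diag[of "x + y"] diag[of x] diag[of y] by (simp add: star_add distrib_left distrib_right add_ac)
    have "e * (\<sigma> x * a * y) * e = 0" for x y
    proof (rule ccontr)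
      let ?z = "e * (\<sigma> x * a * y) * e"
      assume "?z \<noteq> 0"
      moreover have "?z \<in> D"
        using e_idem by (simp add: corner_def mult.assoc) (simp flip: mult.assoc)
      ultimately obtain t where t: "t \<in> D" "?z * t = e" using corner_inverse by blast
      \<comment> \<open>With t inverse to the mixed compression, both mixed terms for x and y e t
        become \<open>e\<close>, and e + e is not 0.\<close>
      have "e * (\<sigma> x * a * (y * e * t)) * e = ?z * t"
        using D_unit(2)[OF t(1)] by (simp add: mult.assoc)
      moreover have "e * (\<sigma> (y * e * t) * a * x) * e = \<sigma> (?z * t)"
        using D_unit(1)[OF D_star[OF t(1)]]
        by (simp add: star_mult star_star sa e_star mult.assoc flip: mult.assoc[of e "\<sigma> t"])
      ultimately have "e + e = 0" using off[of x "y * e * t"] t(2) e_star by simp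
      then have "scale 2 e = 0" by (metis one_add_one scale_left_distrib scale_one)
      then show False using two_nonzero e_nz by simp
    qed
    moreover obtain x where "e * x * a \<noteq> 0" using prime_ring[OF e_nz nz] by blast
    then obtain y where "e * x * a * y * e \<noteq> 0" using prime_ring[OF _ e_nz] by blast
    ultimately show False using star_star[of x] by (metis mult.assoc)
  qed
  have ZP: "d \<in> \<P>" if d: "d \<in> Z" for d
  proof -
    have sd: "\<sigma> d = d" "d \<in> D" using Z(1) d Sym_DD by blast+
    have "e * (\<sigma> x * d * x) * e = \<sigma> (e * x * e) * d * (e * x * e)" for x
    proof -
      have "d = e * d * e" using D_unit[OF sd(2)] by simp
      then show ?thesis by (metis e_idem e_star mult.assoc star_mult)
    qed
    moreover have "e * x * e \<in> D" for x
      using e_idem by (simp add: corner_def mult.assoc) (simp flip: mult.assoc)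
    ultimately show ?thesis using Z(4) d sd(1) by (simp add: \<P>_def)
  qed
  have field: "u \<in> cone_field scale \<P>" if "scale u e \<in> P" for u
    using scl that by (simp add: cone_field_def)
  obtain d where d: "d \<in> Z" "d \<noteq> 0" using Z(6) by blast
  have "prepositive_cone scale \<sigma> \<P>"
  proof (rule prepositive_coneI[OF _ add congr anti ZP[OF d(1)] d(2)])
    show "u \<in> cone_field scale \<P> \<or> - u \<in> cone_field scale \<P>" for u
      using P_total[OF L_scaled[OF L_e, of u]] field[of u] field[of "- u"] by auto
  qed (auto simp: \<P>_def)
  then show ?thesis by blast
qed

end

context definite_star_algebra
begin

theorem formally_real_if_definite: "formally_real scale \<sigma>"
proof -
  obtain e where e: "\<sigma> e = e" "e * e = e" "e \<noteq> 0"
    "\<And>x. x \<in> corner e \<Longrightarrow> x \<noteq> 0 \<Longrightarrow> \<exists>y\<in>corner e. x * y = e \<and> y * x = e"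
    using division_corner_exists by metis
  interpret division_corner scale Basis \<sigma> e
    by unfold_locales (use e in auto)
  obtain L where "max_commuting L" using max_commuting_exists by blast
  then interpret max_symmetric_subfield scale Basis \<sigma> e L
    by unfold_locales
  obtain P where P: "ordered_subfield scale Basis L P e" "sums_of_norms \<subseteq> P" by (rule ordering_exists)
  interpret ordered_subfield scale Basis L P e by (rule P(1))
  interpret ordered_corner scale Basis \<sigma> e L P
    by unfold_locales (rule P(2))
  obtain \<phi> where "trace_form scale Basis \<sigma> e L P \<phi>"
  proof (rule bimodule_projection)
    fix \<phi>
    assume *: "\<And>x y. x \<in> D \<Longrightarrow> y \<in> D \<Longrightarrow> \<phi> (x + y) = \<phi> x + \<phi> y" "\<And>x. x \<in> D \<Longrightarrow> \<phi> x \<in> L"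
      "\<And>x t. x \<in> D \<Longrightarrow> t \<in> L \<Longrightarrow> \<phi> (t * x) = t * \<phi> x" "\<And>x. x \<in> D \<Longrightarrow> \<phi> (\<sigma> x) = \<phi> x"
      "\<And>t. t \<in> L \<Longrightarrow> \<phi> t = t"
    have "trace_form scale Basis \<sigma> e L P \<phi>"
      by unfold_locales (rule *; assumption)+
    then show thesis by (rule that)
  qed
  then interpret trace_form scale Basis \<sigma> e L P \<phi> .
  show ?thesis
    unfolding formally_real_def by (rule prepositive_cone_exists)
qed

end

section \<open>Units in prepositive cones\<close>

context star_algebra
begin

text \<open>Brauer's argument: let I be a minimal nonzero right ideal inside z A. Primeness gives x
  in I with x I nonzero, so x I = I and x = x f for some f in I. The elements of I killed by x form
  a smaller right ideal, which is therefore 0, and it contains f f - f.\<close>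

lemma idempotent_in_right_ideal:
  fixes z :: 'a
  assumes "z \<noteq> 0"
  obtains r where "z * r * (z * r) = z * r" "z * r \<noteq> 0"
proof -
  define rideal where "rideal I \<longleftrightarrow> subspace I \<and> (\<forall>x\<in>I. \<forall>a. x * a \<in> I) \<and> (\<exists>x\<in>I. x \<noteq> 0)" for I :: "'a set"
  have gen1: "subspace ((*) x ` I)" if "subspace I" for x I
  proof -
    interpret T: Vector_Spaces.linear scale scale "\<lambda>y. x * y" by (rule linear_left)
    show ?thesis using T.subspace_image[OF that] .
  qed
  have gen2: "y * a \<in> (*) x ` I" if "\<And>y a. y \<in> I \<Longrightarrow> y * a \<in> I" "y \<in> (*) x ` I" for x y a and I :: "'a set"
    using that by (auto simp: mult.assoc)
  let ?A = "\<lambda>I. rideal I \<and> I \<subseteq> range ((*) z)"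
  have "?A (range ((*) z))"
    using gen1[of UNIV z] gen2[of UNIV _ z] assms unfolding rideal_def by (auto intro!: exI[of _ 1])
  then obtain I where I: "?A I" and min: "\<And>J. ?A J \<Longrightarrow> dim I \<le> dim J"
    using ex_has_least_nat[of ?A _ dim] by metis
  have sub: "subspace I" "\<And>x a. x \<in> I \<Longrightarrow> x * a \<in> I" using I by (auto simp: rideal_def)
  have min': "J = I" if "rideal J" "J \<subseteq> I" for J
    using subspace_dim_equal[of J I] min[of J] that I by (auto simp: rideal_def)
  obtain y where y: "y \<in> I" "y \<noteq> 0" using I by (auto simp: rideal_def)
  obtain a where a: "y * a * y \<noteq> 0" using prime_ring[OF y(2,2)] by blast
  define x where "x = y * a"
  have x: "x \<in> I" "x * y \<noteq> 0" using sub y a by (auto simp: x_def)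
  have "(*) x ` I = I"
  proof (rule min')
    show "rideal ((*) x ` I)"
      unfolding rideal_def
    proof (intro conjI ballI allI)
      show "\<exists>w\<in>(*) x ` I. w \<noteq> 0" using y(1) x(2) by blast
    qed (rule gen1[OF sub(1)], rule gen2[OF sub(2)])
    show "(*) x ` I \<subseteq> I" using x(1) sub(2) by blast
  qed
  then obtain f where f: "f \<in> I" "x = x * f" using x(1) by blast
  have ker: "i = 0" if i: "i \<in> I" "x * i = 0" for i
  proof (rule ccontr)
    assume nz: "i \<noteq> 0"
    have "rideal {i\<in>I. x * i = 0}"
      unfolding rideal_def
    proof (intro conjI ballI allI)
      show "subspace {i\<in>I. x * i = 0}"
        using sub(1) unfolding subspace_def by (auto simp: distrib_left scale_mult_right)
    qed (use sub(2) i nz in \<open>auto simp flip: mult.assoc\<close>)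
    then have "{i\<in>I. x * i = 0} = I" by (rule min') auto
    then show False using y(1) x(2) by blast
  qed
  have "x * (f * f - f) = (x * f) * f - x * f" by (simp add: right_diff_distrib mult.assoc)
  also have "\<dots> = 0" using f(2) by simp
  finally have "f * f - f = 0"
    using ker subspace_diff[OF sub(1) sub(2)[OF f(1), of f] f(1)] by blast
  then have "f * f = f" by simp
  moreover have "f \<noteq> 0" using f(2) x(2) by auto
  moreover obtain r where "f = z * r" using I f(1) by blast
  ultimately show ?thesis using that by blast
qed

lemma coneD:
  assumes "prepositive_cone scale \<sigma> \<P>"
  shows "c \<in> \<P> \<Longrightarrow> \<sigma> c = c" "c \<in> \<P> \<Longrightarrow> d \<in> \<P> \<Longrightarrow> c + d \<in> \<P>" "c \<in> \<P> \<Longrightarrow> \<sigma> a * c * a \<in> \<P>"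
    "c \<in> \<P> \<Longrightarrow> - c \<in> \<P> \<Longrightarrow> c = 0" "0 \<in> \<P>"
    "c \<in> \<P> \<Longrightarrow> d \<in> \<P> \<Longrightarrow> c + d = 0 \<Longrightarrow> c = 0"
proof -
  note * = assms[unfolded prepositive_cone_def]
  show "c \<in> \<P> \<Longrightarrow> \<sigma> c = c" "c \<in> \<P> \<Longrightarrow> d \<in> \<P> \<Longrightarrow> c + d \<in> \<P>" "c \<in> \<P> \<Longrightarrow> \<sigma> a * c * a \<in> \<P>" "0 \<in> \<P>"
    using * by (auto simp: Sym_def)
  have anti: "c = 0" if "c \<in> \<P>" "- c \<in> \<P>" for c
  proof -
    have "c \<in> \<P> \<inter> uminus ` \<P>" using that by (metis IntI add.inverse_inverse imageI)
    then show ?thesis using * by simp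
  qed
  then show "c \<in> \<P> \<Longrightarrow> - c \<in> \<P> \<Longrightarrow> c = 0" .
  show "c = 0" if "c \<in> \<P>" "d \<in> \<P>" "c + d = 0"
    using anti[OF that(1)] that(2,3) by (simp add: add_eq_0_iff)
qed

text \<open>Isotropic vectors of a positive \<open>c\<close> are orthogonal to each other; a non-degenerate
  isotropic \<open>x\<close> would lie in a hyperbolic plane, which has non-orthogonal isotropic vectors.\<close>
lemma cone_isotropic:
  assumes P: "prepositive_cone scale \<sigma> \<P>" and two: "(2::'f) \<noteq> 0" and c: "c \<in> \<P>" and x: "\<sigma> x * c * x = 0"
  shows "c * x = 0"
proof -
  note C = coneD[OF P]
  have sc: "\<sigma> c = c" using C(1) c .
  \<comment> \<open>If x and y are isotropic, the value at y + x t is z t + \<sigma>(z t). It is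
    additive in t, so its values at r and -r are opposite and must be 0. The nonzero idempotent z r
    would then be skew, although \<sigma>(z r) is idempotent too.\<close>
  have orth: "\<sigma> y * c * x = 0" if y: "\<sigma> y * c * y = 0" for y
  proof (rule ccontr)
    define z where "z = \<sigma> y * c * x"
    assume "\<sigma> y * c * x \<noteq> 0"
    then obtain r where r: "z * r * (z * r) = z * r" "z * r \<noteq> 0"
      using idempotent_in_right_ideal z_def by metis
    have sz: "\<sigma> z = \<sigma> x * c * y" by (simp add: z_def star_mult star_star sc mult.assoc)
    have "\<sigma> (y + x * t) * c * (y + x * t) = z * t + \<sigma> (z * t)" for t
    proof -
      have "\<sigma> (y + x * t) * c * (y + x * t) = \<sigma> y * c * y + z * t + \<sigma> t * \<sigma> z + \<sigma> t * (\<sigma> x * c * x) * t"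
        unfolding sz z_def by (simp add: star_add star_mult star_star sc distrib_left distrib_right mult.assoc add_ac)
      then show ?thesis using x y by (simp add: star_mult)
    qed
    then have in_cone: "z * t + \<sigma> (z * t) \<in> \<P>" for t using C(3)[OF c, of "y + x * t"] by metis
    have "- (z * r + \<sigma> (z * r)) \<in> \<P>" using in_cone[of "- r"] by (simp add: star_minus add.commute)
    then have z0: "z * r + \<sigma> (z * r) = 0" using in_cone[of r] C(4) by blast
    then have s: "\<sigma> (z * r) = - (z * r)" by (simp add: add_eq_0_iff)
    have "\<sigma> (z * r) = \<sigma> (z * r) * \<sigma> (z * r)" using star_mult[of "z * r" "z * r"] r(1) by simp
    also have "\<dots> = z * r" using s r(1) by simp
    finally have "z * r + z * r = 0" using z0 by simp
    then have "scale 2 (z * r) = 0" by (metis one_add_one scale_left_distrib scale_one)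
    then show False using r(2) two by simp
  qed
  have "\<sigma> y * c * x = 0" for y
  proof (rule ccontr)
    define z where "z = \<sigma> y * c * x"
    assume "\<sigma> y * c * x \<noteq> 0"
    then obtain r where r: "z * r * (z * r) = z * r" "z * r \<noteq> 0"
      using idempotent_in_right_ideal z_def by metis
    define e where "e = z * r"
    have e: "e * e = e" "e \<noteq> 0" using r by (auto simp: e_def)
    define w where "w = \<sigma> y * c * y"
    have sw: "\<sigma> w = w" by (simp add: w_def star_mult star_star sc mult.assoc)
    have sz: "\<sigma> z = \<sigma> x * c * y" by (simp add: z_def star_mult star_star sc mult.assoc)
    define v where "v = e * w * \<sigma> e"
    have sv: "\<sigma> v = v" by (simp add: v_def star_mult star_star sw mult.assoc)
    \<comment> \<open>This t makes y \<sigma>(e) + x t isotropic: each of the two mixed terms is -v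
      / 2, and together they cancel the value v at y \<sigma>(e).\<close>
    define t where "t = scale (- 1 / 2) (r * v)"
    have ezr: "e * (z * (r * v)) = v"
    proof -
      have "e * (z * (r * v)) = e * e * v" by (simp add: e_def mult.assoc)
      also have "\<dots> = v" using e(1) by (simp add: v_def flip: mult.assoc)
      finally show ?thesis .
    qed
    have ezt: "e * z * t = scale (- 1 / 2) v"
      using ezr by (simp add: t_def scale_mult_right mult.assoc)
    have "\<sigma> (y * \<sigma> e + x * t) * c * (y * \<sigma> e + x * t) =
        e * w * \<sigma> e + e * z * t + \<sigma> (e * z * t) + \<sigma> t * (\<sigma> x * c * x) * t"
      unfolding w_def by (simp add: star_add star_mult star_star sz distrib_left distrib_right mult.assoc add_ac) (simp add: z_def mult.assoc)
    also have "\<dots> = v + scale (- 1 / 2) v + scale (- 1 / 2) v"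
      using x ezt sv by (simp add: star_scale star_minus v_def)
    also have "\<dots> = scale (1 + - 1 / 2 + - 1 / 2) v"
      by (simp only: scale_left_distrib scale_one)
    also have "1 + - 1 / 2 + - 1 / 2 = (0::'f)" using two by (simp add: field_simps)
    finally have "\<sigma> (y * \<sigma> e + x * t) * c * (y * \<sigma> e + x * t) = 0" by simp
    then have "\<sigma> (y * \<sigma> e + x * t) * c * x = 0" by (rule orth)
    moreover have "\<sigma> (y * \<sigma> e + x * t) * c * x = e * z + \<sigma> t * (\<sigma> x * c * x)"
      by (simp add: star_add star_mult star_star z_def distrib_right mult.assoc)
    ultimately have "e * z = 0" using x by simp
    then have "e * (z * r) = 0" by (simp flip: mult.assoc)
    then show False using e by (simp add: e_def)
  qed
  from this[of 1] show ?thesis by (simp add: star_one)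
qed

text \<open>Let c have the smallest annihilator in the cone. If c x = 0 with x nonzero, primeness
  gives a with d a x nonzero, and the annihilator of c + \<sigma>(a) d a is contained in that of c
  but misses x. So left multiplication by c is injective, hence bijective.\<close>

lemma cone_has_unit:
  assumes P: "prepositive_cone scale \<sigma> \<P>" and two: "(2::'f) \<noteq> 0"
  obtains c where "c \<in> \<P>" "c \<in> Sym_units \<sigma>"
proof -
  note C = coneD[OF P]
  \<comment> \<open>If the cone were {0}, all scalars would preserve it and (P4) would fail.\<close>
  have "\<exists>d\<in>\<P>. d \<noteq> 0"
  proof (rule ccontr)
    assume "\<not> ?thesis"
    then have "\<P> \<subseteq> {0}" by blast
    then have "1 \<in> cone_field scale \<P>" "- 1 \<in> cone_field scale \<P>" by (auto simp: cone_field_def)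
    then have "(1::'f) \<in> cone_field scale \<P> \<inter> uminus ` cone_field scale \<P>" by (metis IntI add.inverse_inverse imageI)
    moreover have "cone_field scale \<P> \<inter> uminus ` cone_field scale \<P> = {0}"
      using P by (simp add: prepositive_cone_def field_ordering_def)
    ultimately show False by simp
  qed
  then obtain d where d: "d \<in> \<P>" "d \<noteq> 0" by blast
  define ann where "ann c = {x. c * x = 0}" for c :: 'a
  have ann: "subspace (ann c)" for c
    unfolding subspace_def ann_def by (auto simp: distrib_left scale_mult_right)
  obtain c where c: "c \<in> \<P>" and min: "\<And>b. b \<in> \<P> \<Longrightarrow> dim (ann c) \<le> dim (ann b)"
    using ex_has_least_nat[of "\<lambda>c. c \<in> \<P>" d "\<lambda>c. dim (ann c)"] d(1) by blast
  have inj0: "x = 0" if x: "c * x = 0" for x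
  proof (rule ccontr)
    assume "x \<noteq> 0"
    then obtain a where a: "d * a * x \<noteq> 0" using prime_ring[OF d(2)] by blast
    define b where "b = c + \<sigma> a * d * a"
    have b: "b \<in> \<P>" unfolding b_def using C(2)[OF c C(3)[OF d(1)]] .
    have split: "c * y = 0 \<and> d * (a * y) = 0" if y: "b * y = 0" for y
    proof -
      have "\<sigma> y * c * y + \<sigma> (a * y) * d * (a * y) = \<sigma> y * (b * y)"
        by (simp add: b_def star_mult distrib_left distrib_right mult.assoc)
      then have sum: "\<sigma> y * c * y + \<sigma> (a * y) * d * (a * y) = 0" using y by simp
      then have "\<sigma> y * c * y = 0" using C(6) C(3)[OF c] C(3)[OF d(1)] by blast
      then show ?thesis
        using sum cone_isotropic[OF P two c] cone_isotropic[OF P two d(1)] by simp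
    qed
    then have "ann b \<subseteq> ann c" by (auto simp: ann_def)
    then have "ann b = ann c"
      using subspace_dim_equal[OF ann ann] min[OF b] by blast
    moreover have "x \<in> ann c" using x by (simp add: ann_def)
    ultimately have "b * x = 0" by (auto simp: ann_def)
    then show False using split a by (simp add: mult.assoc)
  qed
  have "inj (\<lambda>x. c * x)"
    using inj0 by (intro injI) (metis eq_iff_diff_eq_0 right_diff_distrib)
  then have "surj (\<lambda>x. c * x)" by (rule linear_inj_imp_surj[OF linear_left])
  then obtain i where i: "c * i = 1" by (metis surjD)
  have "c * (i * c - 1) = 0" using i by (simp add: right_diff_distrib flip: mult.assoc)
  then have "i * c = 1" using inj0 by fastforce
  then have "c \<in> Sym_units \<sigma>"
    using i C(1)[OF c] by (auto simp: Sym_units_def Sym_def)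
  then show ?thesis using that c by blast
qed

lemma sum_in_cone:
  assumes P: "prepositive_cone scale \<sigma> \<P>" and "finite A" "\<And>i. i \<in> A \<Longrightarrow> f i \<in> \<P>"
  shows "sum f A \<in> \<P>" "sum f A = 0 \<Longrightarrow> i \<in> A \<Longrightarrow> f i = 0"
proof -
  note C = coneD[OF P]
  have s: "sum f B \<in> \<P>" if "B \<subseteq> A" for B
    using finite_subset[OF that assms(2)] that
    by (induction B rule: finite_induct) (use assms(3) C in auto)
  then show "sum f A \<in> \<P>" by blast
  show "f i = 0" if "sum f A = 0" "i \<in> A"
    using C(6)[OF assms(3)[OF that(2)] s[of "A - {i}"]] sum.remove[OF assms(2) that(2), of f] that by auto
qed

lemma cone_genI:
  assumes "k \<ge> (1::nat)" "\<And>i. i \<in> {1..k} \<Longrightarrow> u i \<in> P" "y = (\<Sum>i\<in>{1..k}. scale (u i) (\<sigma> (x i) * a * x i))"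
  shows "y \<in> cone_gen scale \<sigma> P a"
  unfolding cone_gen_def by (intro CollectI exI[of _ k] exI[of _ u] exI[of _ x] conjI ballI assms)

lemma cone_genE:
  assumes "y \<in> cone_gen scale \<sigma> P a"
  obtains k u x where "y = (\<Sum>i\<in>{1..k::nat}. scale (u i) (\<sigma> (x i) * a * x i))" "k \<ge> 1" "\<forall>i\<in>{1..k}. u i \<in> P"
  using assms unfolding cone_gen_def mem_Collect_eq by (elim exE conjE) (rule that)

text \<open>The generated cone stays inside the given one and inherits (P5).\<close>

lemma cone_gen_proper:
  assumes P: "prepositive_cone scale \<sigma> \<P>" and c: "c \<in> \<P>"
  shows "cone_gen scale \<sigma> (cone_field scale \<P>) c \<inter> uminus ` cone_gen scale \<sigma> (cone_field scale \<P>) c = {0}"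
proof -
  note C = coneD[OF P]
  have "cone_gen scale \<sigma> (cone_field scale \<P>) c \<subseteq> \<P>"
  proof
    fix y assume "y \<in> cone_gen scale \<sigma> (cone_field scale \<P>) c"
    then obtain k u x where y: "y = (\<Sum>i\<in>{1..k::nat}. scale (u i) (\<sigma> (x i) * c * x i))" "k \<ge> 1"
      "\<forall>i\<in>{1..k}. u i \<in> cone_field scale \<P>" by (rule cone_genE)
    show "y \<in> \<P>" unfolding y(1)
      by (rule sum_in_cone(1)[OF P]) (use y(3) C(3)[OF c] in \<open>auto simp: cone_field_def\<close>)
  qed
  moreover have "0 \<in> cone_gen scale \<sigma> (cone_field scale \<P>) c"
    by (rule cone_genI[of "1::nat" "\<lambda>i. 0"]) (use C(5) in \<open>auto simp: cone_field_def\<close>)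
  moreover have "\<P> \<inter> uminus ` \<P> \<subseteq> {0}"
    using C(4) by auto
  moreover have "0 \<in> uminus ` G" if "0 \<in> G" for G :: "'a set"
    using that by (intro image_eqI[of _ _ 0]) auto
  ultimately show ?thesis by (intro equalityI) (meson Int_mono image_mono order_trans, simp)
qed

text \<open>The summands lie in the cone and add up to 0, so each of them is 0. By
  \<open>cone_isotropic\<close>, c kills every entry of the vector, and c is invertible.\<close>

lemma unit_strongly_anisotropic:
  assumes P: "prepositive_cone scale \<sigma> \<P>" and two: "(2::'f) \<noteq> 0" and c: "c \<in> \<P>" "c \<in> Sym_units \<sigma>"
  shows "strongly_anisotropic UNIV (rank_one_form \<sigma> c)"
  unfolding strongly_anisotropic_def isotropic_def
proof (intro allI impI notI)
  fix l :: nat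
  assume "\<exists>v\<in>multiple_module l UNIV. v \<noteq> 0 \<and> multiple_form l (rank_one_form \<sigma> c) v v = 0"
  then obtain v where v: "\<And>i. i \<notin> {1..l} \<Longrightarrow> v i = 0" "v \<noteq> 0" "(\<Sum>i\<in>{1..l}. \<sigma> (v i) * c * v i) = 0"
    by (auto simp: multiple_module_def multiple_form_def rank_one_form_def)
  obtain j where j: "j * c = 1" using c(2) by (auto simp: Sym_units_def)
  have "v i = 0" for i
  proof (cases "i \<in> {1..l}")
    case True
    have "\<sigma> (v i) * c * v i = 0"
      using sum_in_cone(2)[OF P, of "{1..l}" "\<lambda>i. \<sigma> (v i) * c * v i"] v(3) True coneD(3)[OF P c(1)] by blast
    then have "c * v i = 0" by (rule cone_isotropic[OF P two c(1)])
    then have "j * c * v i = 0" by (simp add: mult.assoc)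
    then show ?thesis using j by simp
  qed (rule v(1))
  then show False using v(2) by (simp add: fun_eq_iff)
qed

lemma cone_gen_add:
  assumes "p \<in> cone_gen scale \<sigma> P a" "q \<in> cone_gen scale \<sigma> P a"
  shows "p + q \<in> cone_gen scale \<sigma> P a"
proof -
  obtain k u x where 1: "p = (\<Sum>i\<in>{1..k::nat}. scale (u i) (\<sigma> (x i) * a * x i))" "k \<ge> 1" "\<forall>i\<in>{1..k}. u i \<in> P"
    using assms(1) by (rule cone_genE)
  obtain l w y where 2: "q = (\<Sum>i\<in>{1..l::nat}. scale (w i) (\<sigma> (y i) * a * y i))" "l \<ge> 1" "\<forall>i\<in>{1..l}. w i \<in> P"
    using assms(2) by (rule cone_genE)
  \<comment> \<open>Indices up to k belong to p; the later ones are shifted by k and belong to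
    q.\<close>
  define u' where "u' i = (if i \<le> k then u i else w (i - k))" for i
  define x' where "x' i = (if i \<le> k then x i else y (i - k))" for i
  let ?f = "\<lambda>i. scale (u' i) (\<sigma> (x' i) * a * x' i)"
  have "sum ?f {1..k + l} = sum ?f {1..k} + sum ?f {k + 1..k + l}"
    by (rule sum.ub_add_nat) simp
  also have "sum ?f {k + 1..k + l} = sum ?f {1 + k..l + k}" by (simp add: add.commute)
  also have "\<dots> = (\<Sum>i\<in>{1..l}. ?f (i + k))" by (rule sum.shift_bounds_cl_nat_ivl)
  also have "\<dots> = q" unfolding 2(1) by (rule sum.cong) (auto simp: u'_def x'_def)
  also have "sum ?f {1..k} = p" unfolding 1(1) by (rule sum.cong) (auto simp: u'_def x'_def)
  finally have "p + q = sum ?f {1..k + l}" by simp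
  moreover have "u' i \<in> P" if "i \<in> {1..k + l}" for i
  proof (cases "i \<le> k")
    case False
    then have "i - k \<in> {1..l}" using that by auto
    then show ?thesis using 2(3) False by (simp add: u'_def)
  qed (use 1(3) that in \<open>auto simp: u'_def\<close>)
  ultimately show ?thesis using cone_genI[of "k + l" u' P _ x'] 1(2) by simp
qed

text \<open>The set \<open>cone_gen scale \<sigma> P a\<close> is itself a prepositive cone: P
  multiplies it into itself, and totality of P yields (P4).\<close>

lemma formally_real_if_cone_gen:
  assumes a: "a \<in> Sym_units \<sigma>" and P: "field_ordering P"
    and proper: "cone_gen scale \<sigma> P a \<inter> uminus ` cone_gen scale \<sigma> P a = {0}"
  shows "formally_real scale \<sigma>"
proof -
  let ?G = "cone_gen scale \<sigma> P a"
  have sa: "\<sigma> a = a" and anz: "a \<noteq> 0" using a by (auto simp: Sym_units_def Sym_def)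
  have Pmult: "\<And>x y. x \<in> P \<Longrightarrow> y \<in> P \<Longrightarrow> x * y \<in> P" and Ptot: "x \<in> P \<or> - x \<in> P" for x
  proof -
    have "x \<in> P \<union> uminus ` P" using P by (simp add: field_ordering_def)
    then show "x \<in> P \<or> - x \<in> P" by auto
  qed (use P in \<open>simp add: field_ordering_def\<close>)
  have P1: "1 \<in> P" using Ptot[of 1] Pmult[of "- 1" "- 1"] by auto
  have anti: "c = 0" if "c \<in> ?G" "- c \<in> ?G" for c
  proof -
    have "c \<in> ?G \<inter> uminus ` ?G" using that by (metis IntI add.inverse_inverse imageI)
    then show ?thesis using proper by simp
  qed
  have aG: "a \<in> ?G"
    by (rule cone_genI[of "1::nat" "\<lambda>i. 1" P _ "\<lambda>i. 1"]) (use P1 star_one in auto)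
  have scl: "scale p c \<in> ?G" if pc: "p \<in> P" "c \<in> ?G" for p c
  proof -
    obtain k u x where 1: "c = (\<Sum>i\<in>{1..k::nat}. scale (u i) (\<sigma> (x i) * a * x i))" "k \<ge> 1" "\<forall>i\<in>{1..k}. u i \<in> P"
      using pc(2) by (rule cone_genE)
    then have "scale p c = (\<Sum>i\<in>{1..k}. scale (p * u i) (\<sigma> (x i) * a * x i))"
      by (simp add: scale_sum_right)
    then show ?thesis using cone_genI[of k "\<lambda>i. p * u i"] 1(2,3) Pmult[OF pc(1)] by blast
  qed
  have congr: "\<sigma> b * c * b \<in> ?G" if c: "c \<in> ?G" for b c
  proof -
    obtain k u x where 1: "c = (\<Sum>i\<in>{1..k::nat}. scale (u i) (\<sigma> (x i) * a * x i))" "k \<ge> 1" "\<forall>i\<in>{1..k}. u i \<in> P"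
      using c by (rule cone_genE)
    then have "\<sigma> b * c * b = (\<Sum>i\<in>{1..k}. scale (u i) (\<sigma> (x i * b) * a * (x i * b)))"
      by (simp add: sum_distrib_left sum_distrib_right scale_mult_left scale_mult_right star_mult mult.assoc)
    then show ?thesis using cone_genI[of k u P _ "\<lambda>i. x i * b"] 1(2,3) by blast
  qed
  have sym: "\<sigma> c = c" if c: "c \<in> ?G" for c
  proof -
    obtain k u x where 1: "c = (\<Sum>i\<in>{1..k::nat}. scale (u i) (\<sigma> (x i) * a * x i))"
      using c by (rule cone_genE) (rule that)
    have "\<sigma> (sum f A) = sum f A" if "finite A" "\<And>i. i \<in> A \<Longrightarrow> \<sigma> (f i) = f i" for f :: "nat \<Rightarrow> 'a" and A
      using that by (induction A rule: finite_induct) (simp_all add: star_zero star_add)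
    then show ?thesis unfolding 1 by (simp add: star_scale star_mult star_star sa mult.assoc)
  qed
  have "prepositive_cone scale \<sigma> ?G"
  proof (rule prepositive_coneI[OF sym cone_gen_add congr anti aG anz])
    show "u \<in> cone_field scale ?G \<or> - u \<in> cone_field scale ?G" for u
      using Ptot[of u] scl unfolding cone_field_def by blast
  qed
  then show ?thesis unfolding formally_real_def by blast
qed

text \<open>The form \<open>\<langle>b\<rangle>\<^sub>\<sigma>\<close> is definite if and only if the adjoint involution \<open>x \<mapsto> b\<inverse> \<sigma>(x) b\<close> is, and
  multiplication by \<open>b\<close> transports prepositive cones from the latter involution to \<open>\<sigma>\<close>.\<close>
lemma formally_real_if_strongly_anisotropic:
  assumes b: "b \<in> Sym_units \<sigma>" and an: "strongly_anisotropic UNIV (rank_one_form \<sigma> b)"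
  shows "formally_real scale \<sigma>"
proof -
  have sb: "\<sigma> b = b" using b by (simp add: Sym_units_def Sym_def)
  obtain i where i: "b * i = 1" "i * b = 1" using b by (auto simp: Sym_units_def)
  have "\<sigma> i * b = 1" using star_mult[of b i] i(1) sb star_one by simp
  then have si: "\<sigma> i = i" using i by (metis mult.assoc mult_1_left mult_1_right)
  have bi: "b * (i * x) = x" "i * (b * x) = x" for x using i by (simp_all flip: mult.assoc)
  define \<tau> where "\<tau> x = i * \<sigma> x * b" for x
  interpret tau: definite_star_algebra scale Basis \<tau>
  proof unfold_locales
    fix xs :: "'a list" and x
    assume sum: "(\<Sum>x\<leftarrow>xs. \<tau> x * x) = 0" and x: "x \<in> set xs"
    define l where "l = length xs"
    \<comment> \<open>Vectors are indexed from 1, lists from 0.\<close>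
    define v where "v k = (if k \<in> {1..l} then xs ! (k - 1) else 0)" for k
    \<comment> \<open>Multiplication by b turns \<tau>(x) x into \<sigma>(x) b x.\<close>
    have "b * (\<Sum>x\<leftarrow>xs. \<tau> x * x) = (\<Sum>x\<leftarrow>xs. \<sigma> x * b * x)"
      by (induction xs) (simp_all add: \<tau>_def distrib_left bi mult.assoc)
    then have "0 = (\<Sum>k<l. \<sigma> (xs ! k) * b * xs ! k)"
      using sum by (simp add: sum_list_sum_nth l_def lessThan_atLeast0)
    also have "\<dots> = (\<Sum>k\<in>{1..l}. \<sigma> (v k) * b * v k)"
      by (rule sum.reindex_bij_witness[of _ "\<lambda>k. k - 1" Suc]) (auto simp: v_def)
    finally have "multiple_form l (rank_one_form \<sigma> b) v v = 0"
      by (simp add: multiple_form_def rank_one_form_def)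
    moreover have "l \<ge> 1" using x by (cases xs) (auto simp: l_def)
    moreover have "v \<in> multiple_module l UNIV" by (simp add: multiple_module_def v_def)
    ultimately have v0: "v = 0"
      using an unfolding strongly_anisotropic_def isotropic_def by blast
    obtain k where "k < l" "x = xs ! k" using x by (auto simp: l_def in_set_conv_nth)
    then have "x = v (Suc k)" by (simp add: v_def)
    then show "x = 0" using v0 by simp
  next
    fix x y :: 'a assume "x \<noteq> 0" "y \<noteq> 0"
    then show "\<exists>a. x * a * y \<noteq> 0" by (rule prime_ring)
  qed (simp_all add: \<tau>_def star_add star_mult star_scale star_star sb si bi distrib_left distrib_right
      scale_mult_left scale_mult_right mult.assoc i)
  obtain \<P> where P: "prepositive_cone scale \<tau> \<P>"
    using tau.formally_real_if_definite by (auto simp: formally_real_def)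
  let ?Q = "(*) b ` \<P>"
  note T = tau.coneD[OF P]
  have mem: "b * x \<in> ?Q \<longleftrightarrow> x \<in> \<P>" for x
    using bi(2) by (metis image_iff)
  have field: "cone_field scale ?Q = cone_field scale \<P>"
    using mem by (auto simp: cone_field_def simp flip: scale_mult_right)
  have "prepositive_cone scale \<sigma> ?Q"
    unfolding prepositive_cone_def
  proof (intro conjI ballI allI)
    show "?Q \<subseteq> Sym \<sigma>"
    proof
      fix y assume "y \<in> ?Q"
      then obtain x where x: "x \<in> \<P>" "y = b * x" by blast
      have "i * (\<sigma> x * b) = x" using T(1)[OF x(1)] by (simp add: \<tau>_def mult.assoc)
      then have "\<sigma> x * b = b * x" using bi(1) by metis
      then show "y \<in> Sym \<sigma>" using x(2) by (simp add: Sym_def star_mult sb)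
    qed
    show "?Q \<noteq> {}" using T(5) by blast
    show "field_ordering (cone_field scale ?Q)"
      unfolding field using P by (simp add: prepositive_cone_def)
    show "?Q \<inter> uminus ` ?Q = {0}"
    proof (intro equalityI subsetI)
      fix y assume "y \<in> ?Q \<inter> uminus ` ?Q"
      then obtain x z where xz: "x \<in> \<P>" "z \<in> \<P>" "y = b * x" "y = - (b * z)" by blast
      then have "b * x = b * (- z)" by simp
      then have "x = - z" using bi(2) by metis
      then have "x = 0" using T(4)[OF xz(1)] xz(2) by simp
      then show "y \<in> {0}" using xz(3) by simp
    qed (use T(5) in \<open>auto intro!: image_eqI[of _ _ 0]\<close>)
  next
    fix y z assume "y \<in> ?Q" "z \<in> ?Q"
    then show "y + z \<in> ?Q" using T(2) mem by (auto simp flip: distrib_left)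
  next
    fix a y assume "y \<in> ?Q"
    then obtain x where x: "x \<in> \<P>" "y = b * x" by blast
    have "\<sigma> a * y * a = b * (\<tau> a * x * a)"
      using x(2) by (simp add: \<tau>_def bi mult.assoc)
    then show "\<sigma> a * y * a \<in> ?Q" using T(3)[OF x(1)] by blast
  qed
  then show ?thesis unfolding formally_real_def by blast
qed

end

section \<open>Simple algebras with involution and the equivalence of the three conditions\<close>

context algebra_with_involution
begin

lemma involution_scale: "\<sigma> (scale c x) = scale c (\<sigma> x)"
proof -
  have "scale c 1 \<in> center \<inter> Sym \<sigma>" using base_field by blast
  then have "\<sigma> (scale c 1) = scale c 1" by (simp add: Sym_def)
  moreover have "scale c x = scale c 1 * x" by (simp add: scale_mult_left)
  ultimately have "\<sigma> (scale c x) = \<sigma> x * scale c 1" by (simp add: involution_mult)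
  then show ?thesis by (simp add: scale_mult_right)
qed

text \<open>The elements y with x A y = 0 form a two-sided ideal that does not contain 1, so by
  simplicity it is 0.\<close>

lemma prime_multiplication:
  fixes x y :: 'a
  assumes "x \<noteq> 0" "y \<noteq> 0"
  shows "\<exists>a. x * a * y \<noteq> 0"
proof (rule ccontr)
  assume not: "\<not> ?thesis"
  define I where "I = {y. \<forall>a. x * a * y = 0}"
  have "two_sided_ideal I"
    unfolding two_sided_ideal_def I_def
  proof (intro conjI allI ballI CollectI)
    fix a y b assume "y \<in> {y. \<forall>a. x * a * y = 0}"
    then have "x * (b * a) * y = 0" "x * b * y = 0" by auto
    then show "x * b * (a * y) = 0" "x * b * (y * a) = 0" by (simp_all add: mult.assoc flip: mult.assoc[of _ y a])
  qed (auto simp: distrib_left)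
  then have "I = {0} \<or> I = UNIV" by (rule simple)
  moreover have "y \<in> I" using not by (simp add: I_def)
  ultimately have "1 \<in> I" using assms(2) by auto
  then have "x * 1 * 1 = 0" unfolding I_def by blast
  then show False using assms(1) by simp
qed

lemma star_algebra_exists: "\<exists>Basis. star_algebra scale Basis \<sigma>"
proof -
  obtain B where B: "finite B" "span B = UNIV" using finite_dimensional by blast
  obtain Basis where C: "Basis \<subseteq> B" "independent Basis" "B \<subseteq> span Basis"
    using maximal_independent_subset[of B] by blast
  have "span Basis = UNIV" using B(2) C(3) by (metis span_minimal subspace_span top.extremum_uniqueI)
  then have "star_algebra scale Basis \<sigma>"
    by unfold_locales
      (use C(2) finite_subset[OF C(1) B(1)] prime_multiplication in
        \<open>auto simp: scale_mult_left scale_mult_right involution_add involution_mult involution_self_inverse involution_scale\<close>)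
  then show ?thesis by blast
qed

end

theorem theorem7p9:
  fixes scale :: "'f::field \<Rightarrow> 'a::ring_1 \<Rightarrow> 'a" and \<sigma> :: "'a \<Rightarrow> 'a"
  assumes "CHAR('f) \<noteq> 2"
    and "algebra_with_involution scale \<sigma>"
  shows "(formally_real scale \<sigma> \<longleftrightarrow>
            (\<exists>a\<in>Sym_units \<sigma>. \<exists>P. field_ordering P \<and>
               cone_gen scale \<sigma> P a \<inter> uminus ` cone_gen scale \<sigma> P a = {0})) \<and>
         (formally_real scale \<sigma> \<longleftrightarrow>
            (\<exists>b\<in>Sym_units \<sigma>. strongly_anisotropic UNIV (rank_one_form \<sigma> b)))"
proof -
  interpret algebra_with_involution scale \<sigma> by (rule assms(2))
  obtain Basis where "star_algebra scale Basis \<sigma>" using star_algebra_exists by blast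
  then interpret star: star_algebra scale Basis \<sigma> .
  have two: "(2::'f) \<noteq> 0"
  proof
    assume "(2::'f) = 0"
    then have "CHAR('f) dvd 2" using of_nat_eq_0_iff_char_dvd[where 'a = 'f, of 2] by simp
    then have "CHAR('f) = 1" using assms(1) by (metis dvd_antisym numeral_2_eq_2 prime_nat_iff two_is_prime_nat)
    then show False using of_nat_eq_0_iff_char_dvd[where 'a = 'f, of 1] by simp
  qed
  have "(\<exists>a\<in>Sym_units \<sigma>. \<exists>P. field_ordering P \<and> cone_gen scale \<sigma> P a \<inter> uminus ` cone_gen scale \<sigma> P a = {0}) \<and>
      (\<exists>b\<in>Sym_units \<sigma>. strongly_anisotropic UNIV (rank_one_form \<sigma> b))"
    if real: "formally_real scale \<sigma>"
  proof -
    obtain \<P> where P: "prepositive_cone scale \<sigma> \<P>" using real by (auto simp: formally_real_def)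
    \<comment> \<open>One unit c of the cone serves as a in (2) and as b in (3).\<close>
    obtain c where c: "c \<in> \<P>" "c \<in> Sym_units \<sigma>" by (rule star.cone_has_unit[OF P two])
    have "field_ordering (cone_field scale \<P>)" using P by (simp add: prepositive_cone_def)
    then show ?thesis
      using star.cone_gen_proper[OF P c(1)] star.unit_strongly_anisotropic[OF P two c] c(2) by blast
  qed
  moreover have "formally_real scale \<sigma>"
    if "\<exists>a\<in>Sym_units \<sigma>. \<exists>P. field_ordering P \<and> cone_gen scale \<sigma> P a \<inter> uminus ` cone_gen scale \<sigma> P a = {0}"
    using that by (elim bexE exE conjE) (rule star.formally_real_if_cone_gen)
  moreover have "formally_real scale \<sigma>"
    if "\<exists>b\<in>Sym_units \<sigma>. strongly_anisotropic UNIV (rank_one_form \<sigma> b)"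
    using that by (elim bexE) (rule star.formally_real_if_strongly_anisotropic)
  ultimately show ?thesis by (intro conjI iffI) (simp_all only:)
qed

end
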